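(* Let $\nu\ge2$, $p\in(1,\infty)$ and let $0<r<\rho<R$ satisfy $R^\nu-r^\nu=\rho^\nu$. Set $B_\rho:=\{x\in\mathbb{R}^\nu:|x|<\rho\}$ and $U_{r,R}:=\{x\in\mathbb{R}^\nu:r<|x|<R\}$, so that $B_\rho$ and $U_{r,R}$ have the same volume. Then for all sufficiently large $\alpha>0$, $$\Lambda(B_\rho,p,\alpha)<\Lambda(U_{r,R},p,\alpha).$$ In particular, balls do not maximize $\Lambda(\Omega,p,\alpha)$ among the domains $\Omega$ of a fixed volume (for such $\alpha$).
   Context: For a domain $\Omega\subset\mathbb{R}^\nu$, $p\in(1,\infty)$ and $\alpha>0$, $$\Lambda(\Omega,p,\alpha):=\inf_{u\in W^{1,p}(\Omega),\ u\not\equiv 0}\frac{\int_\Omega|\nabla u|^p\,\mathrm{d}x-\alpha\int_{\partial\Omega}|u|^p\,\mathrm{d}\sigma}{\int_\Omega|u|^p\,\mathrm{d}x},$$ where $\mathrm{d}\sigma$ is the surface measure on $\partial\Omega$. *)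

theory Defs
  imports "HOL-Analysis.Analysis"
begin

section \<open>Surface measure\<close>

text \<open>Hausdorff outer measure of dimension \<open>s \<ge> 1\<close> by Caratheodory's construction, without a
  normalising constant.\<close>

definition hausdorff_premeasure :: "nat \<Rightarrow> real \<Rightarrow> 'a::metric_space set \<Rightarrow> ennreal" where
  "hausdorff_premeasure s \<delta> A =
     (INF C \<in> {C :: nat \<Rightarrow> 'a set. A \<subseteq> (\<Union>i. C i) \<and> (\<forall>i. bounded (C i) \<and> diameter (C i) \<le> \<delta>)}.
        \<Sum>i. ennreal (diameter (C i) ^ s))"

definition hausdorff_outer :: "nat \<Rightarrow> 'a::metric_space set \<Rightarrow> ennreal" where
  "hausdorff_outer s A = (SUP \<delta>\<in>{0<..}. hausdorff_premeasure s \<delta> A)"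

definition hausdorff_measure :: "nat \<Rightarrow> 'a::metric_space measure" where
  "hausdorff_measure s = measure_of UNIV (sets borel) (hausdorff_outer s)"

text \<open>A unit cube of dimension \<open>DIM('a) - 1\<close>; by symmetry the choice of the face is immaterial.\<close>

definition unit_facet :: "'a::euclidean_space set" where
  "unit_facet = {x \<in> cbox 0 One. x \<bullet> (SOME b. b \<in> Basis) = 0}"

text \<open>The surface measure on \<open>\<partial>\<Omega>\<close> is the Hausdorff measure of codimension one, normalised to
  agree with Lebesgue measure on hyperplanes: the unit cube of a hyperplane gets measure \<open>1\<close>.\<close>

definition surface_measure :: "'a::euclidean_space set \<Rightarrow> 'a measure" where
  "surface_measure \<Omega> =
     restrict_space
       (scale_measure (1 / emeasure (hausdorff_measure (DIM('a) - 1)) (unit_facet :: 'a set))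
          (hausdorff_measure (DIM('a) - 1)))
       (frontier \<Omega>)"

section \<open>Sobolev functions and traces\<close>

definition Lp_space :: "'b measure \<Rightarrow> real \<Rightarrow> ('b \<Rightarrow> 'c::{banach, second_countable_topology}) set" where
  "Lp_space M p = {f \<in> borel_measurable M. integrable M (\<lambda>x. norm (f x) powr p)}"

definition locally_integrable_on ::
    "('a::euclidean_space \<Rightarrow> 'c::{banach, second_countable_topology}) \<Rightarrow> 'a set \<Rightarrow> bool" where
  "locally_integrable_on f \<Omega> \<longleftrightarrow> (\<forall>K. compact K \<and> K \<subseteq> \<Omega> \<longrightarrow> integrable (lebesgue_on K) f)"

definition C1_with_gradient ::
    "'a::euclidean_space set \<Rightarrow> ('a \<Rightarrow> real) \<Rightarrow> ('a \<Rightarrow> 'a) \<Rightarrow> bool" where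
  "C1_with_gradient W \<phi> D\<phi> \<longleftrightarrow> (\<forall>x\<in>W. GDERIV \<phi> x :> D\<phi> x) \<and> continuous_on W D\<phi>"

text \<open>Weak derivatives are tested against \<open>C\<^sup>1\<close> functions with compact support in \<open>\<Omega>\<close>, as in
  Gilbarg and Trudinger; by mollification this is the same as testing against smooth ones.\<close>

definition has_weak_gradient ::
    "'a::euclidean_space set \<Rightarrow> ('a \<Rightarrow> real) \<Rightarrow> ('a \<Rightarrow> 'a) \<Rightarrow> bool" where
  "has_weak_gradient \<Omega> u G \<longleftrightarrow>
     locally_integrable_on u \<Omega> \<and> locally_integrable_on G \<Omega> \<and>
     (\<forall>\<phi> D\<phi>. C1_with_gradient UNIV \<phi> D\<phi> \<and> (\<exists>K. compact K \<and> K \<subseteq> \<Omega> \<and> (\<forall>x. x \<notin> K \<longrightarrow> \<phi> x = 0)) \<longrightarrow>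
        (LINT x|lebesgue_on \<Omega>. u x *\<^sub>R D\<phi> x) = - (LINT x|lebesgue_on \<Omega>. \<phi> x *\<^sub>R G x))"

definition sobolev_space :: "'a::euclidean_space set \<Rightarrow> real \<Rightarrow> ('a \<Rightarrow> real) set" where
  "sobolev_space \<Omega> p =
     {u \<in> Lp_space (lebesgue_on \<Omega>) p. \<exists>G \<in> Lp_space (lebesgue_on \<Omega>) p. has_weak_gradient \<Omega> u G}"

text \<open>Well-defined up to null sets of the open set \<open>\<Omega>\<close>.\<close>

definition weak_gradient :: "'a::euclidean_space set \<Rightarrow> ('a \<Rightarrow> real) \<Rightarrow> ('a \<Rightarrow> 'a)" where
  "weak_gradient \<Omega> u = (SOME G. has_weak_gradient \<Omega> u G)"

text \<open>\<open>g\<close> is the boundary trace of \<open>u\<close>: it is the limit in \<open>L\<^sup>p(\<partial>\<Omega>)\<close> of the restrictions to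
  \<open>\<partial>\<Omega>\<close> of \<open>C\<^sup>1\<close> functions that converge to \<open>u\<close> in \<open>W\<^sup>1\<^sup>,\<^sup>p(\<Omega>)\<close>.\<close>

definition is_trace ::
    "'a::euclidean_space set \<Rightarrow> real \<Rightarrow> ('a \<Rightarrow> real) \<Rightarrow> ('a \<Rightarrow> real) \<Rightarrow> bool" where
  "is_trace \<Omega> p u g \<longleftrightarrow>
     g \<in> Lp_space (surface_measure \<Omega>) p \<and>
     (\<exists>v Dv. (\<forall>k::nat. C1_with_gradient UNIV (v k) (Dv k)) \<and>
        (\<lambda>k. \<integral>\<^sup>+x. ennreal (\<bar>v k x - u x\<bar> powr p) \<partial>lebesgue_on \<Omega>) \<longlonglongrightarrow> 0 \<and>
        (\<lambda>k. \<integral>\<^sup>+x. ennreal (norm (Dv k x - weak_gradient \<Omega> u x) powr p) \<partial>lebesgue_on \<Omega>) \<longlonglongrightarrow> 0 \<and>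
        (\<lambda>k. \<integral>\<^sup>+x. ennreal (\<bar>v k x - g x\<bar> powr p) \<partial>surface_measure \<Omega>) \<longlonglongrightarrow> 0)"

text \<open>On a bounded Lipschitz domain every \<open>u\<close> in \<open>W\<^sup>1\<^sup>,\<^sup>p(\<Omega>)\<close> has a trace, unique up to
  \<open>\<sigma>\<close>-null sets, so the default value \<open>0\<close> only makes the function total.\<close>

definition boundary_trace :: "'a::euclidean_space set \<Rightarrow> real \<Rightarrow> ('a \<Rightarrow> real) \<Rightarrow> ('a \<Rightarrow> real)" where
  "boundary_trace \<Omega> p u = (if \<exists>g. is_trace \<Omega> p u g then SOME g. is_trace \<Omega> p u g else (\<lambda>_. 0))"

section \<open>The Robin eigenvalue\<close>

definition robin_quotient :: "'a::euclidean_space set \<Rightarrow> real \<Rightarrow> real \<Rightarrow> ('a \<Rightarrow> real) \<Rightarrow> real" where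
  "robin_quotient \<Omega> p \<alpha> u =
     ((LINT x|lebesgue_on \<Omega>. norm (weak_gradient \<Omega> u x) powr p)
        - \<alpha> * (LINT x|surface_measure \<Omega>. \<bar>boundary_trace \<Omega> p u x\<bar> powr p))
     / (LINT x|lebesgue_on \<Omega>. \<bar>u x\<bar> powr p)"

text \<open>The infimum is taken in the extended reals, so that unboundedness from below gives \<open>-\<infinity>\<close>.\<close>

definition robin_Lambda :: "'a::euclidean_space set \<Rightarrow> real \<Rightarrow> real \<Rightarrow> ereal" where
  "robin_Lambda \<Omega> p \<alpha> =
     (INF u \<in> {u \<in> sobolev_space \<Omega> p. \<not> (AE x in lebesgue_on \<Omega>. u x = 0)}.
        ereal (robin_quotient \<Omega> p \<alpha> u))"

definition bounded_C1_domain :: "'a::euclidean_space set \<Rightarrow> bool" where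
  "bounded_C1_domain \<Omega> \<longleftrightarrow>
     open \<Omega> \<and> connected \<Omega> \<and> bounded \<Omega> \<and> \<Omega> \<noteq> {} \<and>
     (\<forall>x\<in>frontier \<Omega>. \<exists>N \<phi> D\<phi>. open N \<and> x \<in> N \<and> C1_with_gradient N \<phi> D\<phi> \<and>
        (\<forall>y\<in>N. D\<phi> y \<noteq> 0) \<and> \<Omega> \<inter> N = {y \<in> N. \<phi> y < 0})"

end

theory Submission
  imports Defs
begin

text \<open>
  Write \<open>n\<close> for the dimension and put \<open>\<alpha> = \<beta>\<^sup>p\<^sup>-\<^sup>1\<close>.  For large \<open>\<alpha>\<close> an almost optimal function concentrates near
  the part of the boundary with the largest mean curvature and decays like \<open>e\<^sup>-\<^sup>\<beta>\<^sup>t\<close> at distance \<open>t\<close> from it.  Hence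
  \<open>\<Lambda> = -(p-1)\<beta>\<^sup>p - H \<beta>\<^sup>p\<^sup>-\<^sup>1 + o(\<beta>\<^sup>p\<^sup>-\<^sup>1)\<close>, where \<open>H\<close> is the maximum of the sum of the principal curvatures.  It is
  \<open>(n-1)/\<rho>\<close> for the ball, but only \<open>(n-1)/R\<close> for the shell, whose inner boundary is curved
  the other way.  As \<open>\<rho> < R\<close>, the ball has the smaller eigenvalue.

  Only an upper bound for the ball and a lower bound for the shell are needed.  The upper bound
  (\<open>robin_Lambda_ball_le\<close>) comes from the test function \<open>e\<^sup>\<beta>\<^sup>|\<^sup>x\<^sup>|\<close>, smoothed at the centre.  The lower bound
  (\<open>shell_trace_inequality\<close>, \<open>robin_Lambda_ge\<close>) comes from the divergence theorem: for a vector field \<open>F\<close> with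
  normal component at least \<open>\<alpha>\<close> on the boundary, \<open>\<alpha>\<close> times the integral of \<open>|w|\<^sup>p\<close> over the boundary is at most the
  integral of \<open>div (|w|\<^sup>p F)\<close>, and Young's inequality bounds the latter by that of
  \<open>|\<nabla>w|\<^sup>p + (div F + (p-1)|F|\<^sup>p\<^sup>') |w|\<^sup>p\<close> with the conjugate exponent \<open>p'\<close>.  A radial \<open>F = \<alpha> \<phi>(|x|) x/|x|\<close> is good
  enough.

  For radial fields the divergence theorem follows from polar coordinates and the fundamental theorem of
  calculus on rays (\<open>nn_integral_polar\<close>, \<open>annulus_trace_inequality\<close>).  It remains to identify the surface
  measure of a sphere, a normalised Hausdorff measure, with the area given by volumes of cones
  (\<open>nn_integral_area_measure_sphere\<close>).  This rests on the fact that uniformly distributed measures are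
  proportional (\<open>uniformly_distributed_proportional\<close>), applied to hyperplanes and to spheres; the factor is found
  by comparing small caps with flat discs.

  Finally the quotient is defined by arbitrary choices of a weak gradient and of a trace.  Weak gradients are
  unique almost everywhere (\<open>weak_gradient_unique\<close>), and the trace inequality on balls fixes the \<open>L\<^sup>p\<close>
  norm of the trace of the test function (\<open>boundary_trace_C1_ball\<close>).  On the shell it is enough that the
  inequality for \<open>C\<^sup>1\<close> functions passes to the limits in the definition of the trace
  (\<open>is_trace_inequality\<close>).
\<close>

section \<open>Hausdorff measure\<close>

lemma hausdorff_premeasure_le_cover:
  assumes "A \<subseteq> (\<Union>i. C i)" "\<And>i. bounded (C i)" "\<And>i. diameter (C i) \<le> \<delta>"
  shows "hausdorff_premeasure s \<delta> A \<le> (\<Sum>i. ennreal (diameter (C i) ^ s))"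
  unfolding hausdorff_premeasure_def using assms by (intro INF_lower) auto

lemma hausdorff_premeasure_mono: "A \<subseteq> B \<Longrightarrow> hausdorff_premeasure s \<delta> A \<le> hausdorff_premeasure s \<delta> B"
  unfolding hausdorff_premeasure_def by (intro INF_superset_mono) auto

lemma hausdorff_premeasure_antimono:
  "\<delta> \<le> \<epsilon> \<Longrightarrow> hausdorff_premeasure s \<epsilon> A \<le> hausdorff_premeasure s \<delta> A"
  unfolding hausdorff_premeasure_def by (intro INF_superset_mono) (auto intro: order_trans)

lemma hausdorff_premeasure_le_finite_cover:
  assumes s: "0 < s" and "0 \<le> \<delta>" and I: "finite I" and A: "A \<subseteq> (\<Union>i\<in>I. C i)"
    and C: "\<And>i. i \<in> I \<Longrightarrow> bounded (C i)" "\<And>i. i \<in> I \<Longrightarrow> diameter (C i) \<le> \<delta>"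
  shows "hausdorff_premeasure s \<delta> A \<le> (\<Sum>i\<in>I. ennreal (diameter (C i) ^ s))"
proof -
  obtain h where h: "bij_betw h {0..<card I} I"
    using ex_bij_betw_nat_finite[OF I] by auto
  define D where "D k = (if k < card I then C (h k) else {})" for k
  have hI: "h k \<in> I" if "k < card I" for k
    using h that by (auto simp: bij_betw_def)
  have "A \<subseteq> (\<Union>k. D k)"
  proof
    fix x assume "x \<in> A"
    then obtain i where i: "i \<in> I" "x \<in> C i" using A by auto
    then obtain k where "k < card I" "h k = i"
      using h unfolding bij_betw_def by (metis atLeastLessThan_iff imageE)
    then show "x \<in> (\<Union>k. D k)" using i by (auto simp: D_def intro!: exI[of _ k])
  qed
  then have "hausdorff_premeasure s \<delta> A \<le> (\<Sum>k. ennreal (diameter (D k) ^ s))"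
    by (rule hausdorff_premeasure_le_cover) (auto simp: D_def C hI assms(2))
  also have "\<dots> = (\<Sum>k\<in>{0..<card I}. ennreal (diameter (D k) ^ s))"
    by (rule suminf_finite) (use s in \<open>auto simp: D_def power_0_left\<close>)
  also have "\<dots> = (\<Sum>k\<in>{0..<card I}. ennreal (diameter (C (h k)) ^ s))"
    by (intro sum.cong) (auto simp: D_def)
  also have "\<dots> = (\<Sum>i\<in>I. ennreal (diameter (C i) ^ s))"
    using sum.reindex_bij_betw[OF h] by fastforce
  finally show ?thesis .
qed

lemma hausdorff_premeasure_UN:
  "hausdorff_premeasure s \<delta> (\<Union>n::nat. A n) \<le> (\<Sum>n. hausdorff_premeasure s \<delta> (A n))"
proof (rule ennreal_le_epsilon)
  fix e :: real
  assume fin: "(\<Sum>n. hausdorff_premeasure s \<delta> (A n)) < top" and e: "0 < e"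
  let ?P = "\<lambda>n. hausdorff_premeasure s \<delta> (A n)"
  have fin': "?P n < top" for n
    using fin ennreal_suminf_lessD by blast
  have "\<exists>C. A n \<subseteq> (\<Union>i. C i) \<and> (\<forall>i::nat. bounded (C i) \<and> diameter (C i) \<le> \<delta>) \<and>
      (\<Sum>i. ennreal (diameter (C i) ^ s)) \<le> ?P n + ennreal e * ennreal ((1/2) ^ Suc n)" for n
  proof -
    have "0 < ennreal e * ennreal ((1/2) ^ Suc n)"
      using e by (simp add: ennreal_zero_less_mult_iff)
    then have "?P n + 0 < ?P n + ennreal e * ennreal ((1/2) ^ Suc n)"
      unfolding ennreal_add_left_cancel_less using fin'[of n] by (simp add: less_top)
    then have "?P n < ?P n + ennreal e * ennreal ((1/2) ^ Suc n)"
      by simp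
    then show ?thesis
      unfolding hausdorff_premeasure_def[of s \<delta> "A n"] INF_less_iff
      by (auto intro: less_imp_le)
  qed
  then obtain C where C: "\<And>n. A n \<subseteq> (\<Union>i::nat. C n i)" "\<And>n i. bounded (C n i)" "\<And>n i. diameter (C n i) \<le> \<delta>"
    "\<And>n. (\<Sum>i. ennreal (diameter (C n i) ^ s)) \<le> ?P n + ennreal e * ennreal ((1/2) ^ Suc n)"
    by metis
  define D where "D k = (case prod_decode k of (n, i) \<Rightarrow> C n i)" for k
  have "(\<Union>n. A n) \<subseteq> (\<Union>k. D k)"
  proof
    fix x assume "x \<in> (\<Union>n. A n)"
    then obtain n i where "x \<in> C n i" using C(1) by blast
    then show "x \<in> (\<Union>k. D k)" by (auto simp: D_def intro!: exI[of _ "prod_encode (n, i)"])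
  qed
  then have "hausdorff_premeasure s \<delta> (\<Union>n. A n) \<le> (\<Sum>k. ennreal (diameter (D k) ^ s))"
    by (rule hausdorff_premeasure_le_cover) (auto simp: D_def C(2,3) split: prod.split)
  also have "\<dots> = (\<Sum>k. (\<lambda>(n,i). ennreal (diameter (C n i) ^ s)) (prod_decode k))"
    by (intro arg_cong[where f=suminf] ext) (auto simp: D_def split: prod.split)
  also have "\<dots> = (\<Sum>n. \<Sum>i. ennreal (diameter (C n i) ^ s))"
    by (rule suminf_ennreal_2dimen) simp
  also have "\<dots> \<le> (\<Sum>n. ?P n + ennreal e * ennreal ((1/2) ^ Suc n))"
    by (intro suminf_le C(4)) auto
  also have "\<dots> = (\<Sum>n. ?P n) + (\<Sum>n. ennreal e * ennreal ((1/2) ^ Suc n))"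
    by (subst suminf_add[symmetric]) auto
  also have "\<dots> = (\<Sum>n. ?P n) + e"
    unfolding ennreal_suminf_cmult
    by (subst suminf_ennreal_eq[OF zero_le_power power_half_series]) auto
  finally show "hausdorff_premeasure s \<delta> (\<Union>n. A n) \<le> (\<Sum>n. ?P n) + e" .
qed

lemma hausdorff_premeasure_le_outer: "0 < \<delta> \<Longrightarrow> hausdorff_premeasure s \<delta> A \<le> hausdorff_outer s A"
  unfolding hausdorff_outer_def by (intro SUP_upper) auto

lemma hausdorff_outer_leI:
  "(\<And>\<delta>. 0 < \<delta> \<Longrightarrow> hausdorff_premeasure s \<delta> A \<le> c) \<Longrightarrow> hausdorff_outer s A \<le> c"
  unfolding hausdorff_outer_def by (intro SUP_least) auto

lemma hausdorff_outer_mono: "A \<subseteq> B \<Longrightarrow> hausdorff_outer s A \<le> hausdorff_outer s B"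
  unfolding hausdorff_outer_def by (intro SUP_mono') (auto intro: hausdorff_premeasure_mono)

lemma hausdorff_outer_empty: "0 < s \<Longrightarrow> hausdorff_outer s {} = 0"
proof -
  assume s: "0 < s"
  have "hausdorff_outer s ({}::'a set) \<le> 0"
  proof (rule hausdorff_outer_leI)
    fix \<delta> :: real assume "0 < \<delta>"
    then show "hausdorff_premeasure s \<delta> ({}::'a set) \<le> 0"
      using hausdorff_premeasure_le_finite_cover[OF s, of \<delta> "{}" "{}" "\<lambda>_. {}"] by simp
  qed
  then show ?thesis by simp
qed

lemma hausdorff_outer_UN:
  "hausdorff_outer s (\<Union>n::nat. A n) \<le> (\<Sum>n. hausdorff_outer s (A n))"
proof (rule hausdorff_outer_leI)
  fix \<delta> :: real assume "0 < \<delta>"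
  then have "(\<Sum>n. hausdorff_premeasure s \<delta> (A n)) \<le> (\<Sum>n. hausdorff_outer s (A n))"
    by (intro suminf_le) (auto intro: hausdorff_premeasure_le_outer)
  then show "hausdorff_premeasure s \<delta> (\<Union>n. A n) \<le> (\<Sum>n. hausdorff_outer s (A n))"
    using hausdorff_premeasure_UN order_trans by blast
qed

lemma outer_measure_space_hausdorff:
  assumes "0 < s" shows "outer_measure_space UNIV (hausdorff_outer s)"
  unfolding outer_measure_space_def positive_def increasing_def countably_subadditive_def
  using hausdorff_outer_empty[OF assms] hausdorff_outer_mono hausdorff_outer_UN by auto

lemma hausdorff_outer_Un:
  assumes "0 < s" shows "hausdorff_outer s (A \<union> B) \<le> hausdorff_outer s A + hausdorff_outer s B"
proof -
  have "subadditive UNIV (hausdorff_outer s :: 'a set \<Rightarrow> _)"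
    using outer_measure_space_hausdorff[OF assms] unfolding outer_measure_space_def
    by (metis Pow_UNIV ring_of_sets.countably_subadditive_subadditive ring_of_sets_Pow)
  have "hausdorff_outer s (A \<union> B) = hausdorff_outer s (\<Union>n. binaryset A B n)"
    by (simp add: UN_binaryset_eq)
  also have "\<dots> \<le> (\<Sum>n. hausdorff_outer s (binaryset A B n))"
    by (rule hausdorff_outer_UN)
  also have "\<dots> = hausdorff_outer s A + hausdorff_outer s B"
    by (simp add: suminf_binaryset_eq hausdorff_outer_empty[OF assms])
  finally show ?thesis .
qed

text \<open>A covering set of diameter less than \<open>d\<close> meets at most one of \<open>A\<close> and \<open>B\<close>, so that every cover of
  the union splits into a cover of \<open>A\<close> and one of \<open>B\<close>.\<close>
lemma hausdorff_premeasure_separated: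
  assumes s: "0 < s" and d: "0 \<le> \<delta>" "\<delta> < d"
    and sep: "\<And>x y. x \<in> A \<Longrightarrow> y \<in> B \<Longrightarrow> d \<le> dist x y"
  shows "hausdorff_premeasure s \<delta> A + hausdorff_premeasure s \<delta> B \<le> hausdorff_premeasure s \<delta> (A \<union> B)"
proof -
  have "hausdorff_premeasure s \<delta> A + hausdorff_premeasure s \<delta> B \<le> (\<Sum>i. ennreal (diameter (C i) ^ s))"
    if C: "A \<union> B \<subseteq> (\<Union>i. C i)" "\<forall>i::nat. bounded (C i) \<and> diameter (C i) \<le> \<delta>" for C
  proof -
    define CA where "CA i = (if C i \<inter> A = {} then {} else C i)" for i
    define CB where "CB i = (if C i \<inter> B = {} then {} else C i)" for i
    have disj: "C i \<inter> A = {} \<or> C i \<inter> B = {}" for i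
    proof (rule ccontr)
      assume "\<not> ?thesis"
      then obtain x y where xy: "x \<in> C i" "x \<in> A" "y \<in> C i" "y \<in> B" by auto
      then have "dist x y \<le> \<delta>" using C(2) diameter_bounded_bound by (metis order_trans)
      with sep[OF xy(2,4)] d show False by simp
    qed
    have "hausdorff_premeasure s \<delta> A \<le> (\<Sum>i. ennreal (diameter (CA i) ^ s))"
      by (rule hausdorff_premeasure_le_cover; use C d in \<open>fastforce simp: CA_def\<close>)
    moreover have "hausdorff_premeasure s \<delta> B \<le> (\<Sum>i. ennreal (diameter (CB i) ^ s))"
      by (rule hausdorff_premeasure_le_cover; use C d in \<open>fastforce simp: CB_def\<close>)
    ultimately have "hausdorff_premeasure s \<delta> A + hausdorff_premeasure s \<delta> B
        \<le> (\<Sum>i. ennreal (diameter (CA i) ^ s)) + (\<Sum>i. ennreal (diameter (CB i) ^ s))"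
      by (rule add_mono)
    also have "\<dots> = (\<Sum>i. ennreal (diameter (CA i) ^ s) + ennreal (diameter (CB i) ^ s))"
      by (rule suminf_add) auto
    also have "\<dots> \<le> (\<Sum>i. ennreal (diameter (C i) ^ s))"
      by (intro suminf_le) (use disj s in \<open>auto simp: CA_def CB_def power_0_left\<close>)
    finally show ?thesis .
  qed
  then show ?thesis
    unfolding hausdorff_premeasure_def[of s \<delta> "A \<union> B"] by (intro INF_greatest) auto
qed

lemma hausdorff_outer_separated:
  assumes s: "0 < s" and d: "0 < d"
    and sep: "\<And>x y. x \<in> A \<Longrightarrow> y \<in> B \<Longrightarrow> d \<le> dist x y"
  shows "hausdorff_outer s A + hausdorff_outer s B \<le> hausdorff_outer s (A \<union> B)"
proof -
  have *: "hausdorff_premeasure s \<delta>1 A + hausdorff_premeasure s \<delta>2 B \<le> hausdorff_outer s (A \<union> B)"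
    if "0 < \<delta>1" "0 < \<delta>2" for \<delta>1 \<delta>2
  proof -
    define \<delta> where "\<delta> = min (min \<delta>1 \<delta>2) (d/2)"
    have \<delta>: "0 < \<delta>" "\<delta> < d" using that d by (auto simp: \<delta>_def)
    have "hausdorff_premeasure s \<delta>1 A + hausdorff_premeasure s \<delta>2 B
        \<le> hausdorff_premeasure s \<delta> A + hausdorff_premeasure s \<delta> B"
      by (intro add_mono hausdorff_premeasure_antimono) (auto simp: \<delta>_def)
    also have "\<dots> \<le> hausdorff_premeasure s \<delta> (A \<union> B)"
      by (rule hausdorff_premeasure_separated[OF s _ \<delta>(2) sep]) (use \<delta> in auto)
    also have "\<dots> \<le> hausdorff_outer s (A \<union> B)"
      by (rule hausdorff_premeasure_le_outer[OF \<delta>(1)])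
    finally show ?thesis .
  qed
  have "hausdorff_outer s A + hausdorff_premeasure s \<delta>2 B \<le> hausdorff_outer s (A \<union> B)" if "0 < \<delta>2" for \<delta>2
    unfolding hausdorff_outer_def[of s A]
    by (subst ennreal_SUP_add_left[symmetric]) (use * that in \<open>auto intro!: SUP_least\<close>)
  then show ?thesis
    unfolding hausdorff_outer_def[of s B]
    by (subst ennreal_SUP_add_right) (auto intro!: SUP_least)
qed

text \<open>The complement of \<open>F\<close> is exhausted by the sets at distance at least \<open>1/(k+1)\<close> from \<open>F\<close>.  The layers between consecutive distances have
  summable outer measure, because every other layer is separated from the union of the previous ones,
  so that the part of \<open>T - F\<close> close to \<open>F\<close> is negligible.\<close>
lemma hausdorff_outer_closed:
  fixes F T :: "'a::metric_space set"
  assumes s: "0 < s" and F: "closed F"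
  shows "hausdorff_outer s (T \<inter> F) + hausdorff_outer s (T - F) \<le> hausdorff_outer s T"
proof (cases "F = {} \<or> hausdorff_outer s T = top")
  case True
  then show ?thesis using hausdorff_outer_empty[OF s, where 'a='a] by auto
next
  case False
  define u where "u x = infdist x F" for x
  define a where "a k = 1 / (real k + 1)" for k
  have a_mono: "a (Suc k) < a k" for k by (simp add: a_def field_simps)
  have a_anti: "a l \<le> a k" if "k \<le> l" for k l using that by (simp add: a_def field_simps)
  have lip: "u x \<le> u y + dist x y" for x y unfolding u_def using infdist_triangle by auto
  define L where "L k = {x \<in> T. a (Suc k) \<le> u x \<and> u x < a k}" for k
  define E where "E m = {x \<in> T. a m \<le> u x}" for m
  \<comment> \<open>consecutive layers touch, so only those of one parity \<open>j\<close> are added up\<close>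
  have sum_le: "(\<Sum>k<N. hausdorff_outer s (L (2*k+j))) \<le> hausdorff_outer s (\<Union>k<N. L (2*k+j))" for N j
  proof (induction N)
    case 0 then show ?case by simp
  next
    case (Suc N)
    have "(\<Sum>k<Suc N. hausdorff_outer s (L (2*k+j)))
        \<le> hausdorff_outer s (\<Union>k<N. L (2*k+j)) + hausdorff_outer s (L (2*N+j))"
      using Suc by (auto intro: add_mono)
    also have "\<dots> \<le> hausdorff_outer s ((\<Union>k<N. L (2*k+j)) \<union> L (2*N+j))"
    proof (rule hausdorff_outer_separated[OF s])
      show "0 < (if N = 0 then 1 else a (2*N+j-1) - a (2*N+j))"
        using a_mono[of "2*N+j-1"] by auto
      fix x y assume "x \<in> (\<Union>k<N. L (2*k+j))" and y: "y \<in> L (2*N+j)"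
      then obtain k where k: "k < N" "x \<in> L (2*k+j)" by auto
      have "a (2*N+j-1) \<le> a (Suc (2*k+j))" using k by (intro a_anti) auto
      also have "\<dots> \<le> u x" using k by (auto simp: L_def)
      also have "\<dots> \<le> u y + dist x y" by (rule lip)
      also have "u y \<le> a (2*N+j)" using y by (auto simp: L_def)
      finally show "(if N = 0 then 1 else a (2*N+j-1) - a (2*N+j)) \<le> dist x y" using k by auto
    qed
    also have "(\<Union>k<N. L (2*k+j)) \<union> L (2*N+j) = (\<Union>k<Suc N. L (2*k+j))"
      by (auto simp: lessThan_Suc)
    finally show ?case .
  qed
  have sum_le': "(\<Sum>k<N. hausdorff_outer s (L (2*k+j))) \<le> hausdorff_outer s T" for N j
    using sum_le[of j N] by (rule order_trans) (intro hausdorff_outer_mono, auto simp: L_def)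
  have split: "(\<Sum>k<2*N. f k) = (\<Sum>k<N. f (2*k+0)) + (\<Sum>k<N. f (2*k+1))" for f :: "nat \<Rightarrow> ennreal" and N
    by (induction N) (auto simp: algebra_simps)
  define S where "S = (\<Sum>k. hausdorff_outer s (L k))"
  have "S \<le> 2 * hausdorff_outer s T"
    unfolding S_def
  proof (rule suminf_le_const)
    fix n
    have "(\<Sum>k<n. hausdorff_outer s (L k)) \<le> (\<Sum>k<2*n. hausdorff_outer s (L k))"
      by (intro sum_mono2) auto
    also have "\<dots> \<le> hausdorff_outer s T + hausdorff_outer s T"
      unfolding split by (intro add_mono sum_le')
    finally show "(\<Sum>k<n. hausdorff_outer s (L k)) \<le> 2 * hausdorff_outer s T"
      by (simp add: mult_2)
  qed simp
  then have S_fin: "S < top" using False by (auto simp: ennreal_mult_less_top top.not_eq_extremum intro: order_le_less_trans)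
  have tail: "hausdorff_outer s (T - F) \<le> hausdorff_outer s (E m) + (\<Sum>k. hausdorff_outer s (L (k + m)))" for m
  proof -
    have "T - F \<subseteq> E m \<union> (\<Union>k. L (k + m))"
    proof
      fix x assume x: "x \<in> T - F"
      then have pos: "0 < u x"
        using F False unfolding u_def by (metis DiffD2 in_closed_iff_infdist_zero infdist_nonneg order_le_less)
      obtain k0 where k0: "1 / (real k0 + 1) < u x"
        using pos by (metis nat_approx_posE of_nat_Suc add.commute)
      define k where "k = (LEAST k. a k \<le> u x)"
      have k: "a k \<le> u x" unfolding k_def by (rule LeastI[of _ k0]) (use k0 in \<open>simp add: a_def\<close>)
      show "x \<in> E m \<union> (\<Union>k. L (k + m))"
      proof (cases "k \<le> m")
        case True
        then show ?thesis using x a_anti[OF True] k by (auto simp: E_def)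
      next
        case False
        then obtain l where l: "k = Suc (l + m)" by (metis add.commute less_iff_Suc_add not_le)
        then have "\<not> a (l + m) \<le> u x" unfolding k_def using not_less_Least by (metis lessI)
        then have "x \<in> L (l + m)" using x k l by (auto simp: L_def)
        then show ?thesis by auto
      qed
    qed
    then have "hausdorff_outer s (T - F) \<le> hausdorff_outer s (E m \<union> (\<Union>k. L (k + m)))"
      by (rule hausdorff_outer_mono)
    also have "\<dots> \<le> hausdorff_outer s (E m) + hausdorff_outer s (\<Union>k. L (k + m))"
      by (rule hausdorff_outer_Un[OF s])
    also have "hausdorff_outer s (\<Union>k. L (k + m)) \<le> (\<Sum>k. hausdorff_outer s (L (k + m)))"
      by (rule hausdorff_outer_UN)
    finally show ?thesis by (simp add: add_left_mono)
  qed
  have sepE: "hausdorff_outer s (T \<inter> F) + hausdorff_outer s (E m) \<le> hausdorff_outer s T" for m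
  proof -
    have "hausdorff_outer s (T \<inter> F) + hausdorff_outer s (E m) \<le> hausdorff_outer s (T \<inter> F \<union> E m)"
    proof (rule hausdorff_outer_separated[OF s])
      show "0 < a m" by (simp add: a_def)
      fix x y assume "x \<in> T \<inter> F" "y \<in> E m"
      then show "a m \<le> dist x y" using lip[of y x] by (auto simp: E_def u_def dist_commute)
    qed
    also have "\<dots> \<le> hausdorff_outer s T" by (intro hausdorff_outer_mono) (auto simp: E_def)
    finally show ?thesis .
  qed
  let ?X = "hausdorff_outer s (T \<inter> F) + hausdorff_outer s (T - F)"
  have "?X + (\<Sum>k<m. hausdorff_outer s (L k)) \<le> hausdorff_outer s T + S" for m
  proof -
    have "?X + (\<Sum>k<m. hausdorff_outer s (L k)) \<le>
      (hausdorff_outer s (T \<inter> F) + hausdorff_outer s (E m)) +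
        ((\<Sum>k. hausdorff_outer s (L (k + m))) + (\<Sum>k<m. hausdorff_outer s (L k)))"
      using tail[of m] by (simp add: add.assoc add_left_mono add_right_mono)
    also have "(\<Sum>k. hausdorff_outer s (L (k + m))) + (\<Sum>k<m. hausdorff_outer s (L k)) = S"
      unfolding S_def by (subst (2) suminf_offset[where i=m]) (auto simp: add.commute)
    finally show ?thesis using sepE[of m] by (meson add_right_mono order_trans)
  qed
  then have "(SUP m. ?X + (\<Sum>k<m. hausdorff_outer s (L k))) \<le> hausdorff_outer s T + S"
    by (intro SUP_least)
  also have "(SUP m. ?X + (\<Sum>k<m. hausdorff_outer s (L k))) = ?X + S"
    unfolding S_def suminf_eq_SUP by (rule ennreal_SUP_add_right[symmetric]) simp
  finally have "S + ?X \<le> S + hausdorff_outer s T" by (simp only: add.commute[of S])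
  then show ?thesis
    unfolding ennreal_add_left_cancel_le using S_fin by auto
qed

lemma sets_hausdorff_measure [measurable_cong, simp]: "sets (hausdorff_measure s) = sets borel"
  unfolding hausdorff_measure_def by (metis sets.sets_measure_of_eq space_borel)

lemma space_hausdorff_measure [simp]: "space (hausdorff_measure s) = UNIV"
  unfolding hausdorff_measure_def by (metis sets.space_measure_of_eq space_borel)

text \<open>For a set function that is not countably additive, \<open>measure_of\<close> is the zero measure.  Countable additivity on
  Borel sets holds because closed sets are measurable in the sense of Caratheodory, by \<open>hausdorff_outer_closed\<close>.\<close>
lemma emeasure_hausdorff_measure:
  fixes A :: "'a::metric_space set"
  assumes s: "0 < s" and A: "A \<in> sets borel"
  shows "emeasure (hausdorff_measure s) A = hausdorff_outer s A"
proof -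
  let ?L = "lambda_system UNIV UNIV (hausdorff_outer s :: 'a set \<Rightarrow> _)"
  have ms: "measure_space UNIV ?L (hausdorff_outer s)"
    using sigma_algebra.caratheodory_lemma[OF sigma_algebra_Pow, of UNIV "hausdorff_outer s"]
      outer_measure_space_hausdorff[OF s, where 'a='a] by simp
  then have sa: "sigma_algebra UNIV ?L" by (simp add: measure_space_def)
  have "{F. closed F} \<subseteq> ?L"
  proof
    fix F :: "'a set" assume "F \<in> {F. closed F}"
    then have F: "closed F" by simp
    have "hausdorff_outer s (F \<inter> T) + hausdorff_outer s ((UNIV - F) \<inter> T) = hausdorff_outer s T" for T
    proof (rule antisym)
      have *: "F \<inter> T = T \<inter> F" "(UNIV - F) \<inter> T = T - F" by auto
      show "hausdorff_outer s (F \<inter> T) + hausdorff_outer s ((UNIV - F) \<inter> T) \<le> hausdorff_outer s T"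
        unfolding * by (rule hausdorff_outer_closed[OF s F])
      have "T = F \<inter> T \<union> (UNIV - F) \<inter> T" by auto
      then show "hausdorff_outer s T \<le> hausdorff_outer s (F \<inter> T) + hausdorff_outer s ((UNIV - F) \<inter> T)"
        using hausdorff_outer_Un[OF s] by metis
    qed
    then show "F \<in> ?L" by (auto simp: lambda_system_def)
  qed
  then have "sigma_sets UNIV {F. closed F} \<subseteq> ?L"
    using sigma_algebra.sigma_sets_subset[OF sa] by auto
  moreover have "sigma_sets UNIV {F::'a set. closed F} = sets borel"
    unfolding borel_eq_closed by simp
  ultimately have sub: "sets borel \<subseteq> ?L" by simp
  have "measure_space UNIV (sets borel) (hausdorff_outer s :: 'a set \<Rightarrow> _)"
    using measure_down[OF ms _ sub] sets.sigma_algebra_axioms[of borel] by simp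
  then show ?thesis
    unfolding hausdorff_measure_def
    using A by (intro emeasure_measure_of_sigma) (auto simp: measure_space_def)
qed

lemma hausdorff_outer_lipschitz_image:
  fixes f :: "'a::metric_space \<Rightarrow> 'b::metric_space"
  assumes s: "0 < s" and L: "0 < L" and f: "\<And>x y. x \<in> A \<Longrightarrow> y \<in> A \<Longrightarrow> dist (f x) (f y) \<le> L * dist x y"
  shows "hausdorff_outer s (f ` A) \<le> ennreal (L ^ s) * hausdorff_outer s A"
proof (rule hausdorff_outer_leI)
  fix \<delta> :: real assume \<delta>: "0 < \<delta>"
  have *: "hausdorff_premeasure s \<delta> (f ` A) \<le> ennreal (L ^ s) * (\<Sum>i. ennreal (diameter (C i) ^ s))"
    if C: "A \<subseteq> (\<Union>i. C i)" "\<forall>i::nat. bounded (C i) \<and> diameter (C i) \<le> \<delta> / L" for C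
  proof -
    define D where "D i = f ` (C i \<inter> A)" for i
    have le: "dist x y \<le> L * diameter (C i)" if "x \<in> D i" "y \<in> D i" for x y i
    proof -
      obtain x' y' where xy: "x' \<in> C i \<inter> A" "y' \<in> C i \<inter> A" "x = f x'" "y = f y'"
        using \<open>x \<in> D i\<close> \<open>y \<in> D i\<close> by (auto simp: D_def)
      then have "dist x y \<le> L * dist x' y'" using f by auto
      also have "\<dots> \<le> L * diameter (C i)"
        using L C(2) xy by (intro mult_left_mono diameter_bounded_bound) auto
      finally show ?thesis .
    qed
    have bdd: "bounded (D i)" for i
      unfolding bounded_two_points using le by blast
    have diam: "diameter (D i) \<le> L * diameter (C i)" for i
    proof (cases "D i = {}")
      case True
      then show ?thesis using L C(2) by (simp add: diameter_ge_0)
    next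
      case False
      then have "D i \<times> D i \<noteq> {}" by auto
      then have "(SUP (x,y)\<in>D i \<times> D i. dist x y) \<le> L * diameter (C i)"
        by (rule cSUP_least) (auto intro: le)
      then show ?thesis using False unfolding diameter_def[of "D i"] by simp
    qed
    have "hausdorff_premeasure s \<delta> (f ` A) \<le> (\<Sum>i. ennreal (diameter (D i) ^ s))"
    proof (rule hausdorff_premeasure_le_cover)
      show "f ` A \<subseteq> (\<Union>i. D i)" using C(1) by (fastforce simp: D_def)
      fix i
      show "bounded (D i)" by (rule bdd)
      have "diameter (D i) \<le> L * diameter (C i)" by (rule diam)
      also have "\<dots> \<le> L * (\<delta> / L)" using C(2) L by (intro mult_left_mono) auto
      finally show "diameter (D i) \<le> \<delta>" using L by simp
    qed
    also have "\<dots> \<le> (\<Sum>i. ennreal (L ^ s) * ennreal (diameter (C i) ^ s))"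
    proof (intro suminf_le ballI)
      fix i
      have "diameter (D i) ^ s \<le> (L * diameter (C i)) ^ s"
        by (intro power_mono diam diameter_ge_0 bdd)
      then show "ennreal (diameter (D i) ^ s) \<le> ennreal (L ^ s) * ennreal (diameter (C i) ^ s)"
        using L C(2) by (subst ennreal_mult[symmetric]) (auto simp: power_mult_distrib diameter_ge_0 ennreal_leI)
    qed auto
    finally show ?thesis by simp
  qed
  then have "hausdorff_premeasure s \<delta> (f ` A) \<le> ennreal (L ^ s) * hausdorff_premeasure s (\<delta> / L) A"
  proof -
    have inv: "ennreal (L ^ s) * (ennreal (1 / L ^ s) * X) = X" "ennreal (1 / L ^ s) * (ennreal (L ^ s) * X) = X" for X
      using L by (simp_all add: mult.assoc[symmetric] ennreal_mult[symmetric])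
    have "ennreal (1 / L ^ s) * hausdorff_premeasure s \<delta> (f ` A) \<le> hausdorff_premeasure s (\<delta> / L) A"
      unfolding hausdorff_premeasure_def[of s "\<delta>/L"]
    proof (rule INF_greatest)
      fix C :: "nat \<Rightarrow> 'a set"
      assume "C \<in> {C. A \<subseteq> (\<Union>i. C i) \<and> (\<forall>i. bounded (C i) \<and> diameter (C i) \<le> \<delta> / L)}"
      then have "ennreal (1 / L ^ s) * hausdorff_premeasure s \<delta> (f ` A)
          \<le> ennreal (1 / L ^ s) * (ennreal (L ^ s) * (\<Sum>i. ennreal (diameter (C i) ^ s)))"
        by (intro mult_left_mono *) auto
      then show "ennreal (1 / L ^ s) * hausdorff_premeasure s \<delta> (f ` A) \<le> (\<Sum>i. ennreal (diameter (C i) ^ s))"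
        by (simp only: inv)
    qed
    then have "ennreal (L ^ s) * (ennreal (1 / L ^ s) * hausdorff_premeasure s \<delta> (f ` A))
      \<le> ennreal (L ^ s) * hausdorff_premeasure s (\<delta> / L) A"
      by (rule mult_left_mono) simp
    then show ?thesis by (simp only: inv)
  qed
  also have "\<dots> \<le> ennreal (L ^ s) * hausdorff_outer s A"
    using \<delta> L by (intro mult_left_mono hausdorff_premeasure_le_outer) auto
  finally show "hausdorff_premeasure s \<delta> (f ` A) \<le> ennreal (L ^ s) * hausdorff_outer s A" .
qed

lemma hausdorff_outer_similarity:
  fixes f :: "'a::metric_space \<Rightarrow> 'b::metric_space"
  assumes s: "0 < s" and L: "0 < L" and f: "\<And>x y. x \<in> A \<Longrightarrow> y \<in> A \<Longrightarrow> dist (f x) (f y) = L * dist x y"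
  shows "hausdorff_outer s (f ` A) = ennreal (L ^ s) * hausdorff_outer s A"
proof (rule antisym)
  show "hausdorff_outer s (f ` A) \<le> ennreal (L ^ s) * hausdorff_outer s A"
    by (rule hausdorff_outer_lipschitz_image[OF s L]) (simp add: f)
  have inj: "inj_on f A"
  proof (rule inj_onI)
    fix x y assume "x \<in> A" "y \<in> A" "f x = f y"
    then show "x = y" using f[of x y] L by simp
  qed
  then have inv: "inv_into A f (f x) = x" if "x \<in> A" for x using that by (simp add: inv_into_f_f)
  have "hausdorff_outer s (inv_into A f ` f ` A) \<le> ennreal ((1/L) ^ s) * hausdorff_outer s (f ` A)"
    by (rule hausdorff_outer_lipschitz_image[OF s]) (use L in \<open>auto simp: inv f\<close>)
  also have "inv_into A f ` f ` A = A" using inv by force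
  finally have "ennreal (L ^ s) * hausdorff_outer s A
      \<le> ennreal (L ^ s) * (ennreal ((1/L) ^ s) * hausdorff_outer s (f ` A))"
    by (rule mult_left_mono) simp
  also have "\<dots> = hausdorff_outer s (f ` A)"
    using L by (simp add: mult.assoc[symmetric] power_divide flip: ennreal_mult)
  finally show "ennreal (L ^ s) * hausdorff_outer s A \<le> hausdorff_outer s (f ` A)" .
qed

section \<open>Measures determined by small balls\<close>

lemma sigma_finite_if_finite_on_balls:
  fixes \<mu> :: "'a::metric_space measure"
  assumes "sets \<mu> = sets borel" and "\<And>r. emeasure \<mu> (ball z r) < top"
  shows "sigma_finite_measure \<mu>"
proof
  have "(\<Union>n::nat. ball z (real n)) = UNIV"
    by (auto simp: reals_Archimedean2)
  then show "\<exists>A. countable A \<and> A \<subseteq> sets \<mu> \<and> \<Union>A = space \<mu> \<and> (\<forall>a\<in>A. emeasure \<mu> a \<noteq> \<infinity>)"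
    using assms sets_eq_imp_space_eq[OF assms(1)]
    by (intro exI[of _ "range (\<lambda>n. ball z (real n))"]) (auto simp: less_top[symmetric])
qed

text \<open>The mass that \<open>\<mu>\<close> gives to \<open>G \<inter> ball x r\<close>, divided by the normalisation \<open>g\<close>, is at least \<open>1\<close> for
  \<open>x \<in> G \<inter> S\<close> and small \<open>r\<close>.  Averaging it over \<open>\<nu>\<close>, exchanging the two integrals, and letting \<open>r\<close> tend to \<open>0\<close> by Fatou's lemma
  gives the inequality.\<close>
lemma uniformly_distributed_le:
  fixes \<mu> \<nu> :: "'a::{metric_space, second_countable_topology} measure"
  assumes fin: "sigma_finite_measure \<mu>" "sigma_finite_measure \<nu>"
    and sets[measurable_cong]: "sets \<mu> = sets borel" "sets \<nu> = sets borel"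
    and S[measurable]: "S \<in> sets borel" and null: "emeasure \<mu> (-S) = 0" "emeasure \<nu> (-S) = 0"
    and r: "r \<longlonglongrightarrow> 0"
    and mu: "\<And>k x. x \<in> S \<Longrightarrow> ennreal (g k) \<le> emeasure \<mu> (ball x (r k))"
    and nu: "\<And>k x. x \<in> S \<Longrightarrow> emeasure \<nu> (ball x (r k)) \<le> ennreal (c k) * ennreal (g k)"
    and g: "\<And>k. 0 < g k" and c: "c \<longlonglongrightarrow> c0" "0 < c0"
    and G: "open G"
  shows "emeasure \<nu> G \<le> ennreal c0 * emeasure \<mu> G"
proof -
  interpret pair_sigma_finite \<nu> \<mu> using fin by (simp add: pair_sigma_finite_def)
  note [measurable] = borel_open[OF G]
  have sp: "space \<mu> = UNIV" "space \<nu> = UNIV" using sets[THEN sets_eq_imp_space_eq] by simp_all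
  define H where "H = G \<inter> S"
  have [measurable]: "H \<in> sets borel" by (simp add: H_def)
  have eqH: "emeasure \<mu> G = emeasure \<mu> H" "emeasure \<nu> G = emeasure \<nu> H"
    unfolding H_def using null by (auto intro!: emeasure_eq_AE AE_I[of _ _ "-S"])
  have [measurable]: "Measurable.pred (\<nu> \<Otimes>\<^sub>M \<mu>) (\<lambda>p. dist (fst p) (snd p) < r k)" for k
    by measurable
  define f :: "nat \<Rightarrow> 'a \<Rightarrow> 'a \<Rightarrow> ennreal" where
    "f k x y = (if x \<in> H \<and> y \<in> H \<and> dist x y < r k then ennreal (1 / g k) else 0)" for k x y
  have [measurable]: "(\<lambda>(x, y). f k x y) \<in> borel_measurable (\<nu> \<Otimes>\<^sub>M \<mu>)" for k
    unfolding f_def by measurable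
  have [measurable]: "f k x \<in> borel_measurable \<mu>" for k x
    unfolding f_def by measurable
  have [measurable]: "(\<lambda>x. f k x y) \<in> borel_measurable \<nu>" for k y
    unfolding f_def by measurable
  have inner: "(\<integral>\<^sup>+x. f k x y \<partial>\<nu>) \<le> ennreal (c k) * indicator H y" for k y
  proof (cases "y \<in> H")
    case True
    have "(\<integral>\<^sup>+x. f k x y \<partial>\<nu>) \<le> (\<integral>\<^sup>+x. ennreal (1 / g k) * indicator (ball y (r k)) x \<partial>\<nu>)"
      by (intro nn_integral_mono) (auto simp: f_def dist_commute indicator_def)
    also have "\<dots> = ennreal (1 / g k) * emeasure \<nu> (ball y (r k))"
      by (subst nn_integral_cmult_indicator) auto
    also have "\<dots> \<le> ennreal (1 / g k) * (ennreal (c k) * ennreal (g k))"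
      using True by (intro mult_left_mono nu) (auto simp: H_def)
    also have "\<dots> = ennreal (c k) * (ennreal (1 / g k) * ennreal (g k))" by (simp add: ac_simps)
    also have "\<dots> = ennreal (c k)"
      using g[of k] by (simp flip: ennreal_mult)
    finally show ?thesis using True by simp
  qed (simp add: f_def)
  have "emeasure \<nu> G = (\<integral>\<^sup>+x. indicator H x \<partial>\<nu>)"
    by (simp add: eqH)
  also have "\<dots> \<le> (\<integral>\<^sup>+x. liminf (\<lambda>k. \<integral>\<^sup>+y. f k x y \<partial>\<mu>) \<partial>\<nu>)"
  proof (rule nn_integral_mono)
    fix x
    show "indicator H x \<le> liminf (\<lambda>k. \<integral>\<^sup>+y. f k x y \<partial>\<mu>)"
    proof (cases "x \<in> H")
      case True
      then obtain e where e: "0 < e" "ball x e \<subseteq> G"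
        using G open_contains_ball unfolding H_def by (metis IntD1)
      have "\<forall>\<^sub>F k in sequentially. r k < e"
        using r e by (simp add: order_tendstoD)
      then have "\<forall>\<^sub>F k in sequentially. 1 \<le> (\<integral>\<^sup>+y. f k x y \<partial>\<mu>)"
      proof eventually_elim
        case (elim k)
        have sub: "ball x (r k) \<subseteq> G" using e elim subset_ball[of "r k" e x] by auto
        have "1 = ennreal (1 / g k) * ennreal (g k)"
          using g[of k] by (simp flip: ennreal_mult)
        also have "\<dots> \<le> ennreal (1 / g k) * emeasure \<mu> (ball x (r k))"
          using True by (intro mult_left_mono mu) (auto simp: H_def)
        also have "emeasure \<mu> (ball x (r k)) = emeasure \<mu> (ball x (r k) \<inter> S)"
          using null by (auto intro!: emeasure_eq_AE AE_I[of _ _ "-S"])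
        also have "ennreal (1 / g k) * \<dots> = (\<integral>\<^sup>+y. ennreal (1 / g k) * indicator (ball x (r k) \<inter> S) y \<partial>\<mu>)"
          by (subst nn_integral_cmult_indicator) auto
        also have "\<dots> \<le> (\<integral>\<^sup>+y. f k x y \<partial>\<mu>)"
          using True sub by (intro nn_integral_mono) (auto simp: f_def indicator_def H_def)
        finally show ?case .
      qed
      then show ?thesis using True by (simp add: Liminf_bounded)
    qed simp
  qed
  also have "\<dots> \<le> liminf (\<lambda>k. \<integral>\<^sup>+x. \<integral>\<^sup>+y. f k x y \<partial>\<mu> \<partial>\<nu>)"
    by (rule nn_integral_liminf) measurable
  also have "\<dots> = liminf (\<lambda>k. \<integral>\<^sup>+y. \<integral>\<^sup>+x. f k x y \<partial>\<nu> \<partial>\<mu>)"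
    by (subst Fubini') auto
  also have "\<dots> \<le> liminf (\<lambda>k. ennreal (c k) * emeasure \<mu> G)"
  proof (intro Liminf_mono always_eventually allI)
    fix k
    have "(\<integral>\<^sup>+y. \<integral>\<^sup>+x. f k x y \<partial>\<nu> \<partial>\<mu>) \<le> (\<integral>\<^sup>+y. ennreal (c k) * indicator H y \<partial>\<mu>)"
      by (intro nn_integral_mono inner)
    also have "\<dots> = ennreal (c k) * emeasure \<mu> H"
      by (subst nn_integral_cmult_indicator) auto
    finally show "(\<integral>\<^sup>+y. \<integral>\<^sup>+x. f k x y \<partial>\<nu> \<partial>\<mu>) \<le> ennreal (c k) * emeasure \<mu> G"
      by (simp add: eqH)
  qed
  also have "\<dots> \<le> ennreal c0 * emeasure \<mu> G"
  proof (cases "emeasure \<mu> G = top")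
    case True
    then show ?thesis using c(2) by (simp add: ennreal_mult_top)
  next
    case False
    have "(\<lambda>k. ennreal (c k) * emeasure \<mu> G) \<longlonglongrightarrow> ennreal c0 * emeasure \<mu> G"
      using False c(1) by (intro tendsto_mult_ennreal tendsto_ennrealI tendsto_const) auto
    then show ?thesis by (simp add: lim_imp_Liminf)
  qed
  finally show ?thesis .
qed

text \<open>Christensen's lemma: a measure whose balls centred on its carrier have a mass that depends on the
  radius alone is determined up to a factor, and the factor can be read off from small balls.\<close>
lemma uniformly_distributed_proportional:
  fixes \<mu> \<nu> :: "'a::{metric_space, second_countable_topology} measure"
  assumes sets: "sets \<mu> = sets borel" "sets \<nu> = sets borel"
    and fin: "\<And>t. emeasure \<mu> (ball z t) < top" "\<And>t. emeasure \<nu> (ball z t) < top"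
    and S: "S \<in> sets borel" and null: "emeasure \<mu> (-S) = 0" "emeasure \<nu> (-S) = 0"
    and r: "r \<longlonglongrightarrow> 0"
    and mu: "\<And>k x. x \<in> S \<Longrightarrow> emeasure \<mu> (ball x (r k)) = ennreal (m k)"
    and nu: "\<And>k x. x \<in> S \<Longrightarrow> emeasure \<nu> (ball x (r k)) = ennreal (n k)"
    and pos: "\<And>k. 0 < m k" "\<And>k. 0 < n k"
    and c: "(\<lambda>k. n k / m k) \<longlonglongrightarrow> c" "0 < c"
  shows "\<nu> = scale_measure (ennreal c) \<mu>"
proof -
  have sf: "sigma_finite_measure \<mu>" "sigma_finite_measure \<nu>"
    using sigma_finite_if_finite_on_balls sets fin by blast+
  have le1: "emeasure \<nu> G \<le> ennreal c * emeasure \<mu> G" if "open G" for G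
  proof (rule uniformly_distributed_le[OF sf sets S null r _ _ pos(1) c that])
    fix k x assume "x \<in> S"
    then show "ennreal (m k) \<le> emeasure \<mu> (ball x (r k))" by (simp add: mu)
    show "emeasure \<nu> (ball x (r k)) \<le> ennreal (n k / m k) * ennreal (m k)"
      using pos[of k] \<open>x \<in> S\<close> by (simp add: nu flip: ennreal_mult)
  qed
  have c': "(\<lambda>k. m k / n k) \<longlonglongrightarrow> 1 / c"
    using tendsto_inverse[OF c(1)] c(2) by (simp add: inverse_eq_divide)
  have le2: "emeasure \<mu> G \<le> ennreal (1 / c) * emeasure \<nu> G" if "open G" for G
  proof (rule uniformly_distributed_le[OF sf(2,1) sets(2,1) S null(2,1) r _ _ pos(2) c' _ that])
    fix k x assume "x \<in> S"
    then show "ennreal (n k) \<le> emeasure \<nu> (ball x (r k))" by (simp add: nu)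
    show "emeasure \<mu> (ball x (r k)) \<le> ennreal (m k / n k) * ennreal (n k)"
      using pos[of k] \<open>x \<in> S\<close> by (simp add: mu flip: ennreal_mult)
  qed (use c in simp)
  have eq: "emeasure \<nu> G = ennreal c * emeasure \<mu> G" if "open G" for G
  proof (rule antisym[OF le1[OF that]])
    have "ennreal c * emeasure \<mu> G \<le> ennreal c * (ennreal (1 / c) * emeasure \<nu> G)"
      by (intro mult_left_mono le2 that) simp
    also have "\<dots> = emeasure \<nu> G"
      using c(2) by (simp add: mult.assoc[symmetric] flip: ennreal_mult)
    finally show "ennreal c * emeasure \<mu> G \<le> emeasure \<nu> G" .
  qed
  show ?thesis
  proof (rule measure_eqI_generator_eq[where E="{G. open G}" and \<Omega>=UNIV and A="\<lambda>i. ball z (real i)"])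
    show "Int_stable {G::'a set. open G}" by (auto simp: Int_stable_def)
    show "(\<Union>i. ball z (real i)) = UNIV" by (auto simp: reals_Archimedean2)
    show "sets \<nu> = sigma_sets UNIV {G. open G}" "sets (scale_measure (ennreal c) \<mu>) = sigma_sets UNIV {G. open G}"
      by (simp_all add: sets borel_def sets_measure_of)
    show "emeasure \<nu> (ball z (real i)) \<noteq> \<infinity>" for i using fin(2)[of "real i"] by (simp add: less_top)
    show "emeasure \<nu> X = emeasure (scale_measure (ennreal c) \<mu>) X" if "X \<in> {G. open G}" for X
      using that eq by (simp add: sets)
  qed auto
qed

section \<open>Hausdorff measure of a hyperplane\<close>

lemma emeasure_lborel_affine_image:
  fixes A :: "'a::euclidean_space set"
  assumes [measurable]: "A \<in> sets borel" and c: "c \<noteq> 0"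
  shows "emeasure lborel ((\<lambda>x. t + c *\<^sub>R x) ` A) = ennreal (\<bar>c\<bar> ^ DIM('a)) * emeasure lborel A"
proof -
  let ?T = "\<lambda>x. t + c *\<^sub>R x"
  have img: "?T ` A = (\<lambda>y. (1/c) *\<^sub>R (y - t)) -` A"
  proof safe
    fix y assume "(1/c) *\<^sub>R (y - t) \<in> A"
    then have "?T ((1/c) *\<^sub>R (y - t)) \<in> ?T ` A" by (rule imageI)
    then show "y \<in> ?T ` A" using c by simp
  qed (use c in simp)
  have [measurable]: "?T ` A \<in> sets borel"
    unfolding img by (rule measurable_sets_borel[where M=borel, OF _ assms(1)]) measurable
  have "emeasure lborel (?T ` A) = emeasure (density (distr lborel borel ?T) (\<lambda>_. \<bar>c\<bar> ^ DIM('a))) (?T ` A)"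
    using lborel_affine[OF c, of t] by simp
  also have "\<dots> = ennreal (\<bar>c\<bar> ^ DIM('a)) * emeasure (distr lborel borel ?T) (?T ` A)"
    by (subst emeasure_density) (auto simp: nn_integral_cmult_indicator)
  also have "emeasure (distr lborel borel ?T) (?T ` A) = emeasure lborel (?T -` ?T ` A)"
    by (subst emeasure_distr) auto
  also have "?T -` ?T ` A = A" using c by auto
  finally show ?thesis .
qed

text \<open>The basis vector orthogonal to the facet in the definition of \<open>unit_facet\<close>.\<close>
definition normal_axis :: "'a::euclidean_space" where
  "normal_axis = (SOME b. b \<in> Basis)"

definition tangential :: "'a::euclidean_space \<Rightarrow> 'a" where
  "tangential x = x - (x \<bullet> normal_axis) *\<^sub>R normal_axis"

definition hyperplane :: "'a::euclidean_space set" where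
  "hyperplane = {x. x \<bullet> normal_axis = 0}"

definition unit_slab :: "'a::euclidean_space set" where
  "unit_slab = {x. 0 \<le> x \<bullet> normal_axis \<and> x \<bullet> normal_axis \<le> 1}"

text \<open>Lebesgue measure of dimension \<open>n - 1\<close> on the hyperplane, expressed by the volume of the slab of height \<open>1\<close>
  over a set.\<close>
definition slab_measure :: "'a::euclidean_space measure" where
  "slab_measure = distr (density lborel (indicator unit_slab)) borel tangential"

lemma normal_axis_in_Basis [simp]: "normal_axis \<in> Basis"
  unfolding normal_axis_def by (rule someI_ex) (use nonempty_Basis in blast)

lemma normal_axis_inner [simp]: "normal_axis \<bullet> normal_axis = 1"
  by (simp add: inner_same_Basis)

lemma norm_normal_axis [simp]: "norm normal_axis = 1"
  by (simp add: norm_eq_1)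

lemma tangential_inner: "j \<in> Basis \<Longrightarrow> tangential x \<bullet> j = (if j = normal_axis then 0 else x \<bullet> j)"
  by (auto simp: tangential_def inner_diff_left inner_Basis)

lemma tangential_in_hyperplane [simp]: "tangential x \<in> hyperplane"
  by (simp add: hyperplane_def tangential_inner)

lemma tangential_diff: "tangential (x - y) = tangential x - tangential y"
  and tangential_add: "tangential (x + y) = tangential x + tangential y"
  and tangential_scaleR: "tangential (c *\<^sub>R x) = c *\<^sub>R tangential x"
  by (simp_all add: tangential_def algebra_simps)

lemma tangential_id: "x \<in> hyperplane \<Longrightarrow> tangential x = x"
  by (simp add: tangential_def hyperplane_def)

lemma norm_sq_tangential: "(norm x)\<^sup>2 = (norm (tangential x))\<^sup>2 + (x \<bullet> normal_axis)\<^sup>2"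
  unfolding power2_norm_eq_inner tangential_def by (simp add: algebra_simps power2_eq_square inner_commute)

lemma norm_tangential_le: "norm (tangential x) \<le> norm x"
proof (rule power2_le_imp_le)
  show "(norm (tangential x))\<^sup>2 \<le> (norm x)\<^sup>2"
    using norm_sq_tangential[of x] zero_le_power2[of "x \<bullet> normal_axis"] by linarith
qed simp

lemma measurable_tangential [measurable]: "tangential \<in> borel_measurable borel"
  unfolding tangential_def[abs_def] by measurable

lemma hyperplane_borel [measurable]: "hyperplane \<in> sets borel"
  unfolding hyperplane_def by measurable

lemma unit_slab_borel [measurable]: "unit_slab \<in> sets borel"
  unfolding unit_slab_def by measurable

lemma unit_slab_vimage_borel [measurable]:
  "A \<in> sets borel \<Longrightarrow> {x \<in> unit_slab. tangential x \<in> A} \<in> sets borel"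
proof -
  assume A: "A \<in> sets borel"
  have "{x \<in> unit_slab. tangential x \<in> A} = unit_slab \<inter> tangential -` A" by auto
  then show ?thesis using measurable_sets_borel[OF measurable_tangential A] by simp
qed

lemma sets_slab_measure [simp, measurable_cong]: "sets slab_measure = sets borel"
  by (simp add: slab_measure_def)

lemma emeasure_slab_measure:
  "A \<in> sets borel \<Longrightarrow> emeasure slab_measure A = emeasure lborel {x \<in> unit_slab. tangential x \<in> A}"
  unfolding slab_measure_def
  by (subst emeasure_distr) (auto simp: emeasure_restricted measurable_sets_borel[OF measurable_tangential]
      intro!: arg_cong[where f="emeasure lborel"])

lemma slab_measure_ball_translate:
  fixes x :: "'a::euclidean_space"
  assumes "x \<in> hyperplane"
  shows "emeasure slab_measure (ball x t) = emeasure slab_measure (ball (0::'a) t)"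
proof -
  let ?A = "{y \<in> unit_slab. tangential y \<in> ball 0 t}"
  have "{y \<in> unit_slab. tangential y \<in> ball x t} = (\<lambda>y. x + 1 *\<^sub>R y) ` ?A"
  proof safe
    fix y assume y: "y \<in> unit_slab" "tangential y \<in> ball x t"
    then have "y - x \<in> ?A"
      using assms by (auto simp: tangential_diff tangential_id dist_norm norm_minus_commute
          unit_slab_def inner_diff_left hyperplane_def)
    then show "y \<in> (\<lambda>y. x + 1 *\<^sub>R y) ` ?A" by (intro image_eqI[of _ _ "y - x"]) auto
  qed (use assms in \<open>auto simp: tangential_add tangential_id dist_norm unit_slab_def inner_add_left hyperplane_def\<close>)
  moreover have "?A \<in> sets borel" by (rule unit_slab_vimage_borel) simp
  ultimately show ?thesis
    using emeasure_lborel_affine_image[of ?A 1 x] by (simp add: emeasure_slab_measure del: mem_ball scaleR_one)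
qed

text \<open>A diagonal affine map carries the unit cylinder to any other cylinder over a disc.\<close>
lemma emeasure_cylinder:
  assumes a: "0 < a" and h: "0 < h"
  shows "emeasure lborel {x::'a::euclidean_space. l \<le> x \<bullet> normal_axis \<and> x \<bullet> normal_axis \<le> l + h \<and> norm (tangential x) < a}
    = ennreal (h * a ^ (DIM('a) - 1)) * emeasure slab_measure (ball (0::'a) 1)"
proof -
  define c where "c j = (if j = normal_axis then h else a)" for j :: 'a
  define T where "T = (\<lambda>x. l *\<^sub>R normal_axis + (\<Sum>j\<in>Basis. (c j * (x \<bullet> j)) *\<^sub>R j) :: 'a)"
  let ?A = "{x::'a. l \<le> x \<bullet> normal_axis \<and> x \<bullet> normal_axis \<le> l + h \<and> norm (tangential x) < a}"
  have Tj: "T x \<bullet> j = c j * (x \<bullet> j) + (if j = normal_axis then l else 0)" if "j \<in> Basis" for x j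
    using that by (auto simp: T_def inner_add_left inner_Basis)
  have tanT: "tangential (T x) = a *\<^sub>R tangential x" for x
    by (rule euclidean_eqI) (simp add: tangential_inner Tj c_def)
  have prod: "(\<Prod>j\<in>Basis. \<bar>c j\<bar>) = h * a ^ (DIM('a) - 1)"
  proof -
    have "(\<Prod>j\<in>Basis. \<bar>c j\<bar>) = h * (\<Prod>j\<in>Basis - {normal_axis}. \<bar>c j\<bar>)"
      using h by (subst prod.remove[of _ normal_axis]) (auto simp: c_def)
    also have "(\<Prod>j\<in>Basis - {normal_axis}. \<bar>c j\<bar>) = (\<Prod>j\<in>Basis - {normal_axis::'a}. a)"
      using a by (intro prod.cong) (auto simp: c_def)
    also have "\<dots> = a ^ (DIM('a) - 1)" by (simp add: card_Diff_singleton)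
    finally show ?thesis .
  qed
  have [measurable]: "T \<in> borel_measurable borel"
    unfolding T_def by measurable
  have [measurable]: "?A \<in> sets borel" by measurable
  have "emeasure lborel ?A = emeasure (density (distr lborel borel T) (\<lambda>_. \<Prod>j\<in>Basis. \<bar>c j\<bar>)) ?A"
    using lborel_affine_euclidean[of c "l *\<^sub>R normal_axis", folded T_def] a h by (auto simp: c_def)
  also have "\<dots> = ennreal (h * a ^ (DIM('a) - 1)) * emeasure (distr lborel borel T) ?A"
    unfolding prod by (subst emeasure_density) (auto simp: nn_integral_cmult_indicator)
  also have "emeasure (distr lborel borel T) ?A = emeasure lborel (T -` ?A)"
    by (subst emeasure_distr) auto
  also have "T -` ?A = {x \<in> unit_slab. tangential x \<in> ball 0 1}"
    using a h by (auto simp: unit_slab_def Tj c_def tanT mult_le_cancel_left1 zero_le_mult_iff)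
  finally show ?thesis by (simp add: emeasure_slab_measure)
qed

lemma slab_measure_ball_scale:
  assumes t: "0 < t"
  shows "emeasure (slab_measure :: 'a::euclidean_space measure) (ball 0 t)
    = ennreal (t ^ (DIM('a) - 1)) * emeasure (slab_measure :: 'a measure) (ball 0 1)"
proof -
  have "{x \<in> unit_slab. tangential x \<in> ball (0::'a) t}
      = {x. 0 \<le> x \<bullet> normal_axis \<and> x \<bullet> normal_axis \<le> 0 + 1 \<and> norm (tangential x) < t}"
    by (auto simp: unit_slab_def)
  then show ?thesis
    using emeasure_cylinder[OF t zero_less_one, of 0, where 'a='a] by (simp only: emeasure_slab_measure borel_open open_ball) simp
qed

lemma slab_measure_unit_ball:
  "0 < emeasure slab_measure (ball (0::'a::euclidean_space) 1)"
  "emeasure slab_measure (ball (0::'a) 1) < top"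
proof -
  let ?A = "{x \<in> unit_slab. tangential x \<in> ball (0::'a) 1}"
  have [measurable]: "?A \<in> sets borel" by (rule unit_slab_vimage_borel) simp
  have "?A \<subseteq> ball 0 3"
  proof
    fix x assume x: "x \<in> ?A"
    have "norm x \<le> norm (tangential x) + norm ((x \<bullet> normal_axis) *\<^sub>R (normal_axis::'a))"
      using norm_triangle_ineq[of "tangential x" "(x \<bullet> normal_axis) *\<^sub>R normal_axis"] by (simp add: tangential_def)
    also have "\<dots> < 3" using x by (auto simp: unit_slab_def)
    finally show "x \<in> ball 0 3" by simp
  qed
  then have "emeasure lborel ?A \<le> emeasure lborel (ball (0::'a) 3)"
    by (intro emeasure_mono) auto
  also have "\<dots> < top" using emeasure_lborel_ball_finite[of "0::'a" 3] by simp
  finally show "emeasure slab_measure (ball (0::'a) 1) < top" by (simp add: emeasure_slab_measure)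
  have "ball ((1/2) *\<^sub>R normal_axis) (1/2) \<subseteq> ?A"
  proof
    fix x :: 'a assume "x \<in> ball ((1/2) *\<^sub>R normal_axis) (1/2)"
    then have x: "norm (x - (1/2) *\<^sub>R normal_axis) < 1/2" by (simp add: dist_norm norm_minus_commute)
    have "\<bar>(x - (1/2) *\<^sub>R normal_axis) \<bullet> normal_axis\<bar> < 1/2"
      using Basis_le_norm[of normal_axis "x - (1/2) *\<^sub>R normal_axis"] x by simp
    moreover have "tangential (x - (1/2) *\<^sub>R normal_axis) = tangential x"
      by (simp add: tangential_def algebra_simps)
    moreover from calculation have "0 \<le> x \<bullet> normal_axis" "x \<bullet> normal_axis \<le> 1"
      by (simp_all only: inner_diff_left inner_scaleR_left normal_axis_inner abs_less_iff) linarith+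
    ultimately show "x \<in> ?A"
      using norm_tangential_le[of "x - (1/2) *\<^sub>R normal_axis"] x
      by (auto simp: unit_slab_def)
  qed
  then have "emeasure lborel (ball ((1/2) *\<^sub>R normal_axis :: 'a) (1/2)) \<le> emeasure lborel ?A"
    by (intro emeasure_mono) auto
  moreover have "0 < emeasure lborel (ball ((1/2) *\<^sub>R normal_axis :: 'a) (1/2))"
    by (simp add: emeasure_ball unit_ball_vol_pos ennreal_zero_less_mult_iff)
  ultimately show "0 < emeasure slab_measure (ball (0::'a) 1)" by (simp add: emeasure_slab_measure)
qed

lemma slab_measure_unit_facet: "emeasure slab_measure (unit_facet :: 'a::euclidean_space set) = 1"
proof -
  have fac: "unit_facet = cbox 0 One \<inter> (hyperplane :: 'a set)"
    unfolding unit_facet_def hyperplane_def normal_axis_def by auto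
  have [measurable]: "(unit_facet :: 'a set) \<in> sets borel" unfolding fac by auto
  have "{x \<in> unit_slab. tangential x \<in> unit_facet} = cbox 0 (One::'a)"
    unfolding unit_facet_def normal_axis_def[symmetric]
    by (auto simp: mem_box tangential_inner unit_slab_def split: if_splits)
  then show ?thesis by (simp add: emeasure_slab_measure emeasure_lborel_cbox_eq)
qed

text \<open>A covering set of diameter \<open>d\<close> meets the slab in at most a box with sides \<open>2d\<close>
  over the hyperplane, which bounds the Hausdorff measure from below.\<close>
lemma slab_measure_le_hausdorff:
  assumes dim: "2 \<le> DIM('a::euclidean_space)" and A: "A \<in> sets borel" "A \<subseteq> (hyperplane :: 'a set)"
  shows "ennreal (1 / 2 ^ (DIM('a) - 1)) * emeasure slab_measure A \<le> hausdorff_outer (DIM('a) - 1) A"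
proof -
  let ?s = "DIM('a) - 1"
  have "ennreal (1 / 2 ^ ?s) * emeasure slab_measure A \<le> (\<Sum>i. ennreal (diameter (C i) ^ ?s))"
    if C: "A \<subseteq> (\<Union>i. C i)" "\<forall>i::nat. bounded (C i) \<and> diameter (C i) \<le> 1" for C
  proof -
    define y where "y i = (SOME y. y \<in> C i)" for i
    define d where "d i = diameter (C i)" for i
    have d0: "0 \<le> d i" for i using C by (simp add: d_def diameter_ge_0)
    define l where "l i = (\<Sum>j\<in>Basis. (if j = normal_axis then 0 else y i \<bullet> j - d i) *\<^sub>R j)" for i
    define u where "u i = (\<Sum>j\<in>Basis. (if j = normal_axis then 1 else y i \<bullet> j + d i) *\<^sub>R j)" for i
    have vol: "emeasure lborel (cbox (l i) (u i)) = ennreal ((2 * d i) ^ ?s)" for i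
    proof -
      have "emeasure lborel (cbox (l i) (u i)) = (\<Prod>j\<in>Basis. ((u i - l i) \<bullet> j))"
        by (rule emeasure_lborel_cbox) (use d0[of i] in \<open>auto simp: l_def u_def\<close>)
      also have "(\<Prod>j\<in>Basis. ((u i - l i) \<bullet> j)) = (\<Prod>j\<in>Basis - {normal_axis}. ((u i - l i) \<bullet> j))"
        by (subst prod.remove[of _ normal_axis]) (auto simp: l_def u_def inner_diff_left)
      also have "\<dots> = (\<Prod>j\<in>Basis - {normal_axis::'a}. 2 * d i)"
        by (intro prod.cong) (auto simp: l_def u_def inner_diff_left)
      also have "\<dots> = (2 * d i) ^ ?s" by (simp add: card_Diff_singleton)
      finally show ?thesis .
    qed
    have "{x \<in> unit_slab. tangential x \<in> A} \<subseteq> (\<Union>i. cbox (l i) (u i))"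
    proof
      fix x assume x: "x \<in> {x \<in> unit_slab. tangential x \<in> A}"
      then obtain i where i: "tangential x \<in> C i" using C(1) by blast
      then have "y i \<in> C i" unfolding y_def by (rule someI)
      then have "dist (tangential x) (y i) \<le> d i"
        unfolding d_def using i C(2) by (intro diameter_bounded_bound) auto
      then have "\<bar>(tangential x - y i) \<bullet> j\<bar> \<le> d i" if "j \<in> Basis" for j
        using Basis_le_norm[OF that, of "tangential x - y i"] by (simp add: dist_norm)
      then have "x \<in> cbox (l i) (u i)"
        using x by (fastforce simp: mem_box l_def u_def tangential_inner inner_diff_left unit_slab_def abs_le_iff)
      then show "x \<in> (\<Union>i. cbox (l i) (u i))" by blast
    qed
    then have "emeasure slab_measure A \<le> emeasure lborel (\<Union>i. cbox (l i) (u i))"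
      unfolding emeasure_slab_measure[OF A(1)] by (intro emeasure_mono) auto
    also have "\<dots> \<le> (\<Sum>i. emeasure lborel (cbox (l i) (u i)))"
      by (rule emeasure_subadditive_countably) auto
    also have "\<dots> = (\<Sum>i. ennreal (2 ^ ?s) * ennreal (d i ^ ?s))"
      using d0 by (simp add: vol power_mult_distrib ennreal_mult)
    also have "\<dots> = ennreal (2 ^ ?s) * (\<Sum>i. ennreal (d i ^ ?s))" by simp
    finally have "ennreal (1 / 2 ^ ?s) * emeasure slab_measure A
        \<le> ennreal (1 / 2 ^ ?s) * (ennreal (2 ^ ?s) * (\<Sum>i. ennreal (d i ^ ?s)))"
      by (rule mult_left_mono) simp
    also have "\<dots> = (\<Sum>i. ennreal (d i ^ ?s))"
      by (simp only: mult.assoc[symmetric]) (simp flip: ennreal_mult)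
    finally show ?thesis by (simp add: d_def)
  qed
  then have "ennreal (1 / 2 ^ ?s) * emeasure slab_measure A \<le> hausdorff_premeasure ?s 1 A"
    unfolding hausdorff_premeasure_def by (intro INF_greatest) auto
  also have "\<dots> \<le> hausdorff_outer ?s A" by (rule hausdorff_premeasure_le_outer) simp
  finally show ?thesis .
qed

text \<open>The disc is covered by the \<open>(2N)\<^sup>n\<^sup>-\<^sup>1\<close> cells of a grid of width \<open>1/N\<close>, whose diameters are at most \<open>n/N\<close>.\<close>
lemma hausdorff_outer_disc_finite:
  assumes dim: "2 \<le> DIM('a::euclidean_space)"
  shows "hausdorff_outer (DIM('a) - 1) (ball 0 1 \<inter> (hyperplane :: 'a set)) < top"
proof -
  let ?s = "DIM('a) - 1" and ?n = "real DIM('a)"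
  have "hausdorff_outer ?s (ball 0 1 \<inter> (hyperplane :: 'a set)) \<le> ennreal ((2 * ?n) ^ ?s)"
  proof (rule hausdorff_outer_leI)
    fix \<delta> :: real assume \<delta>: "0 < \<delta>"
    obtain N :: nat where N: "?n / \<delta> < real N" using reals_Archimedean2 by blast
    have N0: "0 < real N" using N \<delta> by (smt (verit) divide_nonneg_pos of_nat_0_le_iff)
    define I where "I = PiE (Basis - {normal_axis::'a}) (\<lambda>_. {0..<2*N})"
    define C where "C f = {x \<in> hyperplane. \<forall>j\<in>Basis - {normal_axis}.
        real (f j) / N - 1 \<le> x \<bullet> j \<and> x \<bullet> j \<le> (real (f j) + 1) / N - 1}" for f :: "'a \<Rightarrow> nat"
    have dist: "dist x y \<le> ?n / N" if xy: "x \<in> C f" "y \<in> C f" for x y f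
    proof -
      have "norm (x - y) \<le> (\<Sum>j\<in>Basis. \<bar>(x - y) \<bullet> j\<bar>)" by (rule norm_le_l1)
      also have "\<dots> \<le> (\<Sum>j\<in>(Basis::'a set). 1 / N)"
      proof (rule sum_mono)
        fix j :: 'a assume j: "j \<in> Basis"
        show "\<bar>(x - y) \<bullet> j\<bar> \<le> 1 / N"
        proof (cases "j = normal_axis")
          case True
          then show ?thesis using xy by (simp add: C_def hyperplane_def inner_diff_left)
        next
          case False
          then have "real (f j) / N - 1 \<le> x \<bullet> j" "x \<bullet> j \<le> (real (f j) + 1) / N - 1"
            "real (f j) / N - 1 \<le> y \<bullet> j" "y \<bullet> j \<le> (real (f j) + 1) / N - 1"
            using xy j by (auto simp: C_def)
          then show ?thesis by (simp add: inner_diff_left abs_le_iff add_divide_distrib)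
        qed
      qed
      finally show ?thesis by (simp add: dist_norm)
    qed
    have bdd: "bounded (C f)" for f unfolding bounded_two_points using dist by blast
    have diam: "diameter (C f) \<le> ?n / N" for f
      by (rule diameter_le) (use dist in \<open>auto simp: dist_norm\<close>)
    have "ball 0 1 \<inter> (hyperplane :: 'a set) \<subseteq> (\<Union>f\<in>I. C f)"
    proof
      fix x :: 'a assume x: "x \<in> ball 0 1 \<inter> hyperplane"
      define f where "f = restrict (\<lambda>j. nat \<lfloor>N * (x \<bullet> j + 1)\<rfloor>) (Basis - {normal_axis::'a})"
      have bd: "0 \<le> N * (x \<bullet> j + 1)" "N * (x \<bullet> j + 1) < 2 * N" if "j \<in> Basis" for j
        using Basis_le_norm[OF that, of x] x N0 by (auto simp: abs_le_iff)
      have f: "real (f j) \<le> N * (x \<bullet> j + 1)" "N * (x \<bullet> j + 1) \<le> real (f j) + 1"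
        if "j \<in> Basis - {normal_axis}" for j
        using bd[of j] that by (auto simp: f_def restrict_def intro: less_imp_le)
      have "f \<in> I"
        unfolding I_def
      proof (rule PiE_I)
        fix j :: 'a assume j: "j \<in> Basis - {normal_axis}"
        have "real (f j) < real (2 * N)" using f(1)[OF j] bd(2)[of j] j by simp
        then show "f j \<in> {0..<2*N}" by (simp only: of_nat_less_iff) simp
      qed (simp only: f_def restrict_def if_False)
      moreover have "x \<in> C f"
        using x f N0 by (auto simp: C_def field_simps)
      ultimately show "x \<in> (\<Union>f\<in>I. C f)" by blast
    qed
    then have "hausdorff_premeasure ?s \<delta> (ball 0 1 \<inter> (hyperplane :: 'a set)) \<le> (\<Sum>f\<in>I. ennreal (diameter (C f) ^ ?s))"
    proof (rule hausdorff_premeasure_le_finite_cover[rotated 3])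
      have "?n / N \<le> \<delta>" using N \<delta> N0 by (simp add: field_simps)
      then show "diameter (C f) \<le> \<delta>" for f using diam[of f] by linarith
    qed (use dim \<delta> bdd in \<open>auto simp: I_def intro!: finite_PiE\<close>)
    also have "\<dots> \<le> (\<Sum>f\<in>I. ennreal ((?n / N) ^ ?s))"
      by (intro sum_mono ennreal_leI power_mono diam diameter_ge_0 bdd)
    also have "\<dots> = ennreal (real (card I) * (?n / N) ^ ?s)"
      by (simp add: ennreal_mult ennreal_of_nat_eq_real_of_nat)
    also have "card I = (2 * N) ^ ?s"
      by (simp add: I_def card_PiE card_Diff_singleton)
    also have "real ((2 * N) ^ ?s) * (?n / N) ^ ?s = (2 * ?n) ^ ?s"
      using N0 by (simp add: power_mult_distrib power_divide)
    finally show "hausdorff_premeasure ?s \<delta> (ball 0 1 \<inter> (hyperplane :: 'a set)) \<le> ennreal ((2 * ?n) ^ ?s)" .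
  qed
  also have "\<dots> < top" by simp
  finally show ?thesis .
qed

lemma hausdorff_outer_disc:
  assumes dim: "2 \<le> DIM('a::euclidean_space)" and x: "x \<in> hyperplane" and t: "0 < t"
  shows "hausdorff_outer (DIM('a) - 1) (ball x t \<inter> (hyperplane :: 'a set))
    = ennreal (t ^ (DIM('a) - 1)) * hausdorff_outer (DIM('a) - 1) (ball 0 1 \<inter> (hyperplane :: 'a set))"
proof -
  have "ball x t \<inter> (hyperplane :: 'a set) = (\<lambda>y. x + t *\<^sub>R y) ` (ball 0 1 \<inter> hyperplane)"
  proof safe
    fix y assume y: "y \<in> ball x t" "y \<in> hyperplane"
    have "(1/t) *\<^sub>R (y - x) \<in> ball 0 1 \<inter> hyperplane"
      using x y t by (auto simp: dist_norm norm_minus_commute hyperplane_def inner_diff_left)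
    then show "y \<in> (\<lambda>y. x + t *\<^sub>R y) ` (ball 0 1 \<inter> hyperplane)"
      using t by (intro image_eqI[of _ _ "(1/t) *\<^sub>R (y - x)"]) auto
  qed (use x t in \<open>auto simp: dist_norm hyperplane_def inner_add_left\<close>)
  then show ?thesis
    using hausdorff_outer_similarity[of "DIM('a) - 1" t "ball 0 1 \<inter> hyperplane" "\<lambda>y. x + t *\<^sub>R y"] dim t
    by (auto simp: dist_norm simp flip: scaleR_diff_right)
qed

text \<open>Both the Hausdorff measure and the slab measure are invariant under translations of the hyperplane,
  hence proportional.  The factor \<open>c\<close> is the one that normalises the surface measure, because the slab
  measure of the unit facet is \<open>1\<close>.\<close>
theorem hausdorff_unit_facet:
  assumes dim: "2 \<le> DIM('a::euclidean_space)"
  obtains c where "0 < c"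
    "emeasure (hausdorff_measure (DIM('a) - 1)) (unit_facet :: 'a set) = ennreal c"
    "\<And>t. 0 < t \<Longrightarrow> hausdorff_outer (DIM('a) - 1) (ball 0 t \<inter> (hyperplane :: 'a set))
       = ennreal c * emeasure slab_measure (ball (0::'a) t)"
proof -
  let ?s = "DIM('a) - 1"
  have s: "0 < ?s" using dim by simp
  define \<nu> :: "'a measure" where "\<nu> = density (hausdorff_measure ?s) (indicator hyperplane)"
  have nu: "emeasure \<nu> A = hausdorff_outer ?s (A \<inter> hyperplane)" if "A \<in> sets borel" for A
    unfolding \<nu>_def using that s
    by (subst emeasure_restricted) (auto simp: emeasure_hausdorff_measure Int_commute)
  define a where "a = enn2real (emeasure slab_measure (ball (0::'a) 1))"
  have a: "0 < a" "emeasure slab_measure (ball (0::'a) 1) = ennreal a"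
    using slab_measure_unit_ball[where 'a='a] by (auto simp: a_def enn2real_positive_iff)
  define h where "h = enn2real (hausdorff_outer ?s (ball 0 1 \<inter> (hyperplane :: 'a set)))"
  have "0 < ennreal (1 / 2 ^ ?s) * emeasure slab_measure (ball (0::'a) 1)"
    using slab_measure_unit_ball(1)[where 'a='a] by (simp add: ennreal_zero_less_mult_iff)
  also have "emeasure slab_measure (ball (0::'a) 1) = emeasure slab_measure (ball (0::'a) 1 \<inter> hyperplane)"
    by (simp add: emeasure_slab_measure)
  also have "ennreal (1 / 2 ^ ?s) * \<dots> \<le> hausdorff_outer ?s (ball 0 1 \<inter> (hyperplane :: 'a set))"
    by (rule slab_measure_le_hausdorff[OF dim]) auto
  finally have h: "0 < h" "hausdorff_outer ?s (ball 0 1 \<inter> (hyperplane :: 'a set)) = ennreal h"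
    using hausdorff_outer_disc_finite[OF dim] by (auto simp: h_def enn2real_positive_iff)
  have slab: "emeasure slab_measure (ball x t) = ennreal (t ^ ?s * a)" if "0 < t" "x \<in> hyperplane" for x :: 'a and t
    unfolding slab_measure_ball_translate[OF that(2)] slab_measure_ball_scale[OF that(1)] a(2)
    using that a by (simp add: ennreal_mult)
  have haus: "emeasure \<nu> (ball x t) = ennreal (t ^ ?s * h)" if "0 < t" "x \<in> hyperplane" for x :: 'a and t
    unfolding nu[OF borel_open[OF open_ball]] hausdorff_outer_disc[OF dim that(2,1)] h(2)
    using that h by (simp add: ennreal_mult)
  have 0: "(0::'a) \<in> hyperplane" by (simp add: hyperplane_def)
  have \<nu>: "\<nu> = scale_measure (ennreal (h / a)) slab_measure"
  proof (rule uniformly_distributed_proportional[where z=0 and S=hyperplane and r="\<lambda>k. 1 / real (Suc k)"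
        and m="\<lambda>k. (1 / real (Suc k)) ^ ?s * a" and n="\<lambda>k. (1 / real (Suc k)) ^ ?s * h"])
    show "emeasure slab_measure (ball (0::'a) t) < top" for t
      by (cases "0 < t") (auto simp: slab 0 not_less ball_empty)
    show "emeasure \<nu> (ball (0::'a) t) < top" for t
      by (cases "0 < t") (auto simp: haus 0 not_less ball_empty)
    show "emeasure slab_measure (- (hyperplane :: 'a set)) = 0"
      by (simp add: emeasure_slab_measure)
    show "emeasure \<nu> (- (hyperplane :: 'a set)) = 0"
      using s by (simp add: nu hausdorff_outer_empty)
    show "(\<lambda>k. 1 / real (Suc k)) \<longlonglongrightarrow> 0" using LIMSEQ_inverse_real_of_nat by (simp add: inverse_eq_divide)
    have "(1 / real (Suc k)) ^ ?s * h / ((1 / real (Suc k)) ^ ?s * a) = h / a" for k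
      by simp
    then show "(\<lambda>k. (1 / real (Suc k)) ^ ?s * h / ((1 / real (Suc k)) ^ ?s * a)) \<longlonglongrightarrow> h / a"
      by simp
  qed (use a h slab haus in \<open>auto simp: \<nu>_def\<close>)
  show ?thesis
  proof (rule that[of "h / a"])
    show "0 < h / a" using a h by simp
    have fac: "unit_facet = cbox 0 One \<inter> (hyperplane :: 'a set)"
      unfolding unit_facet_def hyperplane_def normal_axis_def by auto
    have fac_meas: "(unit_facet :: 'a set) \<in> sets borel" unfolding fac by auto
    have "emeasure (hausdorff_measure ?s) (unit_facet :: 'a set) = emeasure \<nu> unit_facet"
    proof -
      have "unit_facet \<inter> hyperplane = (unit_facet :: 'a set)" using fac by auto
      then show ?thesis using nu[OF fac_meas] emeasure_hausdorff_measure[OF s fac_meas] by simp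
    qed
    also have "\<dots> = ennreal (h / a)"
      by (simp add: \<nu> slab_measure_unit_facet)
    finally show "emeasure (hausdorff_measure ?s) (unit_facet :: 'a set) = ennreal (h / a)" .
    show "hausdorff_outer ?s (ball 0 t \<inter> (hyperplane :: 'a set)) = ennreal (h / a) * emeasure slab_measure (ball (0::'a) t)"
      if "0 < t" for t
      using nu[of "ball 0 t"] by (simp add: \<nu>)
  qed
qed

section \<open>Hausdorff measure of a sphere\<close>

text \<open>An isometry permutes the balls of a given radius, so the image measure and the volume agree on balls.\<close>
lemma lborel_distr_involutive_isometry:
  fixes T :: "'a::euclidean_space \<Rightarrow> 'a"
  assumes inv: "\<And>x. T (T x) = x" and iso: "\<And>x y. dist (T x) (T y) = dist x y"
    and [measurable]: "T \<in> borel_measurable borel"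
  shows "distr lborel borel T = lborel"
proof -
  let ?m = "\<lambda>k. (1 / real (Suc k)) ^ DIM('a) * unit_ball_vol (real DIM('a))"
  have pre: "T -` ball x t = ball (T x) t" for x t
    using iso inv by (auto simp: set_eq_iff) (metis)+
  have ball: "emeasure (distr lborel borel T) (ball x t) = emeasure lborel (ball (T x) t)" for x t
    by (subst emeasure_distr) (auto simp: pre)
  have "distr lborel borel T = scale_measure (ennreal 1) lborel"
  proof (rule uniformly_distributed_proportional[where z=0 and S=UNIV and r="\<lambda>k. 1 / real (Suc k)"
        and m="?m" and n="?m"])
    show "emeasure lborel (ball (0::'a) t) < top" "emeasure (distr lborel borel T) (ball 0 t) < top" for t
      using emeasure_lborel_ball_finite by (auto simp: ball)
    show "(\<lambda>k. 1 / real (Suc k)) \<longlonglongrightarrow> 0"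
      using LIMSEQ_inverse_real_of_nat by (simp add: inverse_eq_divide)
    show pos: "0 < ?m k" for k by (simp add: unit_ball_vol_pos)
    then show "0 < ?m k" for k .
    have "?m k / ?m k = 1" for k by (rule divide_self[OF less_imp_neq[OF pos[of k], symmetric]])
    then show "(\<lambda>k. ?m k / ?m k) \<longlonglongrightarrow> 1" by simp
  qed (auto simp: ball emeasure_ball mult.commute)
  then show ?thesis by simp
qed

text \<open>Reflection in the hyperplane orthogonal to \<open>a\<close>.  The reflections with \<open>a = x - y\<close> act transitively on
  spheres, which makes all caps of a given radius equivalent.\<close>
definition reflect :: "'a::real_inner \<Rightarrow> 'a \<Rightarrow> 'a" where
  "reflect a x = x - (2 * (x \<bullet> a) / (a \<bullet> a)) *\<^sub>R a"

lemma reflect_diff: "reflect a (x - y) = reflect a x - reflect a y"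
  by (simp add: reflect_def inner_diff_left algebra_simps diff_divide_distrib)

lemma reflect_scaleR: "reflect a (c *\<^sub>R x) = c *\<^sub>R reflect a x"
  by (simp add: reflect_def algebra_simps)

lemma inner_reflect: "reflect a x \<bullet> reflect a x = x \<bullet> x"
proof (cases "a = 0")
  case False
  define k where "k = 2 * (x \<bullet> a) / (a \<bullet> a)"
  have k: "k * (a \<bullet> a) = 2 * (x \<bullet> a)" using False by (simp add: k_def)
  have "reflect a x \<bullet> reflect a x = x \<bullet> x - 2 * k * (x \<bullet> a) + k * (k * (a \<bullet> a))"
    unfolding reflect_def k_def[symmetric]
    by (simp only: inner_diff_left inner_diff_right inner_scaleR_left inner_scaleR_right inner_commute[of a x]) (simp add: algebra_simps)
  then show ?thesis unfolding k by simp
qed (simp add: reflect_def)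

lemma norm_reflect [simp]: "norm (reflect a x) = norm x"
  by (simp add: norm_eq_sqrt_inner inner_reflect)

lemma reflect_reflect [simp]: "reflect a (reflect a x) = x"
proof (cases "a = 0")
  case False
  then have "reflect a x \<bullet> a = - (x \<bullet> a)" by (simp add: reflect_def inner_diff_left)
  then show ?thesis by (simp add: reflect_def[of a "reflect a x"]) (simp add: reflect_def)
qed (simp add: reflect_def)

lemma dist_reflect [simp]: "dist (reflect a x) (reflect a y) = dist x y"
  by (simp add: dist_norm reflect_diff[symmetric])

lemma reflect_swap:
  assumes "norm x = norm y"
  shows "reflect (x - y) x = y"
proof (cases "x = y")
  case True then show ?thesis by (simp add: reflect_def)
next
  case False
  then have nz: "(x - y) \<bullet> (x - y) \<noteq> 0" by simp
  have eq: "(x - y) \<bullet> (x - y) = 2 * (x \<bullet> (x - y))"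
    using assms by (simp add: norm_eq_sqrt_inner inner_diff_left inner_diff_right inner_commute)
  have r1: "2 * (x \<bullet> (x - y)) / ((x - y) \<bullet> (x - y)) = 1"
    unfolding eq[symmetric] by (rule divide_self[OF nz])
  show ?thesis unfolding reflect_def r1 by simp
qed

lemma measurable_reflect [measurable]: "reflect (a::'a::euclidean_space) \<in> borel_measurable borel"
  unfolding reflect_def[abs_def] by measurable

text \<open>The area measure of the unit sphere, defined through the volume of the cone over a set.\<close>

definition sphere_measure :: "'a::euclidean_space measure" where
  "sphere_measure = scale_measure (ennreal (real DIM('a)))
     (distr (density lborel (indicator (ball 0 1 - {0}))) borel sgn)"

lemma sets_sphere_measure [simp, measurable_cong]: "sets sphere_measure = sets borel"
  by (simp add: sphere_measure_def)

lemma space_sphere_measure [simp]: "space sphere_measure = UNIV"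
  by (simp add: sphere_measure_def space_scale_measure)

lemma borel_measurable_sgn' [measurable]: "(sgn :: 'a::euclidean_space \<Rightarrow> 'a) \<in> borel_measurable borel"
  unfolding sgn_div_norm[abs_def] by measurable

lemma sector_borel [measurable]:
  "A \<in> sets borel \<Longrightarrow> {x. 0 < norm x \<and> norm x < t \<and> sgn (x::'a::euclidean_space) \<in> A} \<in> sets borel"
proof -
  assume A: "A \<in> sets borel"
  have "{x. 0 < norm x \<and> norm x < t \<and> sgn x \<in> A} = {x. 0 < norm x \<and> norm x < t} \<inter> sgn -` A" by auto
  then show ?thesis using measurable_sets_borel[OF borel_measurable_sgn' A] by simp
qed

lemma emeasure_sphere_measure:
  fixes A :: "'a::euclidean_space set"
  assumes A: "A \<in> sets borel"
  shows "emeasure sphere_measure A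
    = ennreal (real DIM('a)) * emeasure lborel {x. 0 < norm x \<and> norm x < 1 \<and> sgn x \<in> A}"
proof -
  have "emeasure (distr (density lborel (indicator (ball 0 1 - {0}))) borel sgn) A
     = emeasure lborel ((ball 0 1 - {0}) \<inter> sgn -` A)"
    using measurable_sets_borel[OF borel_measurable_sgn' A] A
    by (subst emeasure_distr) (auto simp: emeasure_restricted)
  also have "(ball 0 1 - {0}) \<inter> sgn -` A = {x. 0 < norm x \<and> norm x < 1 \<and> sgn x \<in> A}" by auto
  finally show ?thesis by (simp add: sphere_measure_def A)
qed

lemma sphere_measure_null: "emeasure sphere_measure (- sphere (0::'a::euclidean_space) 1) = 0"
proof -
  have "{x. 0 < norm x \<and> norm x < 1 \<and> sgn x \<in> - sphere (0::'a) 1} = {}"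
    by (auto simp: norm_sgn)
  then show ?thesis by (subst emeasure_sphere_measure) (auto simp only: emeasure_empty mult_zero_right borel_comp closed_sphere borel_closed)
qed

lemma sphere_measure_finite: "emeasure sphere_measure (A::'a::euclidean_space set) < top"
proof -
  have "emeasure sphere_measure A \<le> emeasure sphere_measure (UNIV::'a set)"
    by (rule emeasure_mono) auto
  also have "\<dots> \<le> ennreal (real DIM('a)) * emeasure lborel (ball (0::'a) 1)"
    by (subst emeasure_sphere_measure) (auto intro!: mult_left_mono emeasure_mono)
  also have "\<dots> < top" using emeasure_lborel_ball_finite[of "0::'a" 1] by (simp add: ennreal_mult_less_top)
  finally show ?thesis .
qed

lemma finite_measure_sphere_measure: "finite_measure sphere_measure"
  by standard (use sphere_measure_finite in \<open>simp add: less_top[symmetric]\<close>)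

lemma sphere_measure_ball:
  fixes x y :: "'a::euclidean_space"
  assumes "norm x = norm y"
  shows "emeasure sphere_measure (ball x t) = emeasure sphere_measure (ball y t)"
proof -
  define T where "T = reflect (x - y)"
  have T: "T x = y" "T (T z) = z" "dist (T z) (T w) = dist z w" "norm (T z) = norm z" "T (c *\<^sub>R z) = c *\<^sub>R T z" for z w c
    using reflect_swap[OF assms] by (simp_all add: T_def reflect_scaleR)
  have [measurable]: "T \<in> borel_measurable borel" by (simp add: T_def)
  let ?A = "\<lambda>x::'a. {z. 0 < norm z \<and> norm z < 1 \<and> sgn z \<in> ball x t}"
  have [measurable]: "?A x \<in> sets borel" for x by (rule sector_borel) simp
  have "emeasure lborel (?A x) = emeasure (distr lborel borel T) (?A x)"
    using lborel_distr_involutive_isometry[of T] T by simp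
  also have "\<dots> = emeasure lborel (T -` ?A x)" by (subst emeasure_distr) auto
  also have "T -` ?A x = ?A y"
  proof -
    have "dist x (sgn (T z)) = dist y (sgn z)" for z
      using T(3)[of x "sgn (T z)"] T(1,2,4,5) by (simp add: sgn_div_norm)
    then show ?thesis by (simp only: vimage_def mem_Collect_eq mem_ball T(4))
  qed
  finally show ?thesis by (simp only: emeasure_sphere_measure borel_open open_ball)
qed

lemma hausdorff_outer_cap:
  fixes x y :: "'a::euclidean_space"
  assumes s: "0 < s" and "norm x = norm y"
  shows "hausdorff_outer s (ball x t \<inter> sphere 0 1) = hausdorff_outer s (ball y t \<inter> sphere 0 1)"
proof -
  define T where "T = reflect (x - y)"
  have T: "T x = y" "T y = x" "T (T z) = z" "dist (T z) (T w) = dist z w" "norm (T z) = norm z" for z w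
    using reflect_swap[OF assms(2)] reflect_reflect[of "x - y" x] by (simp_all add: T_def)
  have "T ` (ball x t \<inter> sphere 0 1) = ball y t \<inter> sphere 0 1"
  proof safe
    fix z assume z: "z \<in> ball y t" "z \<in> sphere 0 1"
    then have "T z \<in> ball x t \<inter> sphere 0 1" using T(4)[of y z] T(2,5) by auto
    then show "z \<in> T ` (ball x t \<inter> sphere 0 1)" using T(3)[of z] by (metis imageI)
  next
    fix z assume "z \<in> ball x t" then show "T z \<in> ball y t" using T(4)[of x z] T(1) by auto
  qed (simp add: T)
  then show ?thesis
    using hausdorff_outer_similarity[OF s, of 1 "ball x t \<inter> sphere 0 1" T] T by simp
qed

subsection \<open>Small caps\<close>

text \<open>Truncating the cone between the heights \<open>x\<close> and \<open>1\<close> leaves a set that lies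
  between two cylinders, and by homogeneity has volume \<open>1 - x\<^sup>n\<close> times that of the cone.  Dividing by \<open>1 - x\<close>
  and letting \<open>x\<close> tend to \<open>1\<close> gives the factor \<open>1/n\<close> without Fubini's theorem.\<close>
lemma emeasure_solid_cone:
  assumes \<tau>: "0 < \<tau>" and h: "0 < h"
  shows "ennreal (real DIM('a)) * emeasure lborel {x::'a::euclidean_space. 0 < x \<bullet> normal_axis \<and>
      x \<bullet> normal_axis < h \<and> norm (tangential x) < \<tau> * (x \<bullet> normal_axis)}
    = ennreal (h ^ DIM('a) * \<tau> ^ (DIM('a) - 1)) * emeasure slab_measure (ball (0::'a) 1)"
proof -
  let ?n = "DIM('a)" and ?s = "DIM('a) - 1"
  define K where "K h = {x::'a. 0 < x \<bullet> normal_axis \<and>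
      x \<bullet> normal_axis < h \<and> norm (tangential x) < \<tau> * (x \<bullet> normal_axis)}" for h
  have [measurable]: "K h \<in> sets borel" for h unfolding K_def by measurable
  define \<kappa> where "\<kappa> = enn2real (emeasure slab_measure (ball (0::'a) 1))"
  have \<kappa>: "0 < \<kappa>" "emeasure slab_measure (ball (0::'a) 1) = ennreal \<kappa>"
    using slab_measure_unit_ball[where 'a='a] by (auto simp: \<kappa>_def enn2real_positive_iff)
  have cyl: "emeasure lborel {x::'a. l \<le> x \<bullet> normal_axis \<and> x \<bullet> normal_axis \<le> l + h \<and> norm (tangential x) < a}
    = ennreal (h * a ^ ?s * \<kappa>)" if "0 < a" "0 < h" for a h l
    using emeasure_cylinder[OF that, of l, where 'a='a] that \<kappa> by (simp add: ennreal_mult)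
  have scale: "emeasure lborel (K h) = ennreal (h ^ ?n) * emeasure lborel (K 1)" if "0 < h" for h
  proof -
    have "K h = (\<lambda>x. 0 + h *\<^sub>R x) ` K 1"
    proof safe
      fix x assume x: "x \<in> K h"
      then have "(1/h) *\<^sub>R x \<in> K 1" using that by (auto simp: K_def tangential_scaleR field_simps)
      then show "x \<in> (\<lambda>x. 0 + h *\<^sub>R x) ` K 1" using that by (intro image_eqI[of _ _ "(1/h) *\<^sub>R x"]) auto
    qed (use that in \<open>auto simp: K_def tangential_scaleR\<close>)
    then show ?thesis using emeasure_lborel_affine_image[of "K 1" h 0] that by simp
  qed
  have "emeasure lborel (K 1) \<le> ennreal (1 * \<tau> ^ ?s * \<kappa>)"
    unfolding cyl[OF \<tau> zero_less_one, of 0, symmetric]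
    using \<tau> by (intro emeasure_mono) (auto simp: K_def intro: order_less_le_trans)
  then have finK: "emeasure lborel (K 1) < top" by (rule order_le_less_trans) simp
  define W where "W = enn2real (emeasure lborel (K 1))"
  have W: "emeasure lborel (K 1) = ennreal W" "0 \<le> W" using finK by (auto simp: W_def)
  have trunc: "emeasure lborel (K 1 - K x) = ennreal ((1 - x) * (W * (\<Sum>i<?n. x ^ i)))" if "0 < x" "x < 1" for x
  proof -
    have "emeasure lborel (K 1 - K x) = emeasure lborel (K 1) - emeasure lborel (K x)"
      using scale[OF that(1)] W that by (intro emeasure_Diff) (auto simp: K_def ennreal_mult_eq_top_iff)
    also have "\<dots> = ennreal (W - x ^ ?n * W)"
      unfolding scale[OF that(1)] W(1) using W(2) that by (simp add: ennreal_minus flip: ennreal_mult)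
    also have "W - x ^ ?n * W = (1 - x) * (W * (\<Sum>i<?n. x ^ i))"
    proof -
      have "W - x ^ ?n * W = W * (1 - x ^ ?n)" by (simp add: algebra_simps)
      then show ?thesis unfolding one_diff_power_eq by (simp only: ac_simps)
    qed
    finally show ?thesis .
  qed
  have upper: "W * (\<Sum>i<?n. x ^ i) \<le> \<tau> ^ ?s * \<kappa>" if x: "0 < x" "x < 1" for x
  proof -
    have "emeasure lborel (K 1 - K x) \<le> ennreal ((1 - x) * \<tau> ^ ?s * \<kappa>)"
      unfolding cyl[OF \<tau>, of "1 - x" x, symmetric, unfolded diff_gt_0_iff_gt, OF x(2)]
      using \<tau> by (intro emeasure_mono) (auto simp: K_def intro: order_less_le_trans)
    then have "(1 - x) * (W * (\<Sum>i<?n. x ^ i)) \<le> (1 - x) * (\<tau> ^ ?s * \<kappa>)"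
      unfolding trunc[OF x] using x \<tau> \<kappa> by (simp add: mult.assoc)
    then show ?thesis using x by simp
  qed
  have lower: "x * x ^ ?s * \<tau> ^ ?s * \<kappa> \<le> W * (\<Sum>i<?n. x ^ i)" if x: "0 < x" "x < 1" for x
  proof -
    have pos: "0 < \<tau> * x" "0 < (1 - x) * x" using x \<tau> by auto
    have "ennreal ((1 - x) * x * (\<tau> * x) ^ ?s * \<kappa>) \<le> emeasure lborel (K 1 - K x)"
      unfolding cyl[OF pos, of x, symmetric]
    proof (intro emeasure_mono subsetI)
      fix y :: 'a assume "y \<in> {y. x \<le> y \<bullet> normal_axis \<and> y \<bullet> normal_axis \<le> x + (1 - x) * x \<and> norm (tangential y) < \<tau> * x}"
      then have y: "x \<le> y \<bullet> normal_axis" "y \<bullet> normal_axis \<le> x + (1 - x) * x" "norm (tangential y) < \<tau> * x" by auto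
      have "(1 - x) * x < (1 - x) * 1" using x by (intro mult_strict_left_mono) auto
      then have "x + (1 - x) * x < 1" by (simp only: mult_1_right less_diff_eq add.commute)
      moreover have "\<tau> * x \<le> \<tau> * (y \<bullet> normal_axis)" using y \<tau> by simp
      ultimately show "y \<in> K 1 - K x" using y x by (auto simp: K_def)
    qed auto
    then have "(1 - x) * (x * x ^ ?s * \<tau> ^ ?s * \<kappa>) \<le> (1 - x) * (W * (\<Sum>i<?n. x ^ i))"
      unfolding trunc[OF x] using x W by (simp add: ac_simps power_mult_distrib sum_nonneg)
    then show ?thesis using x by simp
  qed
  have ev: "\<forall>\<^sub>F x in at_left (1::real). 0 < x \<and> x < 1"
    by (intro eventually_at_leftI[of 0]) auto
  have t1: "((\<lambda>x. W * (\<Sum>i<?n. x ^ i)) \<longlongrightarrow> W * (\<Sum>i<?n. 1 ^ i)) (at_left 1)"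
    by (intro tendsto_intros)
  have t2: "((\<lambda>x. x * x ^ ?s * \<tau> ^ ?s * \<kappa>) \<longlongrightarrow> 1 * 1 ^ ?s * \<tau> ^ ?s * \<kappa>) (at_left 1)"
    by (intro tendsto_intros)
  have "W * (\<Sum>i<?n. 1 ^ i) \<le> \<tau> ^ ?s * \<kappa>"
    by (rule tendsto_upperbound[OF t1]) (use ev upper in \<open>auto elim!: eventually_mono\<close>)
  moreover have "1 * 1 ^ ?s * \<tau> ^ ?s * \<kappa> \<le> W * (\<Sum>i<?n. 1 ^ i)"
    by (rule tendsto_le[OF _ t1 t2]) (use ev lower in \<open>auto elim!: eventually_mono\<close>)
  ultimately have "real ?n * W = \<tau> ^ ?s * \<kappa>" by (simp add: mult.commute)
  then have e: "ennreal (real ?n) * ennreal W = ennreal (\<tau> ^ ?s * \<kappa>)"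
    using W by (simp flip: ennreal_mult)
  have "ennreal (real ?n) * emeasure lborel (K h) = ennreal (h ^ ?n) * ennreal (\<tau> ^ ?s * \<kappa>)"
    unfolding scale[OF h] W(1) mult.left_commute[of "ennreal (real ?n)"] e ..
  then show ?thesis
    using \<kappa> h \<tau> by (simp add: K_def ennreal_mult mult.assoc)
qed

text \<open>For the cap of the sphere with height above \<open>q\<close>, all estimates are in terms of the flat disc of radius
  \<open>a\<close> below it, with ratios that tend to \<open>1\<close> as \<open>q\<close> does.\<close>
lemma sphere_measure_cap_bounds:
  fixes q a :: real
  defines "C \<equiv> {\<omega>::'a::euclidean_space. norm \<omega> = 1 \<and> q < \<omega> \<bullet> normal_axis}"
  assumes q: "0 < q" "q < 1" and a: "a = sqrt (1 - q\<^sup>2)"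
  shows "emeasure sphere_measure C \<le> ennreal ((a / q) ^ (DIM('a) - 1)) * emeasure slab_measure (ball (0::'a) 1)"
    and "ennreal (q ^ DIM('a) * (a / q) ^ (DIM('a) - 1)) * emeasure slab_measure (ball (0::'a) 1) \<le> emeasure sphere_measure C"
proof -
  have q2: "q\<^sup>2 < 1" using q by (simp add: power_less_one_iff)
  have a0: "0 < a" using q2 a by simp
  have a2: "a\<^sup>2 = 1 - q\<^sup>2" using q2 a by simp
  have [measurable]: "C \<in> sets borel" unfolding C_def by measurable
  define K where "K h = {x::'a. 0 < x \<bullet> normal_axis \<and>
      x \<bullet> normal_axis < h \<and> norm (tangential x) < a / q * (x \<bullet> normal_axis)}" for h
  have [measurable]: "K h \<in> sets borel" for h unfolding K_def by measurable
  define S where "S = {x::'a. 0 < norm x \<and> norm x < 1 \<and> sgn x \<in> C}"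
  have [measurable]: "S \<in> sets borel" unfolding S_def by (rule sector_borel) simp
  have sq: "0 < v \<and> u\<^sup>2 < v\<^sup>2 \<longleftrightarrow> u < v" if "0 \<le> u" for u v :: real
    using that power2_less_imp_less[of u v] power_strict_mono[of u v 2] by auto
  have mem: "sgn x \<in> C \<longleftrightarrow> 0 < x \<bullet> normal_axis \<and> norm (tangential x) < a / q * (x \<bullet> normal_axis)" (is "_ \<longleftrightarrow> ?R")
    if "x \<noteq> 0" for x :: 'a
  proof -
    have "sgn x \<in> C \<longleftrightarrow> q * norm x < x \<bullet> normal_axis"
      using that by (auto simp: C_def norm_sgn sgn_div_norm field_simps)
    also have "\<dots> \<longleftrightarrow> 0 < x \<bullet> normal_axis \<and> (q * norm x)\<^sup>2 < (x \<bullet> normal_axis)\<^sup>2"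
      using q by (intro sq[symmetric]) simp
    also have "(q * norm x)\<^sup>2 < (x \<bullet> normal_axis)\<^sup>2 \<longleftrightarrow> (q * norm (tangential x))\<^sup>2 < (a * (x \<bullet> normal_axis))\<^sup>2"
      using norm_sq_tangential[of x] by (simp add: power_mult_distrib a2 algebra_simps)
    also have "0 < x \<bullet> normal_axis \<and> (q * norm (tangential x))\<^sup>2 < (a * (x \<bullet> normal_axis))\<^sup>2 \<longleftrightarrow>
       0 < x \<bullet> normal_axis \<and> q * norm (tangential x) < a * (x \<bullet> normal_axis)"
      using sq[of "q * norm (tangential x)" "a * (x \<bullet> normal_axis)"] q a0 by (auto simp: zero_less_mult_iff)
    also have "\<dots> \<longleftrightarrow> ?R" using q by (auto simp: field_simps)
    finally show ?thesis .
  qed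
  have "S \<subseteq> K 1"
  proof
    fix x assume x: "x \<in> S"
    then have "x \<bullet> normal_axis \<le> norm x" using Basis_le_norm[of normal_axis x] by auto
    then show "x \<in> K 1" using x mem[of x] by (auto simp: S_def K_def)
  qed
  then have "ennreal (real DIM('a)) * emeasure lborel S \<le> ennreal (real DIM('a)) * emeasure lborel (K 1)"
    by (intro mult_left_mono emeasure_mono) auto
  then show "emeasure sphere_measure C \<le> ennreal ((a / q) ^ (DIM('a) - 1)) * emeasure slab_measure (ball (0::'a) 1)"
    using emeasure_solid_cone[of "a / q" 1, where 'a='a] a0 q by (simp add: emeasure_sphere_measure K_def S_def)
  have "K q \<subseteq> S"
  proof
    fix x assume x: "x \<in> K q"
    then have x0: "x \<noteq> 0" by (auto simp: K_def)
    have "sgn x \<in> C" using x mem[OF x0] by (auto simp: K_def)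
    then have "q * norm x < x \<bullet> normal_axis" using x0 by (auto simp: C_def sgn_div_norm field_simps)
    also have "\<dots> < q * 1" using x by (auto simp: K_def)
    finally have "norm x < 1" using q by simp
    then show "x \<in> S" using x0 \<open>sgn x \<in> C\<close> by (auto simp: S_def)
  qed
  then have "ennreal (real DIM('a)) * emeasure lborel (K q) \<le> ennreal (real DIM('a)) * emeasure lborel S"
    by (intro mult_left_mono emeasure_mono) auto
  then show "ennreal (q ^ DIM('a) * (a / q) ^ (DIM('a) - 1)) * emeasure slab_measure (ball (0::'a) 1) \<le> emeasure sphere_measure C"
    using emeasure_solid_cone[of "a / q" q, where 'a='a] a0 q by (simp add: emeasure_sphere_measure K_def S_def)
qed

text \<open>The projection of the cap to the flat disc does not increase distances, and its inverse increases them
  at most by the factor \<open>1/q\<close>.\<close>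
lemma hausdorff_outer_cap_bounds:
  fixes q a :: real
  defines "C \<equiv> {\<omega>::'a::euclidean_space. norm \<omega> = 1 \<and> q < \<omega> \<bullet> normal_axis}"
  assumes q: "0 < q" "q < 1" and a: "a = sqrt (1 - q\<^sup>2)" and s: "0 < s"
  shows "hausdorff_outer s (ball 0 a \<inter> (hyperplane :: 'a set)) \<le> hausdorff_outer s C"
    and "hausdorff_outer s C \<le> ennreal ((1 / q) ^ s) * hausdorff_outer s (ball 0 a \<inter> (hyperplane :: 'a set))"
proof -
  have q2: "q\<^sup>2 < 1" using q by (simp add: power_less_one_iff)
  have a0: "0 < a" using q2 a by simp
  have a2: "a\<^sup>2 = 1 - q\<^sup>2" using q2 a by simp
  define g where "g y = y + sqrt (1 - (norm y)\<^sup>2) *\<^sub>R (normal_axis::'a)" for y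
  have tan: "tangential x \<in> ball 0 a \<and> g (tangential x) = x" if "x \<in> C" for x
  proof -
    have x: "norm x = 1" "q < x \<bullet> normal_axis" using that by (auto simp: C_def)
    have eq: "1 - (norm (tangential x))\<^sup>2 = (x \<bullet> normal_axis)\<^sup>2" using norm_sq_tangential[of x] x by simp
    have "q\<^sup>2 < (x \<bullet> normal_axis)\<^sup>2" using x q by (intro power_strict_mono) auto
    then have "(norm (tangential x))\<^sup>2 < a\<^sup>2" using eq a2 by simp
    then have "norm (tangential x) < a" using a0 by (simp add: power2_less_imp_less)
    moreover have "g (tangential x) = x" unfolding g_def eq using x q by (simp add: tangential_def)
    ultimately show ?thesis by simp
  qed
  have g: "g y \<in> C \<and> tangential (g y) = y \<and> q < sqrt (1 - (norm y)\<^sup>2)" if "y \<in> ball 0 a \<inter> hyperplane" for y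
  proof -
    have y: "norm y < a" "y \<bullet> normal_axis = 0" using that by (auto simp: hyperplane_def)
    have "(norm y)\<^sup>2 < a\<^sup>2" using y by (intro power_strict_mono) auto
    then have lt: "q\<^sup>2 < 1 - (norm y)\<^sup>2" using a2 by simp
    then have sq: "q < sqrt (1 - (norm y)\<^sup>2)" using q by (simp add: real_less_rsqrt)
    have ax: "g y \<bullet> normal_axis = sqrt (1 - (norm y)\<^sup>2)" using y by (simp add: g_def inner_add_left)
    have tg: "tangential (g y) = y" using y ax by (simp add: tangential_def) (simp add: g_def)
    have "(norm (g y))\<^sup>2 = 1"
      using norm_sq_tangential[of "g y"] lt q by (simp add: tg ax) (smt (verit) real_sqrt_pow2 zero_le_power2)
    then have "norm (g y) = 1" using norm_ge_zero[of "g y"] unfolding power2_eq_1_iff by linarith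
    then show ?thesis using sq ax tg by (simp add: C_def)
  qed
  have "tangential ` C = ball 0 a \<inter> hyperplane"
  proof safe
    fix y :: 'a assume "y \<in> ball 0 a" "y \<in> hyperplane"
    then have "g y \<in> C" "y = tangential (g y)" using g[of y] by auto
    then show "y \<in> tangential ` C" by blast
  qed (use tan in auto)
  then show "hausdorff_outer s (ball 0 a \<inter> (hyperplane :: 'a set)) \<le> hausdorff_outer s C"
    using hausdorff_outer_lipschitz_image[OF s, of 1 C tangential]
    by (simp add: dist_norm norm_tangential_le flip: tangential_diff)
  have "g ` (ball 0 a \<inter> hyperplane) = C"
  proof safe
    fix x assume "x \<in> C"
    then have "tangential x \<in> ball 0 a \<inter> hyperplane" "x = g (tangential x)" using tan[of x] by auto
    then show "x \<in> g ` (ball 0 a \<inter> hyperplane)" by (rule rev_image_eqI)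
  qed (use g in auto)
  moreover have "dist (g x) (g y) \<le> 1 / q * dist x y"
    if xy: "x \<in> ball 0 a \<inter> hyperplane" "y \<in> ball 0 a \<inter> hyperplane" for x y
  proof -
    define u v where "u = sqrt (1 - (norm x)\<^sup>2)" and "v = sqrt (1 - (norm y)\<^sup>2)"
    have uv: "q < u" "q < v" using g xy by (auto simp: u_def v_def)
    have u2: "u\<^sup>2 = 1 - (norm x)\<^sup>2" "v\<^sup>2 = 1 - (norm y)\<^sup>2"
      using uv q unfolding u_def v_def by (smt (verit) real_sqrt_le_0_iff real_sqrt_pow2)+
    have "(u - v) * (u + v) = (norm y - norm x) * (norm y + norm x)"
      using u2 by (simp add: power2_eq_square algebra_simps)
    then have "\<bar>u - v\<bar> * (u + v) = \<bar>norm y - norm x\<bar> * (norm y + norm x)"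
    proof -
      assume e: "(u - v) * (u + v) = (norm y - norm x) * (norm y + norm x)"
      have "\<bar>u - v\<bar> * \<bar>u + v\<bar> = \<bar>norm y - norm x\<bar> * \<bar>norm y + norm x\<bar>"
        unfolding abs_mult[symmetric] e ..
      then show ?thesis using uv q by simp
    qed
    also have "\<dots> \<le> dist x y * (2 * a)"
      using xy norm_triangle_ineq3[of y x] by (intro mult_mono) (auto simp: dist_norm norm_minus_commute)
    finally have "\<bar>u - v\<bar> * (u + v) \<le> dist x y * (2 * a)" .
    moreover have "\<bar>u - v\<bar> * (2 * q) \<le> \<bar>u - v\<bar> * (u + v)" using uv by (intro mult_left_mono) auto
    ultimately have "\<bar>u - v\<bar> * (2 * q) \<le> dist x y * (2 * a)" by linarith
    then have "q * \<bar>u - v\<bar> \<le> a * dist x y" by (simp add: mult.commute mult.left_commute)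
    then have "(q * \<bar>u - v\<bar>)\<^sup>2 \<le> (a * dist x y)\<^sup>2" using q by (intro power_mono) auto
    then have *: "q\<^sup>2 * (u - v)\<^sup>2 \<le> (1 - q\<^sup>2) * (dist x y)\<^sup>2" by (simp add: power_mult_distrib a2)
    have "tangential (g x - g y) = x - y" "(g x - g y) \<bullet> normal_axis = u - v"
      using g[OF xy(1)] g[OF xy(2)] xy by (auto simp: tangential_diff hyperplane_def g_def u_def v_def inner_diff_left inner_add_left)
    then have "(dist (g x) (g y))\<^sup>2 = (dist x y)\<^sup>2 + (u - v)\<^sup>2"
      using norm_sq_tangential[of "g x - g y"] by (simp add: dist_norm)
    then have "(q * dist (g x) (g y))\<^sup>2 \<le> (dist x y)\<^sup>2"
      using * by (simp add: power_mult_distrib algebra_simps)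
    then have "q * dist (g x) (g y) \<le> dist x y" by (rule power2_le_imp_le) simp
    then show ?thesis using q by (simp add: field_simps)
  qed
  ultimately show "hausdorff_outer s C \<le> ennreal ((1 / q) ^ s) * hausdorff_outer s (ball 0 a \<inter> (hyperplane :: 'a set))"
    using hausdorff_outer_lipschitz_image[OF s, of "1/q" "ball 0 a \<inter> hyperplane" g] q by simp
qed

text \<open>Both measures are uniformly distributed on the sphere.  Small caps are almost isometric to flat discs, on which the
  Hausdorff measure is \<open>c\<close> times the volume, so the factor between the two measures is the
  factor \<open>c\<close> of the hyperplane.\<close>
lemma hausdorff_unit_sphere:
  fixes c :: real
  assumes dim: "2 \<le> DIM('a::euclidean_space)" and c: "0 < c"
    and disc: "\<And>t. 0 < t \<Longrightarrow> hausdorff_outer (DIM('a) - 1) (ball 0 t \<inter> (hyperplane :: 'a set))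
       = ennreal c * emeasure slab_measure (ball (0::'a) t)"
  shows "density (hausdorff_measure (DIM('a) - 1)) (indicator (sphere (0::'a) 1))
       = scale_measure (ennreal c) sphere_measure"
proof -
  let ?n = "DIM('a)" and ?s = "DIM('a) - 1"
  have s: "0 < ?s" using dim by simp
  define e where "e = (normal_axis :: 'a)"
  have e: "norm e = 1" by (simp add: e_def)
  define \<nu> :: "'a measure" where "\<nu> = density (hausdorff_measure ?s) (indicator (sphere 0 1))"
  have nu: "emeasure \<nu> A = hausdorff_outer ?s (A \<inter> sphere 0 1)" if "A \<in> sets borel" for A
    unfolding \<nu>_def using that s
    by (subst emeasure_restricted) (auto simp: emeasure_hausdorff_measure Int_commute)
  define \<kappa> where "\<kappa> = enn2real (emeasure slab_measure (ball (0::'a) 1))"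
  have \<kappa>: "0 < \<kappa>" "emeasure slab_measure (ball (0::'a) 1) = ennreal \<kappa>"
    using slab_measure_unit_ball[where 'a='a] by (auto simp: \<kappa>_def enn2real_positive_iff)
  \<comment> \<open>radii below \<open>1\<close> keep the caps in the half-space, so that the height \<open>q\<close> is positive\<close>
  define r where "r k = 1 / (real k + 2)" for k
  define q where "q k = 1 - (r k)\<^sup>2 / 2" for k
  define a where "a k = sqrt (1 - (q k)\<^sup>2)" for k
  have r: "0 < r k" "r k < 1" for k by (auto simp: r_def)
  have q: "0 < q k" "q k < 1" for k
    using r[of k] power_less_one_iff[of "r k" 2] by (auto simp: q_def)
  have a: "0 < a k" for k using q[of k] by (simp add: a_def power_less_one_iff)
  define C where "C k = {\<omega>::'a. norm \<omega> = 1 \<and> q k < \<omega> \<bullet> normal_axis}" for k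
  have capC: "ball e (r k) \<inter> sphere 0 1 = C k" for k
  proof -
    have "dist e \<omega> < r k \<longleftrightarrow> q k < \<omega> \<bullet> normal_axis" if "norm \<omega> = 1" for \<omega>
    proof -
      have "dist e \<omega> < r k \<longleftrightarrow> (dist e \<omega>)\<^sup>2 < (r k)\<^sup>2"
        using r[of k] by (metis power_strict_mono power2_less_imp_less zero_le_dist zero_less_numeral less_imp_le)
      also have "(dist e \<omega>)\<^sup>2 = 2 - 2 * (\<omega> \<bullet> normal_axis)"
        using that e unfolding dist_norm e_def
        by (simp add: power2_norm_eq_inner inner_diff_left inner_diff_right inner_commute norm_eq_1)
      finally show ?thesis by (auto simp: q_def)
    qed
    then show ?thesis by (auto simp: C_def)
  qed
  have haus: "emeasure \<nu> (ball x (r k)) = hausdorff_outer ?s (C k)" if "x \<in> sphere 0 1" for x :: 'a and k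
    unfolding nu[OF borel_open[OF open_ball]] capC[symmetric]
    using hausdorff_outer_cap[OF s, of x e "r k"] that e by simp
  have sph: "emeasure sphere_measure (ball x (r k)) = emeasure sphere_measure (C k)" if "x \<in> sphere 0 1" for x :: 'a and k
  proof -
    have "emeasure sphere_measure (ball x (r k)) = emeasure sphere_measure (ball e (r k))"
      using that e by (intro sphere_measure_ball) simp
    also have "\<dots> = emeasure sphere_measure (C k)"
      unfolding capC[symmetric]
      using sphere_measure_null[where 'a='a] by (auto intro!: emeasure_eq_AE AE_I[of _ _ "- sphere 0 1"])
    finally show ?thesis .
  qed
  define M where "M k = enn2real (emeasure sphere_measure (C k))" for k
  define N where "N k = enn2real (hausdorff_outer ?s (C k))" for k
  have slab: "emeasure slab_measure (ball (0::'a) (a k)) = ennreal (a k ^ ?s * \<kappa>)" for k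
    unfolding slab_measure_ball_scale[OF a] \<kappa>(2) using a[of k] \<kappa> by (simp add: ennreal_mult)
  have Mb: "emeasure sphere_measure (C k) = ennreal (M k)" "0 < M k"
      "q k ^ ?n * (a k / q k) ^ ?s * \<kappa> \<le> M k" "M k \<le> (a k / q k) ^ ?s * \<kappa>" for k
  proof -
    note b = sphere_measure_cap_bounds[OF q[of k] a_def[of k], where 'a='a, folded C_def, unfolded \<kappa>(2)]
    have ub: "emeasure sphere_measure (C k) \<le> ennreal ((a k / q k) ^ ?s * \<kappa>)"
      using b(1) a[of k] q[of k] \<kappa> by (simp add: ennreal_mult)
    show M: "emeasure sphere_measure (C k) = ennreal (M k)"
      unfolding M_def using sphere_measure_finite[of "C k"] by simp
    show "M k \<le> (a k / q k) ^ ?s * \<kappa>"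
      using ub a[of k] q[of k] \<kappa> unfolding M by (simp add: ennreal_le_iff)
    have "ennreal (q k ^ ?n * (a k / q k) ^ ?s * \<kappa>) \<le> ennreal (M k)"
      using b(2) a[of k] q[of k] \<kappa> unfolding M by (simp add: ennreal_mult)
    then show lb: "q k ^ ?n * (a k / q k) ^ ?s * \<kappa> \<le> M k"
      by (subst (asm) ennreal_le_iff) (auto simp: M_def)
    have "0 < q k ^ ?n * (a k / q k) ^ ?s * \<kappa>" using a[of k] q[of k] \<kappa> by simp
    then show "0 < M k" using lb by linarith
  qed
  have Nb: "hausdorff_outer ?s (C k) = ennreal (N k)" "0 < N k"
      "c * (a k ^ ?s * \<kappa>) \<le> N k" "N k \<le> (1 / q k) ^ ?s * (c * (a k ^ ?s * \<kappa>))" for k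
  proof -
    note b = hausdorff_outer_cap_bounds[OF q[of k] a_def[of k] s, where 'a='a, folded C_def,
        unfolded disc[OF a] slab]
    have ub: "hausdorff_outer ?s (C k) \<le> ennreal ((1 / q k) ^ ?s * (c * (a k ^ ?s * \<kappa>)))"
      using b(2) a[of k] q[of k] \<kappa> c by (simp add: ennreal_mult)
    show N: "hausdorff_outer ?s (C k) = ennreal (N k)"
      unfolding N_def using order_le_less_trans[OF ub ennreal_less_top] by simp
    show "N k \<le> (1 / q k) ^ ?s * (c * (a k ^ ?s * \<kappa>))"
      using ub a[of k] q[of k] \<kappa> c unfolding N by (simp add: ennreal_le_iff)
    have "ennreal (c * (a k ^ ?s * \<kappa>)) \<le> ennreal (N k)"
      using b(1) a[of k] \<kappa> c unfolding N by (simp add: ennreal_mult)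
    then show lb: "c * (a k ^ ?s * \<kappa>) \<le> N k"
      by (subst (asm) ennreal_le_iff) (auto simp: N_def)
    have "0 < c * (a k ^ ?s * \<kappa>)" using a[of k] c \<kappa> by simp
    then show "0 < N k" using lb by linarith
  qed
  have r0: "r \<longlonglongrightarrow> 0"
    unfolding r_def by real_asymp
  then have q1: "q \<longlonglongrightarrow> 1"
    unfolding q_def by (auto intro!: tendsto_eq_intros)
  have ratio: "(\<lambda>k. N k / M k) \<longlonglongrightarrow> c"
  proof (rule tendsto_sandwich[of "\<lambda>k. c * q k ^ ?s" _ _ "\<lambda>k. c / q k ^ ?n"])
    show "\<forall>\<^sub>F k in sequentially. c * q k ^ ?s \<le> N k / M k"
    proof (intro always_eventually allI)
      fix k
      have "c * q k ^ ?s * M k \<le> c * q k ^ ?s * ((a k / q k) ^ ?s * \<kappa>)"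
        using c q[of k] Mb(4) by (intro mult_left_mono) auto
      also have "\<dots> = c * (a k ^ ?s * \<kappa>)" using q[of k] by (simp add: power_divide)
      also have "\<dots> \<le> N k" by (rule Nb)
      finally show "c * q k ^ ?s \<le> N k / M k" using Mb(2)[of k] by (simp add: field_simps)
    qed
    show "\<forall>\<^sub>F k in sequentially. N k / M k \<le> c / q k ^ ?n"
    proof (intro always_eventually allI)
      fix k
      have "q k ^ ?n * N k \<le> q k ^ ?n * ((1 / q k) ^ ?s * (c * (a k ^ ?s * \<kappa>)))"
        using q[of k] Nb(4) by (intro mult_left_mono) auto
      also have "\<dots> = c * (q k ^ ?n * (a k / q k) ^ ?s * \<kappa>)" by (simp add: power_divide)
      also have "\<dots> \<le> c * M k" using c Mb(3) by (intro mult_left_mono) auto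
      finally show "N k / M k \<le> c / q k ^ ?n" using Mb(2)[of k] q[of k] by (simp add: field_simps)
    qed
    show "(\<lambda>k. c * q k ^ ?s) \<longlonglongrightarrow> c" "(\<lambda>k. c / q k ^ ?n) \<longlonglongrightarrow> c"
      using q1 by (auto intro!: tendsto_eq_intros)
  qed
  have "\<nu> = scale_measure (ennreal c) sphere_measure"
  proof (rule uniformly_distributed_proportional[where z=0 and S="sphere 0 1" and r=r and m=M and n=N])
    show "emeasure sphere_measure (ball (0::'a) t) < top" for t by (rule sphere_measure_finite)
    show "emeasure \<nu> (ball 0 t) < top" for t
    proof -
      have "sphere (0::'a) 1 \<subseteq> (\<Union>x\<in>sphere 0 1. ball x (r 0))" using r by auto
      then obtain F where F: "F \<subseteq> sphere (0::'a) 1" "finite F" "sphere (0::'a) 1 \<subseteq> (\<Union>x\<in>F. ball x (r 0))"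
        using compactE_image[OF compact_sphere, of "sphere 0 1" "\<lambda>x. ball x (r 0)" 0 1] by (metis open_ball)
      have "emeasure \<nu> (ball 0 t) \<le> emeasure \<nu> (sphere 0 1)"
        unfolding nu[OF borel_open[OF open_ball]] nu[OF borel_closed[OF closed_sphere]]
        by (rule hausdorff_outer_mono) auto
      also have "\<dots> \<le> emeasure \<nu> (\<Union>x\<in>F. ball x (r 0))"
        using F by (intro emeasure_mono) (auto simp: \<nu>_def)
      also have "\<dots> \<le> (\<Sum>x\<in>F. emeasure \<nu> (ball x (r 0)))"
        using F by (intro emeasure_subadditive_finite) (auto simp: \<nu>_def)
      also have "\<dots> = (\<Sum>x\<in>F. ennreal (N 0))"
        using F haus Nb(1) by (intro sum.cong) auto
      also have "\<dots> < top" by (simp add: ennreal_mult_less_top of_nat_less_top)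
      finally show ?thesis .
    qed
    show "emeasure \<nu> (- sphere 0 1) = 0"
      by (subst nu) (simp_all add: hausdorff_outer_empty[OF s] del: One_nat_def)
    show "emeasure sphere_measure (- sphere (0::'a) 1) = 0" by (rule sphere_measure_null)
  qed (use c r0 ratio Mb Nb haus sph in \<open>auto simp: \<nu>_def\<close>)
  then show ?thesis by (simp add: \<nu>_def)
qed

definition area_measure :: "'a::euclidean_space measure" where
  "area_measure = scale_measure (1 / emeasure (hausdorff_measure (DIM('a) - 1)) (unit_facet :: 'a set))
          (hausdorff_measure (DIM('a) - 1))"

lemma sets_area_measure [simp, measurable_cong]: "sets area_measure = sets borel"
  by (simp add: area_measure_def)

lemma surface_measure_area: "surface_measure \<Omega> = restrict_space area_measure (frontier \<Omega>)"
  by (simp add: surface_measure_def area_measure_def)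

lemma emeasure_area_measure_sphere:
  fixes A :: "'a::euclidean_space set"
  assumes dim: "2 \<le> DIM('a)" and R: "0 < R" and A: "A \<in> sets borel"
  shows "emeasure area_measure (A \<inter> sphere z R)
    = ennreal (R ^ (DIM('a) - 1)) * emeasure sphere_measure ((\<lambda>\<omega>. z + R *\<^sub>R \<omega>) -` A)"
proof -
  let ?s = "DIM('a) - 1" and ?T = "\<lambda>\<omega>. z + R *\<^sub>R \<omega>"
  have s: "0 < ?s" using dim by simp
  obtain c where c: "0 < c"
    "emeasure (hausdorff_measure ?s) (unit_facet :: 'a set) = ennreal c"
    "\<And>t. 0 < t \<Longrightarrow> hausdorff_outer ?s (ball 0 t \<inter> (hyperplane :: 'a set))
       = ennreal c * emeasure slab_measure (ball (0::'a) t)"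
    using hausdorff_unit_facet[OF dim] by metis
  let ?B = "?T -` A"
  have B: "?B \<in> sets borel" by (rule measurable_sets_borel[OF _ A]) measurable
  have "A \<inter> sphere z R = ?T ` (?B \<inter> sphere 0 1)"
  proof safe
    fix x assume x: "x \<in> A" "x \<in> sphere z R"
    have "(1/R) *\<^sub>R (x - z) \<in> ?B \<inter> sphere 0 1"
      using x R by (auto simp: dist_norm norm_minus_commute)
    then show "x \<in> ?T ` (?B \<inter> sphere 0 1)"
      using R by (intro image_eqI[of _ _ "(1/R) *\<^sub>R (x - z)"]) auto
  qed (use R in \<open>auto simp: dist_norm\<close>)
  then have "hausdorff_outer ?s (A \<inter> sphere z R) = ennreal (R ^ ?s) * hausdorff_outer ?s (?B \<inter> sphere 0 1)"
    using hausdorff_outer_similarity[OF s R, of "?B \<inter> sphere 0 1" ?T] R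
    by (simp add: dist_norm flip: scaleR_diff_right)
  also have "hausdorff_outer ?s (?B \<inter> sphere 0 1) = emeasure (density (hausdorff_measure ?s) (indicator (sphere (0::'a) 1))) ?B"
    using B s by (subst emeasure_restricted) (auto simp: emeasure_hausdorff_measure Int_commute)
  also have "density (hausdorff_measure ?s) (indicator (sphere (0::'a) 1)) = scale_measure (ennreal c) sphere_measure"
    by (rule hausdorff_unit_sphere[OF dim c(1)]) (rule c(3))
  also have "emeasure (scale_measure (ennreal c) sphere_measure) ?B = ennreal c * emeasure sphere_measure ?B"
    using B by simp
  finally have "emeasure area_measure (A \<inter> sphere z R)
    = (1 / ennreal c) * (ennreal (R ^ ?s) * (ennreal c * emeasure sphere_measure ?B))"
    using A s unfolding area_measure_def c(2) by (simp add: emeasure_hausdorff_measure)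
  also have "\<dots> = ((1 / ennreal c) * ennreal c) * (ennreal (R ^ ?s) * emeasure sphere_measure ?B)"
    by (simp only: ac_simps)
  also have "(1 / ennreal c) * ennreal c = 1"
    using c(1) by (simp add: ennreal_divide_times)
  finally show ?thesis by simp
qed

lemma nn_integral_area_measure_sphere:
  fixes f :: "'a::euclidean_space \<Rightarrow> ennreal"
  assumes dim: "2 \<le> DIM('a)" and R: "0 < R" and [measurable]: "f \<in> borel_measurable borel"
  shows "(\<integral>\<^sup>+x. f x * indicator (sphere z R) x \<partial>area_measure)
    = ennreal (R ^ (DIM('a) - 1)) * (\<integral>\<^sup>+\<omega>. f (z + R *\<^sub>R \<omega>) \<partial>sphere_measure)"
proof -
  let ?T = "\<lambda>\<omega>. z + R *\<^sub>R \<omega>"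
  have eq: "density area_measure (indicator (sphere z R))
      = scale_measure (ennreal (R ^ (DIM('a) - 1))) (distr sphere_measure borel ?T)"
  proof (rule measure_eqI)
    fix A :: "'a set" assume "A \<in> sets (density area_measure (indicator (sphere z R)))"
    then have A: "A \<in> sets borel" by simp
    have "emeasure (density area_measure (indicator (sphere z R))) A = emeasure area_measure (A \<inter> sphere z R)"
      using A by (subst emeasure_restricted) (auto simp: Int_commute)
    also have "\<dots> = emeasure (scale_measure (ennreal (R ^ (DIM('a) - 1))) (distr sphere_measure borel ?T)) A"
      using A emeasure_area_measure_sphere[OF dim R A, of z] by (simp add: emeasure_distr)
    finally show "emeasure (density area_measure (indicator (sphere z R))) A
      = emeasure (scale_measure (ennreal (R ^ (DIM('a) - 1))) (distr sphere_measure borel ?T)) A" .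
  qed simp
  have "(\<integral>\<^sup>+x. f x * indicator (sphere z R) x \<partial>area_measure)
      = (\<integral>\<^sup>+x. f x \<partial>density area_measure (indicator (sphere z R)))"
    by (subst nn_integral_density) (auto simp: mult.commute intro!: borel_measurable_indicator)
  also have "\<dots> = ennreal (R ^ (DIM('a) - 1)) * (\<integral>\<^sup>+x. f (?T x) \<partial>sphere_measure)"
    unfolding eq by (subst nn_integral_scale_measure) (auto simp: nn_integral_distr)
  finally show ?thesis .
qed

section \<open>Polar coordinates\<close>

definition radial_measure :: "nat \<Rightarrow> real measure" where
  "radial_measure n = density lborel (\<lambda>s. ennreal (\<bar>s\<bar> ^ (n - 1)) * indicator {0<..} s)"

lemma sets_radial_measure [simp, measurable_cong]: "sets (radial_measure n) = sets borel"
  by (simp add: radial_measure_def)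

lemma space_radial_measure [simp]: "space (radial_measure n) = UNIV"
  by (simp add: radial_measure_def)

lemma emeasure_radial_measure:
  assumes n: "0 < n"
  shows "emeasure (radial_measure n) {..<a} = ennreal (if 0 < a then a ^ n / real n else 0)"
proof -
  have "emeasure (radial_measure n) {..<a}
      = (\<integral>\<^sup>+s. ennreal (\<bar>s\<bar> ^ (n - 1)) * indicator {0<..} s * indicator {..<a} s \<partial>lborel)"
    unfolding radial_measure_def by (subst emeasure_density) auto
  also have "\<dots> = ennreal (if 0 < a then a ^ n / real n else 0)"
  proof (cases "0 < a")
    case True
    have "AE s in lborel. s \<noteq> 0" "AE s in lborel. s \<noteq> a" by (rule AE_lborel_singleton)+
    then have "(\<integral>\<^sup>+s. ennreal (\<bar>s\<bar> ^ (n - 1)) * indicator {0<..} s * indicator {..<a} s \<partial>lborel)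
      = (\<integral>\<^sup>+s. ennreal (\<bar>s\<bar> ^ (n - 1)) * indicator {0..a} s \<partial>lborel)"
      by (intro nn_integral_cong_AE) (auto simp: indicator_def)
    also have "\<dots> = ennreal (a ^ n / real n - 0 ^ n / real n)"
    proof (rule nn_integral_FTC_Icc)
      fix s assume "s \<in> {0..a}"
      then show "((\<lambda>s. s ^ n / real n) has_real_derivative \<bar>s\<bar> ^ (n - 1)) (at s)"
        using n by (auto intro!: derivative_eq_intros)
    qed (use True in auto)
    finally show ?thesis using True n by (simp add: power_0_left)
  next
    case False
    then have "(\<lambda>s. ennreal (\<bar>s\<bar> ^ (n - 1)) * indicator {0<..} s * indicator {..<a} s) = (\<lambda>s. 0)"
      by (auto simp: indicator_def)
    then show ?thesis using False by simp
  qed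
  finally show ?thesis .
qed

lemma sigma_finite_radial_measure: "0 < n \<Longrightarrow> sigma_finite_measure (radial_measure n)"
proof
  assume n: "0 < n"
  have "(\<Union>i::nat. {..<real i}) = UNIV" by (auto simp: reals_Archimedean2)
  then show "\<exists>A. countable A \<and> A \<subseteq> sets (radial_measure n) \<and> \<Union>A = space (radial_measure n) \<and>
      (\<forall>a\<in>A. emeasure (radial_measure n) a \<noteq> \<infinity>)"
    by (intro exI[of _ "range (\<lambda>i::nat. {..<real i})"])
      (auto simp: emeasure_radial_measure[OF n])
qed

text \<open>For fixed \<open>A\<close> both sides are measures in \<open>B\<close>, and by homogeneity of the volume they agree on the sets of radii
  below a given bound.\<close>
lemma emeasure_sector:
  fixes A :: "'a::euclidean_space set"
  assumes A: "A \<in> sets borel" and B: "B \<in> sets borel"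
  shows "emeasure lborel {x. sgn x \<in> A \<and> norm x \<in> B}
    = emeasure sphere_measure A * emeasure (radial_measure DIM('a)) B"
proof -
  have n: "0 < DIM('a)" by simp
  have sA: "sgn -` A \<in> sets borel" by (rule measurable_sets_borel[OF borel_measurable_sgn' A])
  define M where "M = distr (density lborel (indicator (sgn -` A))) borel (norm :: 'a \<Rightarrow> real)"
  have M: "emeasure M B = emeasure lborel {x. sgn x \<in> A \<and> norm x \<in> B}" if "B \<in> sets borel" for B
  proof -
    have "emeasure M B = emeasure lborel (sgn -` A \<inter> norm -` B)"
      unfolding M_def using sA that measurable_sets_borel[OF borel_measurable_norm that]
        emeasure_restricted[of "sgn -` A" lborel "norm -` B"]
      by (subst emeasure_distr) auto
    also have "sgn -` A \<inter> norm -` B = {x. sgn x \<in> A \<and> norm x \<in> B}" by auto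
    finally show ?thesis .
  qed
  have lt: "emeasure M {..<a} = ennreal (if 0 < a then a ^ DIM('a) else 0) *
      emeasure lborel {x. 0 < norm x \<and> norm x < 1 \<and> sgn x \<in> A}" for a
  proof (cases "0 < a")
    case True
    let ?S = "\<lambda>t. {x. 0 < norm x \<and> norm x < t \<and> sgn x \<in> A}"
    have "emeasure M {..<a} = emeasure lborel {x. sgn x \<in> A \<and> norm x \<in> {..<a}}" by (simp add: M)
    also have "\<dots> = emeasure lborel (?S a)"
    proof (rule emeasure_eq_AE)
      have "AE x in lborel. x \<noteq> (0::'a)" by (rule AE_lborel_singleton)
      then show "AE x in lborel. x \<in> {x. sgn x \<in> A \<and> norm x \<in> {..<a}} \<longleftrightarrow> x \<in> ?S a" by eventually_elim auto
      have "{x. sgn x \<in> A \<and> norm x \<in> {..<a}} = sgn -` A \<inter> norm -` {..<a}" by auto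
      then show "{x. sgn x \<in> A \<and> norm x \<in> {..<a}} \<in> sets lborel"
        using sA measurable_sets_borel[OF borel_measurable_norm, of "{..<a}"] by simp
      show "?S a \<in> sets lborel" using sector_borel[OF A, of a] by simp
    qed
    also have "?S a = (\<lambda>x. 0 + a *\<^sub>R x) ` ?S 1"
    proof safe
      fix x assume x: "0 < norm x" "norm x < a" "sgn x \<in> A"
      then have "(1/a) *\<^sub>R x \<in> ?S 1" using True by (auto simp: sgn_scaleR)
      then show "x \<in> (\<lambda>x. 0 + a *\<^sub>R x) ` ?S 1" using True by (intro image_eqI[of _ _ "(1/a) *\<^sub>R x"]) auto
    qed (use True in \<open>auto simp: sgn_scaleR\<close>)
    also have "emeasure lborel \<dots> = ennreal (\<bar>a\<bar> ^ DIM('a)) * emeasure lborel (?S 1)"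
      using True by (intro emeasure_lborel_affine_image sector_borel A) auto
    finally show ?thesis using True by simp
  next
    case False
    then have "{x. sgn x \<in> A \<and> norm x \<in> {..<a}} = {}"
      by (auto dest: order_le_less_trans[OF norm_ge_zero])
    then have "emeasure M {..<a} = 0" using M[of "{..<a}"] by (simp only: emeasure_empty) simp
    then show ?thesis using False by simp
  qed
  have "M = scale_measure (emeasure sphere_measure A) (radial_measure DIM('a))"
  proof (rule measure_eqI_generator_eq[where E="range lessThan" and \<Omega>=UNIV and A="\<lambda>i. {..<real i}"])
    show "Int_stable (range lessThan :: real set set)"
    proof -
      have "{..<a} \<inter> {..<b} = {..<min a b}" for a b :: real by auto
      then show ?thesis by (auto simp: Int_stable_def)
    qed
    show "sets M = sigma_sets UNIV (range lessThan)"
      "sets (scale_measure (emeasure sphere_measure A) (radial_measure DIM('a))) = sigma_sets UNIV (range lessThan)"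
      by (simp_all add: M_def borel_Iio)
    show "(\<Union>i::nat. {..<real i}) = UNIV" by (auto simp: reals_Archimedean2)
    have fin: "emeasure lborel {x. 0 < norm x \<and> norm x < 1 \<and> sgn x \<in> A} < top"
      using sphere_measure_finite[of A] unfolding emeasure_sphere_measure[OF A]
      by (auto simp: ennreal_mult_less_top)
    then show "emeasure M {..<real i} \<noteq> \<infinity>" for i
      by (auto simp: lt ennreal_mult_eq_top_iff)
    fix X :: "real set" assume "X \<in> range lessThan"
    then obtain a where X: "X = {..<a}" by auto
    let ?e = "emeasure lborel {x. 0 < norm x \<and> norm x < 1 \<and> sgn x \<in> A}"
    have "ennreal (real DIM('a)) * ?e * ennreal (if 0 < a then a ^ DIM('a) / real DIM('a) else 0)
        = (ennreal (real DIM('a)) * ennreal (if 0 < a then a ^ DIM('a) / real DIM('a) else 0)) * ?e"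
      by (simp only: ac_simps)
    also have "ennreal (real DIM('a)) * ennreal (if 0 < a then a ^ DIM('a) / real DIM('a) else 0)
        = ennreal (if 0 < a then a ^ DIM('a) else 0)"
      by (auto simp flip: ennreal_mult)
    finally show "emeasure M X = emeasure (scale_measure (emeasure sphere_measure A) (radial_measure DIM('a))) X"
      unfolding X lt by (simp add: emeasure_radial_measure emeasure_sphere_measure[OF A])
  qed auto
  then have "emeasure M B = emeasure sphere_measure A * emeasure (radial_measure DIM('a)) B"
    using B by simp
  then show ?thesis by (simp add: M B)
qed

theorem nn_integral_polar:
  fixes f :: "'a::euclidean_space \<Rightarrow> ennreal"
  assumes [measurable]: "f \<in> borel_measurable borel"
  shows "(\<integral>\<^sup>+x. f x \<partial>lborel) = (\<integral>\<^sup>+\<omega>. \<integral>\<^sup>+s. ennreal (\<bar>s\<bar> ^ (DIM('a) - 1)) * indicator {0<..} s * f (s *\<^sub>R \<omega>)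
      \<partial>lborel \<partial>sphere_measure)"
proof -
  have n: "0 < DIM('a)" by simp
  interpret S: finite_measure "sphere_measure :: 'a measure" by (rule finite_measure_sphere_measure)
  interpret R: sigma_finite_measure "radial_measure DIM('a)" by (rule sigma_finite_radial_measure[OF n])
  let ?T = "\<lambda>x::'a. (sgn x, norm x)"
  have [measurable]: "?T \<in> borel \<rightarrow>\<^sub>M borel \<Otimes>\<^sub>M borel" by measurable
  have sets: "sets (sphere_measure \<Otimes>\<^sub>M radial_measure DIM('a)) = sets ((borel :: 'a measure) \<Otimes>\<^sub>M (borel :: real measure))"
    by (intro sets_pair_measure_cong) auto
  have "sphere_measure \<Otimes>\<^sub>M radial_measure DIM('a) = distr lborel (borel \<Otimes>\<^sub>M borel) ?T"
  proof (rule pair_measure_eqI)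
    show "sigma_finite_measure (sphere_measure :: 'a measure)" ..
    show "sigma_finite_measure (radial_measure DIM('a))" ..
    show "sets (sphere_measure \<Otimes>\<^sub>M radial_measure DIM('a)) = sets (distr lborel (borel \<Otimes>\<^sub>M borel) ?T)"
      using sets by simp
    fix A :: "'a set" and B assume "A \<in> sets sphere_measure" "B \<in> sets (radial_measure DIM('a))"
    then have AB: "A \<in> sets borel" "B \<in> sets borel" by auto
    then have "emeasure (distr lborel (borel \<Otimes>\<^sub>M borel) ?T) (A \<times> B) = emeasure lborel (?T -` (A \<times> B))"
      by (subst emeasure_distr) auto
    also have "?T -` (A \<times> B) = {x. sgn x \<in> A \<and> norm x \<in> B}" by auto
    finally show "emeasure sphere_measure A * emeasure (radial_measure DIM('a)) B
        = emeasure (distr lborel (borel \<Otimes>\<^sub>M borel) ?T) (A \<times> B)"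
      using emeasure_sector[OF AB] by simp
  qed
  note eq = this
  have [measurable]: "(\<lambda>(\<omega>, s). f (s *\<^sub>R \<omega>)) \<in> borel_measurable (borel \<Otimes>\<^sub>M borel)" by measurable
  have mP: "(\<lambda>(\<omega>, s). f (s *\<^sub>R \<omega>)) \<in> borel_measurable (sphere_measure \<Otimes>\<^sub>M radial_measure DIM('a))"
    unfolding measurable_cong_sets[OF sets refl] by measurable
  have "norm x *\<^sub>R sgn x = x" for x :: 'a by (cases "x = 0") (simp_all add: sgn_div_norm)
  then have "(\<integral>\<^sup>+x. f x \<partial>lborel) = (\<integral>\<^sup>+x. (\<lambda>(\<omega>, s). f (s *\<^sub>R \<omega>)) (?T x) \<partial>lborel)"
    by simp
  also have "\<dots> = (\<integral>\<^sup>+z. (\<lambda>(\<omega>, s). f (s *\<^sub>R \<omega>)) z \<partial>(sphere_measure \<Otimes>\<^sub>M radial_measure DIM('a)))"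
    unfolding eq by (subst nn_integral_distr) auto
  also have "\<dots> = (\<integral>\<^sup>+\<omega>. \<integral>\<^sup>+s. f (s *\<^sub>R \<omega>) \<partial>radial_measure DIM('a) \<partial>sphere_measure)"
    using R.nn_integral_fst[OF mP] by simp
  also have "\<dots> = (\<integral>\<^sup>+\<omega>. \<integral>\<^sup>+s. ennreal (\<bar>s\<bar> ^ (DIM('a) - 1)) * indicator {0<..} s * f (s *\<^sub>R \<omega>)
      \<partial>lborel \<partial>sphere_measure)"
    unfolding radial_measure_def by (subst nn_integral_density) auto
  finally show ?thesis .
qed

section \<open>The trace inequality on balls and shells\<close>

lemma Young_powr:
  fixes p :: real
  assumes p: "1 < p" and xy: "0 \<le> x" "0 \<le> y"
  shows "p * x powr (p - 1) * y \<le> y powr p + (p - 1) * x powr p"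
proof -
  define q where "q = p / (p - 1)"
  have q: "1 < q" "1 / p + 1 / q = 1" using p by (auto simp: q_def field_simps)
  have "(x powr (p - 1)) powr q = x powr p" using p by (simp add: powr_powr q_def)
  then have "y * x powr (p - 1) \<le> y powr p / p + x powr p / q"
    using Youngs_inequality[OF p q xy(2), of "x powr (p - 1)"] by simp
  then have "p * (y * x powr (p - 1)) \<le> p * (y powr p / p + x powr p / q)"
    using p by (intro mult_left_mono) auto
  also have "\<dots> = y powr p + (p - 1) * x powr p" using p by (simp add: q_def field_simps)
  finally show ?thesis by (simp add: mult_ac)
qed

lemma DERIV_abs_powr:
  fixes p :: real
  assumes p: "1 < p"
  shows "((\<lambda>x. \<bar>x\<bar> powr p) has_real_derivative p * sgn x * \<bar>x\<bar> powr (p - 1)) (at x)"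
proof -
  consider "0 < x" | "x < 0" | "x = 0" by linarith
  then show ?thesis
  proof cases
    case 1
    have "((\<lambda>x. x powr p) has_real_derivative p * sgn x * \<bar>x\<bar> powr (p - 1)) (at x)"
      using 1 by (auto intro!: derivative_eq_intros simp: powr_diff)
    then show ?thesis
      by (rule DERIV_cong_ev[THEN iffD1, rotated -1, OF _ refl _ refl])
        (use 1 in \<open>auto intro: eventually_mono[OF eventually_gt_at_top] simp: eventually_nhds_metric dist_real_def intro!: exI[of _ x]\<close>)
  next
    case 2
    have "((\<lambda>x. (- x) powr p) has_real_derivative p * sgn x * \<bar>x\<bar> powr (p - 1)) (at x)"
      using 2 by (auto intro!: derivative_eq_intros simp: powr_diff)
    then show ?thesis
      by (rule DERIV_cong_ev[THEN iffD1, rotated -1, OF _ refl _ refl])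
        (use 2 in \<open>auto simp: eventually_nhds_metric dist_real_def intro!: exI[of _ "-x"]\<close>)
  next
    case 3
    have "((\<lambda>h. \<bar>h\<bar> powr (p - 1)) \<longlongrightarrow> 0) (at (0::real))"
      using p by (intro tendsto_eq_intros) (auto intro!: always_eventually)
    then have "((\<lambda>h. sgn h * \<bar>h\<bar> powr (p - 1)) \<longlongrightarrow> 0) (at (0::real))"
      by (rule tendsto_0_le[where K=1]) (auto simp: abs_mult sgn_if intro!: always_eventually)
    moreover have "sgn h * \<bar>h\<bar> powr (p - 1) = \<bar>h\<bar> powr p / h" for h :: real
      by (cases "h = 0") (auto simp: powr_diff sgn_if abs_if field_simps)
    ultimately show ?thesis using 3 by (simp add: DERIV_def)
  qed
qed

lemma continuous_on_abs_powr:
  fixes f :: "'a::topological_space \<Rightarrow> real"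
  assumes "0 < p" "continuous_on A f" shows "continuous_on A (\<lambda>x. \<bar>f x\<bar> powr p)"
  by (rule continuous_on_powr') (use assms in \<open>auto intro!: continuous_intros\<close>)

text \<open>Integrate the derivative of \<open>s\<^sup>n\<^sup>-\<^sup>1 \<phi> |h|\<^sup>p\<close> and split the mixed term by Young's inequality.  In higher
  dimensions this is the divergence theorem for the vector field \<open>\<phi>(|x|) |w|\<^sup>p x/|x|\<close>, and \<open>\<phi>\<close> is free to be
  adapted to the domain.\<close>
lemma radial_trace_inequality:
  fixes h h' \<phi> \<phi>' :: "real \<Rightarrow> real" and p \<beta> C a b :: real
  assumes p: "1 < p" and n: "2 \<le> n" and ab: "0 \<le> a" "a < b" and \<beta>: "0 < \<beta>"
    and h: "\<And>s. (h has_real_derivative h' s) (at s)" and h': "continuous_on {a..b} h'"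
    and \<phi>: "\<And>s. s \<in> {a..b} \<Longrightarrow> (\<phi> has_real_derivative \<phi>' s) (at s)"
    and \<phi>1: "\<And>s. s \<in> {a..b} \<Longrightarrow> \<bar>\<phi> s\<bar> \<le> 1"
    and C: "\<And>s. s \<in> {a..b} \<Longrightarrow>
      \<beta> powr (p - 1) * (s * \<phi>' s + real (n - 1) * \<phi> s) + (p - 1) * \<beta> powr p * \<bar>\<phi> s\<bar> * s \<le> C * s"
  shows "\<beta> powr (p - 1) * (b ^ (n - 1) * \<phi> b * \<bar>h b\<bar> powr p - a ^ (n - 1) * \<phi> a * \<bar>h a\<bar> powr p)
    \<le> integral {a..b} (\<lambda>s. s ^ (n - 1) * (\<bar>h' s\<bar> powr p + C * \<bar>h s\<bar> powr p))"
proof -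
  define J where "J s = \<beta> powr (p - 1) * (s ^ (n - 1) * \<phi> s * \<bar>h s\<bar> powr p)" for s
  define J' where "J' s = \<beta> powr (p - 1) * (real (n - 1) * s ^ (n - 2) * \<phi> s * \<bar>h s\<bar> powr p +
      s ^ (n - 1) * (\<phi>' s * \<bar>h s\<bar> powr p + \<phi> s * (p * sgn (h s) * \<bar>h s\<bar> powr (p - 1) * h' s)))" for s
  have hc: "continuous_on {a..b} h"
    using h by (meson DERIV_isCont continuous_at_imp_continuous_on)
  have "(J' has_integral (J b - J a)) {a..b}"
  proof (rule fundamental_theorem_of_calculus)
    fix s assume s: "s \<in> {a..b}"
    have hp: "((\<lambda>s. \<bar>h s\<bar> powr p) has_real_derivative p * sgn (h s) * \<bar>h s\<bar> powr (p - 1) * h' s) (at s)"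
      by (rule DERIV_chain2[OF DERIV_abs_powr[OF p] h])
    define k where "k s = \<bar>h s\<bar> powr p" for s
    have n2: "n - Suc (Suc 0) = n - 2" by simp
    have "(J has_real_derivative J' s) (at s)"
      unfolding J_def[abs_def] J'_def k_def[symmetric]
      by (auto intro!: derivative_eq_intros hp[folded k_def] \<phi>[OF s] simp: algebra_simps n2)
    then show "(J has_vector_derivative J' s) (at s within {a..b})"
      by (simp add: has_field_derivative_at_within flip: has_real_derivative_iff_has_vector_derivative)
  qed (use ab in simp)
  moreover have "((\<lambda>s. s ^ (n - 1) * (\<bar>h' s\<bar> powr p + C * \<bar>h s\<bar> powr p)) has_integral
      integral {a..b} (\<lambda>s. s ^ (n - 1) * (\<bar>h' s\<bar> powr p + C * \<bar>h s\<bar> powr p))) {a..b}"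
    using p hc h' by (intro integrable_integral integrable_continuous_real continuous_intros continuous_on_abs_powr) auto
  moreover have "J' s \<le> s ^ (n - 1) * (\<bar>h' s\<bar> powr p + C * \<bar>h s\<bar> powr p)" if s: "s \<in> {a..b}" for s
  proof -
    have s0: "0 \<le> s" using s ab by auto
    have "n - 1 = Suc (n - 2)" using n by simp
    then have pw: "s ^ (n - 1) = s ^ (n - 2) * s" by (metis power_Suc2)
    have "\<phi> s * (p * sgn (h s) * \<bar>h s\<bar> powr (p - 1) * h' s) \<le> \<bar>\<phi> s\<bar> * (p * \<bar>h s\<bar> powr (p - 1) * \<bar>h' s\<bar>)"
    proof -
      have "\<phi> s * (p * sgn (h s) * \<bar>h s\<bar> powr (p - 1) * h' s) \<le> \<bar>\<phi> s * (p * sgn (h s) * \<bar>h s\<bar> powr (p - 1) * h' s)\<bar>"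
        by (rule abs_ge_self)
      also have "\<dots> = \<bar>\<phi> s\<bar> * (p * (\<bar>sgn (h s)\<bar> * \<bar>h s\<bar> powr (p - 1)) * \<bar>h' s\<bar>)"
        using p by (simp add: abs_mult)
      also have "\<dots> \<le> \<bar>\<phi> s\<bar> * (p * (1 * \<bar>h s\<bar> powr (p - 1)) * \<bar>h' s\<bar>)"
        using p by (intro mult_left_mono mult_right_mono) (auto simp: sgn_if)
      finally show ?thesis by simp
    qed
    then have "\<beta> powr (p - 1) * (\<phi> s * (p * sgn (h s) * \<bar>h s\<bar> powr (p - 1) * h' s))
        \<le> \<beta> powr (p - 1) * (\<bar>\<phi> s\<bar> * (p * \<bar>h s\<bar> powr (p - 1) * \<bar>h' s\<bar>))"
      by (intro mult_left_mono) auto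
    also have "\<dots> = \<bar>\<phi> s\<bar> * (p * (\<beta> * \<bar>h s\<bar>) powr (p - 1) * \<bar>h' s\<bar>)"
      using \<beta> by (simp add: powr_mult)
    also have "\<dots> \<le> \<bar>\<phi> s\<bar> * (\<bar>h' s\<bar> powr p + (p - 1) * (\<beta> * \<bar>h s\<bar>) powr p)"
      using \<beta> by (intro mult_left_mono Young_powr p) auto
    also have "\<dots> \<le> \<bar>h' s\<bar> powr p + \<bar>\<phi> s\<bar> * (p - 1) * \<beta> powr p * \<bar>h s\<bar> powr p"
      using \<phi>1[OF s] \<beta> mult_right_mono[OF \<phi>1[OF s], of "\<bar>h' s\<bar> powr p"] by (simp add: powr_mult algebra_simps)
    finally have Y: "\<beta> powr (p - 1) * (\<phi> s * (p * sgn (h s) * \<bar>h s\<bar> powr (p - 1) * h' s))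
      \<le> \<bar>h' s\<bar> powr p + \<bar>\<phi> s\<bar> * (p - 1) * \<beta> powr p * \<bar>h s\<bar> powr p" .
    have "J' s = s ^ (n - 2) * \<bar>h s\<bar> powr p * (\<beta> powr (p - 1) * (s * \<phi>' s + real (n - 1) * \<phi> s))
        + s ^ (n - 1) * (\<beta> powr (p - 1) * (\<phi> s * (p * sgn (h s) * \<bar>h s\<bar> powr (p - 1) * h' s)))"
      unfolding J'_def pw by (simp add: algebra_simps)
    also have "\<dots> \<le> s ^ (n - 2) * \<bar>h s\<bar> powr p * (C * s - (p - 1) * \<beta> powr p * \<bar>\<phi> s\<bar> * s)
        + s ^ (n - 1) * (\<bar>h' s\<bar> powr p + \<bar>\<phi> s\<bar> * (p - 1) * \<beta> powr p * \<bar>h s\<bar> powr p)"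
      using C[OF s] s0 by (intro add_mono mult_left_mono Y) auto
    also have "\<dots> = s ^ (n - 1) * (\<bar>h' s\<bar> powr p + C * \<bar>h s\<bar> powr p)"
      unfolding pw by (simp add: algebra_simps)
    finally show ?thesis .
  qed
  ultimately have "J b - J a \<le> integral {a..b} (\<lambda>s. s ^ (n - 1) * (\<bar>h' s\<bar> powr p + C * \<bar>h s\<bar> powr p))"
    by (rule has_integral_le)
  then show ?thesis by (simp add: J_def algebra_simps)
qed

lemma C1_with_gradient_measurable:
  fixes w :: "'a::euclidean_space \<Rightarrow> real"
  assumes "C1_with_gradient UNIV w Dw"
  shows "w \<in> borel_measurable borel" "Dw \<in> borel_measurable borel" "continuous_on UNIV w" "continuous_on UNIV Dw"
proof -
  show c: "continuous_on UNIV w" "continuous_on UNIV Dw"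
    using assms unfolding C1_with_gradient_def
    by (auto simp: gderiv_def intro!: continuous_at_imp_continuous_on has_derivative_continuous)
  show "w \<in> borel_measurable borel" "Dw \<in> borel_measurable borel"
    using c by (simp_all add: borel_measurable_continuous_onI)
qed

lemma C1_with_gradient_ray:
  fixes w :: "'a::euclidean_space \<Rightarrow> real"
  assumes "C1_with_gradient UNIV w Dw"
  shows "((\<lambda>s. w (z + s *\<^sub>R \<omega>)) has_real_derivative (Dw (z + s *\<^sub>R \<omega>) \<bullet> \<omega>)) (at s)"
proof -
  have "(w has_derivative (\<lambda>h. h \<bullet> Dw (z + s *\<^sub>R \<omega>))) (at (z + s *\<^sub>R \<omega>))"
    using assms by (auto simp: C1_with_gradient_def gderiv_def)
  then have "((\<lambda>s. w (z + s *\<^sub>R \<omega>)) has_derivative (\<lambda>t. (t *\<^sub>R \<omega>) \<bullet> Dw (z + s *\<^sub>R \<omega>))) (at s)"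
    by (rule has_derivative_compose[rotated]) (auto intro!: derivative_eq_intros)
  then show ?thesis
    by (simp add: has_field_derivative_def inner_commute mult_commute_abs)
qed

text \<open>The inequality on the rays, integrated over all directions.  The case \<open>a = 0\<close> is the ball, since the factor
  \<open>s\<^sup>n\<^sup>-\<^sup>1\<close> then removes the inner boundary term.\<close>
lemma annulus_trace_inequality:
  fixes w :: "'a::euclidean_space \<Rightarrow> real" and p \<beta> C a b :: real
  assumes dim: "2 \<le> DIM('a)" and w: "C1_with_gradient UNIV w Dw"
    and p: "1 < p" and ab: "0 \<le> a" "a < b" and \<beta>: "0 < \<beta>" and C0: "0 \<le> C"
    and \<phi>: "\<And>s. s \<in> {a..b} \<Longrightarrow> (\<phi> has_real_derivative \<phi>' s) (at s)"
    and \<phi>1: "\<And>s. s \<in> {a..b} \<Longrightarrow> \<bar>\<phi> s\<bar> \<le> 1"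
    and C: "\<And>s. s \<in> {a..b} \<Longrightarrow>
      \<beta> powr (p - 1) * (s * \<phi>' s + real (DIM('a) - 1) * \<phi> s) + (p - 1) * \<beta> powr p * \<bar>\<phi> s\<bar> * s \<le> C * s"
    and bd: "\<phi> b = 1" "a = 0 \<or> \<phi> a = -1"
  shows "ennreal (\<beta> powr (p - 1)) *
      (ennreal (b ^ (DIM('a) - 1)) * (\<integral>\<^sup>+\<omega>. ennreal (\<bar>w (z + b *\<^sub>R \<omega>)\<bar> powr p) \<partial>sphere_measure) +
       ennreal (a ^ (DIM('a) - 1)) * (\<integral>\<^sup>+\<omega>. ennreal (\<bar>w (z + a *\<^sub>R \<omega>)\<bar> powr p) \<partial>sphere_measure))
    \<le> (\<integral>\<^sup>+x. ennreal (norm (Dw x) powr p + C * \<bar>w x\<bar> powr p) * indicator {x. a < norm (x - z) \<and> norm (x - z) < b} x \<partial>lborel)"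
    (is "?L \<le> ?R")
proof -
  let ?s = "DIM('a) - 1"
  note [measurable] = C1_with_gradient_measurable(1,2)[OF w]
  define F where "F x = norm (Dw x) powr p + C * \<bar>w x\<bar> powr p" for x
  have F0: "0 \<le> F x" for x using C0 by (simp add: F_def)
  have [measurable]: "F \<in> borel_measurable borel" unfolding F_def by measurable
  have "?L = (\<integral>\<^sup>+\<omega>. ennreal (\<beta> powr (p - 1) *
      (b ^ ?s * \<bar>w (z + b *\<^sub>R \<omega>)\<bar> powr p + a ^ ?s * \<bar>w (z + a *\<^sub>R \<omega>)\<bar> powr p)) \<partial>sphere_measure)"
    using ab by (simp add: ennreal_mult ennreal_plus[symmetric] nn_integral_cmult nn_integral_add del: ennreal_plus)
     (simp add: nn_integral_cmult nn_integral_add ennreal_mult)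
  also have "\<dots> \<le> (\<integral>\<^sup>+\<omega>. \<integral>\<^sup>+s. ennreal (\<bar>s\<bar> ^ ?s) * indicator {0<..} s *
      (ennreal (F (z + s *\<^sub>R \<omega>)) * indicator {x. a < norm x \<and> norm x < b} (s *\<^sub>R \<omega>)) \<partial>lborel \<partial>sphere_measure)"
  proof (rule nn_integral_mono_AE)
    have "AE \<omega> in sphere_measure. \<omega> \<in> sphere (0::'a) 1"
      using sphere_measure_null[where 'a='a] by (intro AE_I[of _ _ "- sphere 0 1"]) auto
    then show "AE \<omega> in sphere_measure. ennreal (\<beta> powr (p - 1) *
      (b ^ ?s * \<bar>w (z + b *\<^sub>R \<omega>)\<bar> powr p + a ^ ?s * \<bar>w (z + a *\<^sub>R \<omega>)\<bar> powr p)) \<le>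
      (\<integral>\<^sup>+s. ennreal (\<bar>s\<bar> ^ ?s) * indicator {0<..} s *
      (ennreal (F (z + s *\<^sub>R \<omega>)) * indicator {x. a < norm x \<and> norm x < b} (s *\<^sub>R \<omega>)) \<partial>lborel)"
    proof eventually_elim
      case (elim \<omega>)
      then have \<omega>: "norm \<omega> = 1" by simp
      define h where "h s = w (z + s *\<^sub>R \<omega>)" for s
      define h' where "h' s = Dw (z + s *\<^sub>R \<omega>) \<bullet> \<omega>" for s
      have h: "(h has_real_derivative h' s) (at s)" for s
        unfolding h_def h'_def by (rule C1_with_gradient_ray[OF w])
      have h'c: "continuous_on A h'" for A
        unfolding h'_def by (intro continuous_intros continuous_on_compose2[OF C1_with_gradient_measurable(4)[OF w]]) auto
      have hc: "continuous_on A h" for A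
        unfolding h_def by (intro continuous_intros continuous_on_compose2[OF C1_with_gradient_measurable(3)[OF w]]) auto
      have [measurable]: "h \<in> borel_measurable borel" "h' \<in> borel_measurable borel"
        using hc h'c by (simp_all add: borel_measurable_continuous_onI)
      have tr: "\<beta> powr (p - 1) * (b ^ ?s * \<phi> b * \<bar>h b\<bar> powr p - a ^ ?s * \<phi> a * \<bar>h a\<bar> powr p)
        \<le> integral {a..b} (\<lambda>s. s ^ ?s * (\<bar>h' s\<bar> powr p + C * \<bar>h s\<bar> powr p))"
        by (rule radial_trace_inequality[OF p dim ab \<beta> h h'c \<phi> \<phi>1 C])
      define g where "g s = \<bar>s\<bar> ^ ?s * (\<bar>h' s\<bar> powr p + C * \<bar>h s\<bar> powr p)" for s
      have g0: "0 \<le> g s" for s using C0 by (simp add: g_def)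
      have [measurable]: "g \<in> borel_measurable borel" unfolding g_def by measurable
      have gi: "g integrable_on {a..b}"
        unfolding g_def using p by (intro integrable_continuous_real continuous_intros continuous_on_abs_powr hc h'c) auto
      have "- (a ^ ?s * \<phi> a) = a ^ ?s" using bd(2) dim by (auto simp: power_0_left)
      then have "\<beta> powr (p - 1) * (b ^ ?s * \<bar>h b\<bar> powr p + a ^ ?s * \<bar>h a\<bar> powr p)
        = \<beta> powr (p - 1) * (b ^ ?s * \<phi> b * \<bar>h b\<bar> powr p - a ^ ?s * \<phi> a * \<bar>h a\<bar> powr p)"
        using bd(1) by (metis (no_types, opaque_lifting) diff_conv_add_uminus minus_mult_left mult.right_neutral)
      also have "\<dots> \<le> integral {a..b} g"
      proof -
        have "integral {a..b} (\<lambda>s. s ^ ?s * (\<bar>h' s\<bar> powr p + C * \<bar>h s\<bar> powr p)) = integral {a..b} g"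
          using ab by (intro integral_cong) (auto simp: g_def)
        then show ?thesis using tr by simp
      qed
      finally have "ennreal (\<beta> powr (p - 1) * (b ^ ?s * \<bar>h b\<bar> powr p + a ^ ?s * \<bar>h a\<bar> powr p))
        \<le> ennreal (integral {a..b} g)" by (rule ennreal_leI)
      also have "\<dots> = (\<integral>\<^sup>+s. ennreal (g s * indicator {a..b} s) \<partial>lborel)"
      proof (rule nn_integral_has_integral_lborel[symmetric])
        have "((\<lambda>s. if s \<in> {a..b} then g s else 0) has_integral integral {a..b} g) UNIV"
          unfolding has_integral_restrict_UNIV using gi by (rule integrable_integral)
        then show "((\<lambda>s. g s * indicator {a..b} s) has_integral integral {a..b} g) UNIV"
          by (rule has_integral_eq[rotated]) (auto simp: indicator_def)
      qed (auto simp: g0)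
      also have "\<dots> \<le> (\<integral>\<^sup>+s. ennreal (\<bar>s\<bar> ^ ?s) * indicator {0<..} s *
        (ennreal (F (z + s *\<^sub>R \<omega>)) * indicator {x. a < norm x \<and> norm x < b} (s *\<^sub>R \<omega>)) \<partial>lborel)"
      proof (rule nn_integral_mono_AE)
        have "AE s in lborel. s \<noteq> a" "AE s in lborel. s \<noteq> b" by (rule AE_lborel_singleton)+
        then show "AE s in lborel. ennreal (g s * indicator {a..b} s) \<le> ennreal (\<bar>s\<bar> ^ ?s) * indicator {0<..} s *
          (ennreal (F (z + s *\<^sub>R \<omega>)) * indicator {x. a < norm x \<and> norm x < b} (s *\<^sub>R \<omega>))"
        proof eventually_elim
          case (elim s)
          have "\<bar>h' s\<bar> \<le> norm (Dw (z + s *\<^sub>R \<omega>))"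
            using Cauchy_Schwarz_ineq2[of "Dw (z + s *\<^sub>R \<omega>)" \<omega>] \<omega> by (simp add: h'_def)
          then have "\<bar>h' s\<bar> powr p \<le> norm (Dw (z + s *\<^sub>R \<omega>)) powr p" using p by (intro powr_mono2) auto
          then have "g s \<le> \<bar>s\<bar> ^ ?s * F (z + s *\<^sub>R \<omega>)"
            unfolding g_def F_def h_def by (intro mult_left_mono) auto
          then have "ennreal (g s) \<le> ennreal (\<bar>s\<bar> ^ ?s) * ennreal (F (z + s *\<^sub>R \<omega>))"
            using F0 by (simp flip: ennreal_mult add: ennreal_leI)
          then show ?case using elim ab \<omega> by (auto simp: indicator_def)
        qed
      qed
      finally show ?case by (simp add: h_def)
    qed
  qed
  also have "\<dots> = (\<integral>\<^sup>+x. ennreal (F (z + x)) * indicator {x. a < norm x \<and> norm x < b} x \<partial>lborel)"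
    by (subst nn_integral_polar) auto
  also have "\<dots> = (\<integral>\<^sup>+x. ennreal (F (z + x)) * indicator {x. a < norm (x - z) \<and> norm (x - z) < b} (z + x) \<partial>lborel)"
    by (intro nn_integral_cong) (auto simp: indicator_def)
  also have "\<dots> = (\<integral>\<^sup>+x. ennreal (F x) * indicator {x. a < norm (x - z) \<and> norm (x - z) < b} x \<partial>distr lborel borel ((+) z))"
    by (subst nn_integral_distr) auto
  also have "\<dots> = ?R" by (simp add: lborel_distr_plus F_def)
  finally show ?thesis .
qed

section \<open>Weak gradients\<close>

lemma C1_with_gradient_mult:
  assumes "C1_with_gradient UNIV u Du" "C1_with_gradient UNIV v Dv"
  shows "C1_with_gradient UNIV (\<lambda>x. u x * v x) (\<lambda>x. u x *\<^sub>R Dv x + v x *\<^sub>R Du x)"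
  using assms C1_with_gradient_measurable(3,4)[OF assms(1)] C1_with_gradient_measurable(3,4)[OF assms(2)]
  unfolding C1_with_gradient_def by (auto intro!: GDERIV_mult continuous_intros)

lemma C1_with_gradient_diff:
  assumes "C1_with_gradient UNIV u Du" "C1_with_gradient UNIV v Dv"
  shows "C1_with_gradient UNIV (\<lambda>x. u x - v x) (\<lambda>x. Du x - Dv x)"
  using assms unfolding C1_with_gradient_def by (auto intro!: GDERIV_diff continuous_intros)

lemma gradient_zero_outside_support:
  fixes \<psi> :: "'a::euclidean_space \<Rightarrow> real"
  assumes \<psi>: "C1_with_gradient UNIV \<psi> D\<psi>" and K: "closed K" "\<And>x. x \<notin> K \<Longrightarrow> \<psi> x = 0" and x: "x \<notin> K"
  shows "D\<psi> x = 0"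
proof -
  have "(\<psi> has_derivative (\<lambda>h. h \<bullet> D\<psi> x)) (at x)"
    using \<psi> by (auto simp: C1_with_gradient_def gderiv_def)
  moreover have "(\<psi> has_derivative (\<lambda>h. 0)) (at x)"
    by (rule has_derivative_transform_within_open[OF has_derivative_const[of 0], of "- K"]) (use K x in auto)
  ultimately have "(\<lambda>h. h \<bullet> D\<psi> x) = (\<lambda>h. 0)" by (rule has_derivative_unique)
  then have "D\<psi> x \<bullet> D\<psi> x = 0" by metis
  then show ?thesis by simp
qed

lemma integrable_compact_support:
  fixes f :: "'a::euclidean_space \<Rightarrow> 'b::euclidean_space"
  assumes "compact K" "continuous_on UNIV f" "\<And>x. x \<notin> K \<Longrightarrow> f x = 0"
  shows "integrable lborel f"
proof -
  have "integrable lborel (\<lambda>x. indicator K x *\<^sub>R f x)"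
    by (rule borel_integrable_compact) (use assms in \<open>auto intro: continuous_on_subset\<close>)
  moreover have "(\<lambda>x. indicator K x *\<^sub>R f x) = f" using assms(3) by (auto simp: indicator_def)
  ultimately show ?thesis by simp
qed

text \<open>The integral of \<open>\<psi>\<close> is invariant under translations, so that the integrals of its difference quotients
  vanish; these converge dominatedly to the partial derivatives.\<close>
lemma integral_gradient_compact_support:
  fixes \<psi> :: "'a::euclidean_space \<Rightarrow> real"
  assumes \<psi>: "C1_with_gradient UNIV \<psi> D\<psi>" and K: "compact K" "\<And>x. x \<notin> K \<Longrightarrow> \<psi> x = 0"
  shows "integrable lborel D\<psi>" "(LINT x|lborel. D\<psi> x) = 0"
proof -
  have D0: "D\<psi> x = 0" if "x \<notin> K" for x
    using gradient_zero_outside_support[OF \<psi> compact_imp_closed[OF K(1)] K(2) that] .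
  note [measurable] = C1_with_gradient_measurable(1,2)[OF \<psi>] and cont = C1_with_gradient_measurable(3,4)[OF \<psi>]
  show int: "integrable lborel D\<psi>" by (rule integrable_compact_support[OF K(1) cont(2) D0])
  have int\<psi>: "integrable lborel \<psi>" by (rule integrable_compact_support[OF K(1) cont(1) K(2)])
  have "bounded (D\<psi> ` K)"
    using compact_continuous_image[OF continuous_on_subset[OF cont(2)] K(1)] compact_imp_bounded by auto
  then obtain M where M: "\<And>x. x \<in> K \<Longrightarrow> norm (D\<psi> x) \<le> M" unfolding bounded_iff by blast
  then have M': "norm (D\<psi> x) \<le> \<bar>M\<bar>" for x using D0[of x] by (cases "x \<in> K") fastforce+
  obtain B where B: "\<And>x. x \<in> K \<Longrightarrow> norm x \<le> B" using compact_imp_bounded[OF K(1)] unfolding bounded_iff by blast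
  have "(LINT x|lborel. D\<psi> x) \<bullet> e = 0" if e: "e \<in> Basis" for e
  proof -
    have ne: "norm e = 1" using e by simp
    define t where "t k = 1 / real (Suc k)" for k
    have t: "0 < t k" "t k \<le> 1" for k by (auto simp: t_def)
    have t0: "t \<longlonglongrightarrow> 0" unfolding t_def using LIMSEQ_inverse_real_of_nat by (simp add: inverse_eq_divide)
    define q where "q k x = (\<psi> (t k *\<^sub>R e + x) - \<psi> x) / t k" for k x
    have q0: "(LINT x|lborel. q k x) = 0" for k
    proof -
      have i: "integrable lborel (\<lambda>x. \<psi> (t k *\<^sub>R e + x))"
        using int\<psi> integrable_distr_eq[of "(+) (t k *\<^sub>R e)" lborel borel \<psi>] by (simp add: lborel_distr_plus)
      have "(LINT x|lborel. \<psi> (t k *\<^sub>R e + x)) = (LINT x|lborel. \<psi> x)"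
        using integral_distr[of "(+) (t k *\<^sub>R e)" lborel borel \<psi>] by (simp add: lborel_distr_plus)
      then show ?thesis unfolding q_def using i int\<psi> by simp
    qed
    have "(\<lambda>k. LINT x|lborel. q k x) \<longlonglongrightarrow> (LINT x|lborel. D\<psi> x \<bullet> e)"
    proof (rule integral_dominated_convergence[where w="\<lambda>x. \<bar>M\<bar> * indicator (cball 0 (B + 1)) x"])
      show "integrable lborel (\<lambda>x. \<bar>M\<bar> * indicator (cball (0::'a) (B + 1)) x)"
        using emeasure_lborel_cball_finite[of "0::'a" "B+1"]
        by (intro integrable_mult_right integrable_real_indicator) (auto simp: less_top)
      show "AE x in lborel. (\<lambda>k. q k x) \<longlonglongrightarrow> D\<psi> x \<bullet> e"
      proof (rule AE_I2)
        fix x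
        have "((\<lambda>s. \<psi> (x + s *\<^sub>R e)) has_real_derivative D\<psi> x \<bullet> e) (at 0)"
          using C1_with_gradient_ray[OF \<psi>, of x e 0] by simp
        then have "((\<lambda>h. (\<psi> (x + h *\<^sub>R e) - \<psi> x) / h) \<longlongrightarrow> D\<psi> x \<bullet> e) (at 0)"
          by (simp add: DERIV_def)
        moreover have "filterlim t (at 0) sequentially"
          using t0 t(1) by (auto simp: filterlim_at intro!: always_eventually less_imp_neq[symmetric])
        ultimately show "(\<lambda>k. q k x) \<longlonglongrightarrow> D\<psi> x \<bullet> e"
          unfolding q_def by (auto dest: filterlim_compose simp: add.commute)
      qed
      fix k
      show "AE x in lborel. norm (q k x) \<le> \<bar>M\<bar> * indicator (cball 0 (B + 1)) x"
      proof (rule AE_I2)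
        fix x
        show "norm (q k x) \<le> \<bar>M\<bar> * indicator (cball 0 (B + 1)) x"
        proof (cases "x \<in> cball 0 (B + 1)")
          case True
          have "\<exists>\<xi>\<in>{0<..<t k}. \<psi> (x + t k *\<^sub>R e) - \<psi> (x + 0 *\<^sub>R e) = (\<lambda>h. h * (D\<psi> (x + \<xi> *\<^sub>R e) \<bullet> e)) (t k - 0)"
            using t[of k] C1_with_gradient_ray[OF \<psi>, of x e]
            by (intro mvt_simple[where f'="\<lambda>\<xi> h. h * (D\<psi> (x + \<xi> *\<^sub>R e) \<bullet> e)"])
              (auto simp: has_field_derivative_def mult_commute_abs intro: has_derivative_at_withinI)
          then obtain \<xi> where "\<psi> (x + t k *\<^sub>R e) - \<psi> x = t k * (D\<psi> (x + \<xi> *\<^sub>R e) \<bullet> e)" by auto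
          then have "q k x = D\<psi> (x + \<xi> *\<^sub>R e) \<bullet> e" using t[of k] by (simp add: q_def add.commute)
          then have "norm (q k x) \<le> norm (D\<psi> (x + \<xi> *\<^sub>R e)) * norm e"
            using Cauchy_Schwarz_ineq2 by simp
          then show ?thesis using M'[of "x + \<xi> *\<^sub>R e"] True ne by simp
        next
          case False
          then have "B + 1 < norm x" by simp
          moreover have "norm x \<le> norm (t k *\<^sub>R e + x) + norm (t k *\<^sub>R e)"
            using norm_triangle_ineq4[of "t k *\<^sub>R e + x" "t k *\<^sub>R e"] by simp
          moreover have "norm (t k *\<^sub>R e) \<le> 1" using t[of k] ne by simp
          ultimately have "x \<notin> K" "t k *\<^sub>R e + x \<notin> K" using B by fastforce+
          then show ?thesis using K(2) False by (simp add: q_def)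
        qed
      qed
    qed (simp_all add: q_def)
    then have "(LINT x|lborel. D\<psi> x \<bullet> e) = 0" by (simp add: q0 LIMSEQ_const_iff)
    then show ?thesis using int by simp
  qed
  then show "(LINT x|lborel. D\<psi> x) = 0" using euclidean_all_zero_iff by blast
qed

lemma LINT_lebesgue_on_compact_support:
  fixes f :: "'a::euclidean_space \<Rightarrow> 'b::euclidean_space"
  assumes "f \<in> borel_measurable borel" "open \<Omega>" "K \<subseteq> \<Omega>" "\<And>x. x \<notin> K \<Longrightarrow> f x = 0"
  shows "(LINT x|lebesgue_on \<Omega>. f x) = (LINT x|lborel. f x)"
proof -
  have "indicator \<Omega> x *\<^sub>R f x = f x" for x
    using assms(3) assms(4)[of x] by (cases "x \<in> \<Omega>") auto
  then show ?thesis
    using assms by (subst integral_restrict_space) (auto simp: integral_completion)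
qed

lemma has_weak_gradient_C1:
  fixes u :: "'a::euclidean_space \<Rightarrow> real"
  assumes \<Omega>: "open \<Omega>" and u: "C1_with_gradient UNIV u Du"
  shows "has_weak_gradient \<Omega> u Du"
proof -
  note [measurable] = C1_with_gradient_measurable(1,2)[OF u] and cu = C1_with_gradient_measurable(3,4)[OF u]
  have li: "locally_integrable_on f \<Omega>"
    if f: "continuous_on UNIV f" for f :: "'a \<Rightarrow> 'b::euclidean_space"
    unfolding locally_integrable_on_def
  proof (intro allI impI)
    fix K assume K: "compact K \<and> K \<subseteq> \<Omega>"
    have [measurable]: "f \<in> borel_measurable borel" "K \<in> sets borel"
      using f K by (auto simp: borel_measurable_continuous_onI compact_imp_closed)
    have "integrable lborel (\<lambda>x. indicator K x *\<^sub>R f x)"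
      by (rule borel_integrable_compact) (use f K in \<open>auto intro: continuous_on_subset\<close>)
    then show "integrable (lebesgue_on K) f"
      by (subst integrable_restrict_space) (auto simp: integrable_completion)
  qed
  have ibp: "(LINT x|lebesgue_on \<Omega>. u x *\<^sub>R D\<phi> x) = - (LINT x|lebesgue_on \<Omega>. \<phi> x *\<^sub>R Du x)"
    if \<phi>: "C1_with_gradient UNIV \<phi> D\<phi>" and K: "compact K" "K \<subseteq> \<Omega>" "\<And>x. x \<notin> K \<Longrightarrow> \<phi> x = 0" for \<phi> D\<phi> K
  proof -
    note [measurable] = C1_with_gradient_measurable(1,2)[OF \<phi>] and c\<phi> = C1_with_gradient_measurable(3,4)[OF \<phi>]
    have D0: "D\<phi> x = 0" if "x \<notin> K" for x
      using gradient_zero_outside_support[OF \<phi> compact_imp_closed[OF K(1)] K(3) that] .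
    have i1: "integrable lborel (\<lambda>x. u x *\<^sub>R D\<phi> x)"
      by (rule integrable_compact_support[OF K(1)]) (use D0 cu c\<phi> in \<open>auto intro!: continuous_intros\<close>)
    have i2: "integrable lborel (\<lambda>x. \<phi> x *\<^sub>R Du x)"
      by (rule integrable_compact_support[OF K(1)]) (use K cu c\<phi> in \<open>auto intro!: continuous_intros\<close>)
    have "(LINT x|lborel. u x *\<^sub>R D\<phi> x + \<phi> x *\<^sub>R Du x) = 0"
      by (rule integral_gradient_compact_support(2)[OF C1_with_gradient_mult[OF u \<phi>] K(1)]) (use K in auto)
    then have "(LINT x|lborel. u x *\<^sub>R D\<phi> x) = - (LINT x|lborel. \<phi> x *\<^sub>R Du x)"
      using i1 i2 by (simp add: eq_neg_iff_add_eq_0)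
    moreover have "(LINT x|lebesgue_on \<Omega>. u x *\<^sub>R D\<phi> x) = (LINT x|lborel. u x *\<^sub>R D\<phi> x)"
      by (rule LINT_lebesgue_on_compact_support[OF _ \<Omega> K(2)]) (use D0 in auto)
    moreover have "(LINT x|lebesgue_on \<Omega>. \<phi> x *\<^sub>R Du x) = (LINT x|lborel. \<phi> x *\<^sub>R Du x)"
      by (rule LINT_lebesgue_on_compact_support[OF _ \<Omega> K(2)]) (use K in auto)
    ultimately show ?thesis by simp
  qed
  show ?thesis unfolding has_weak_gradient_def using li[OF cu(1)] li[OF cu(2)] ibp by blast
qed

lemma DERIV_max_square: "((\<lambda>t::real. (max 0 t)\<^sup>2) has_real_derivative 2 * max 0 t) (at t)"
proof -
  consider "0 < t" | "t < 0" | "t = 0" by linarith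
  then show ?thesis
  proof cases
    case 1
    have "((\<lambda>t. t\<^sup>2) has_real_derivative 2 * max 0 t) (at t)"
      using 1 by (auto intro!: derivative_eq_intros)
    then show ?thesis
      by (rule has_field_derivative_transform_within_open[of _ _ _ "{0<..}"]) (use 1 in auto)
  next
    case 2
    have "((\<lambda>t. 0) has_real_derivative 2 * max 0 t) (at t)" using 2 by simp
    then show ?thesis
      by (rule has_field_derivative_transform_within_open[of _ _ _ "{..<0}"]) (use 2 in auto)
  next
    case 3
    have "((\<lambda>h::real. (max 0 h)\<^sup>2 / h) \<longlongrightarrow> 0) (at 0)"
    proof (rule tendsto_0_le[where f="\<lambda>h. h" and K=1])
      show "\<forall>\<^sub>F h in at (0::real). norm ((max 0 h)\<^sup>2 / h) \<le> norm h * 1"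
        by (intro always_eventually) (auto simp: max_def power2_eq_square)
    qed (rule tendsto_ident_at)
    then show ?thesis using 3 by (simp add: DERIV_def)
  qed
qed

text \<open>A \<open>C\<^sup>1\<close> function with support in the closed box that agrees with the indicator of the open
  box up to distance \<open>\<epsilon>\<close> from its boundary: a function of the squared distance to the shrunk box.\<close>

definition shrunk_box_dist_sq :: "'a::euclidean_space \<Rightarrow> 'a \<Rightarrow> real \<Rightarrow> 'a \<Rightarrow> real" where
  "shrunk_box_dist_sq a b \<epsilon> x =
     (\<Sum>j\<in>Basis. (max 0 (a \<bullet> j + \<epsilon> - x \<bullet> j))\<^sup>2 + (max 0 (x \<bullet> j - b \<bullet> j + \<epsilon>))\<^sup>2)"

definition box_bump :: "'a::euclidean_space \<Rightarrow> 'a \<Rightarrow> real \<Rightarrow> 'a \<Rightarrow> real" where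
  "box_bump a b \<epsilon> x = (max 0 (1 - shrunk_box_dist_sq a b \<epsilon> x / \<epsilon>\<^sup>2))\<^sup>2"

lemma C1_box_bump:
  fixes a b :: "'a::euclidean_space"
  shows "\<exists>D. C1_with_gradient UNIV (box_bump a b \<epsilon>) D"
proof -
  define Dd where "Dd x = (\<Sum>j\<in>Basis. (2 * max 0 (x \<bullet> j - b \<bullet> j + \<epsilon>) - 2 * max 0 (a \<bullet> j + \<epsilon> - x \<bullet> j)) *\<^sub>R j)" for x :: 'a
  have "GDERIV (shrunk_box_dist_sq a b \<epsilon>) x :> Dd x" for x
  proof -
    have "((\<lambda>x. (max 0 (a \<bullet> j + \<epsilon> - x \<bullet> j))\<^sup>2 + (max 0 (x \<bullet> j - b \<bullet> j + \<epsilon>))\<^sup>2) has_derivative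
        (\<lambda>h. (- (h \<bullet> j)) * (2 * max 0 (a \<bullet> j + \<epsilon> - x \<bullet> j)) + (h \<bullet> j) * (2 * max 0 (x \<bullet> j - b \<bullet> j + \<epsilon>)))) (at x)" for j
      by (intro has_derivative_add DERIV_compose_FDERIV[OF DERIV_max_square]) (auto intro!: derivative_eq_intros)
    then have "(shrunk_box_dist_sq a b \<epsilon> has_derivative
        (\<lambda>h. \<Sum>j\<in>Basis. (- (h \<bullet> j)) * (2 * max 0 (a \<bullet> j + \<epsilon> - x \<bullet> j)) + (h \<bullet> j) * (2 * max 0 (x \<bullet> j - b \<bullet> j + \<epsilon>)))) (at x)"
      unfolding shrunk_box_dist_sq_def[abs_def] by (intro has_derivative_sum)
    also have "(\<lambda>h. \<Sum>j\<in>Basis. (- (h \<bullet> j)) * (2 * max 0 (a \<bullet> j + \<epsilon> - x \<bullet> j)) + (h \<bullet> j) * (2 * max 0 (x \<bullet> j - b \<bullet> j + \<epsilon>)))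
      = (\<lambda>h. h \<bullet> Dd x)"
      unfolding Dd_def inner_sum_right by (intro ext sum.cong) (simp_all add: algebra_simps)
    finally show ?thesis by (simp add: gderiv_def)
  qed
  note d = this
  define D where "D = (\<lambda>x. (2 * max 0 (1 - shrunk_box_dist_sq a b \<epsilon> x / \<epsilon>\<^sup>2) * (- 1 / \<epsilon>\<^sup>2)) *\<^sub>R Dd x)"
  have "GDERIV (box_bump a b \<epsilon>) x :> D x" for x
    unfolding box_bump_def[abs_def] D_def
    by (rule GDERIV_DERIV_compose[OF d, where g="\<lambda>t. (max 0 (1 - t / \<epsilon>\<^sup>2))\<^sup>2"],
        rule DERIV_chain2[OF DERIV_max_square])
      (use DERIV_diff[OF DERIV_const DERIV_cdivide[OF DERIV_ident]] in simp)
  moreover have "continuous_on UNIV D"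
    unfolding D_def shrunk_box_dist_sq_def Dd_def divide_inverse by (intro continuous_intros)
  ultimately show ?thesis unfolding C1_with_gradient_def by blast
qed

lemma box_bump_bounds: "0 \<le> box_bump a b \<epsilon> x" "box_bump a b \<epsilon> x \<le> 1"
proof -
  have "0 \<le> shrunk_box_dist_sq a b \<epsilon> x" unfolding shrunk_box_dist_sq_def by (intro sum_nonneg) auto
  then have "0 \<le> shrunk_box_dist_sq a b \<epsilon> x / \<epsilon>\<^sup>2" by simp
  then show "box_bump a b \<epsilon> x \<le> 1" unfolding box_bump_def by (intro power_le_one) auto
qed (simp add: box_bump_def)

lemma box_bump_support:
  assumes \<epsilon>: "0 < \<epsilon>" and x: "x \<notin> box a b"
  shows "box_bump a b \<epsilon> x = 0"
proof -
  let ?f = "\<lambda>j. (max 0 (a \<bullet> j + \<epsilon> - x \<bullet> j))\<^sup>2 + (max 0 (x \<bullet> j - b \<bullet> j + \<epsilon>))\<^sup>2"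
  obtain j where j: "j \<in> Basis" "x \<bullet> j \<le> a \<bullet> j \<or> b \<bullet> j \<le> x \<bullet> j" using x by (auto simp: mem_box not_less)
  have "\<epsilon> \<le> max 0 (a \<bullet> j + \<epsilon> - x \<bullet> j) \<or> \<epsilon> \<le> max 0 (x \<bullet> j - b \<bullet> j + \<epsilon>)" using j \<epsilon> by auto
  then have "\<epsilon>\<^sup>2 \<le> ?f j" using \<epsilon> by (auto dest!: power_mono[of \<epsilon> _ 2] intro: add_increasing add_increasing2)
  also have "\<dots> \<le> shrunk_box_dist_sq a b \<epsilon> x"
    unfolding shrunk_box_dist_sq_def by (rule member_le_sum[OF j(1)]) auto
  finally have "1 \<le> shrunk_box_dist_sq a b \<epsilon> x / \<epsilon>\<^sup>2" using \<epsilon> by simp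
  then show ?thesis by (simp add: box_bump_def)
qed

lemma box_bump_tendsto:
  "(\<lambda>k. box_bump a b (1 / real (Suc k)) x) \<longlonglongrightarrow> indicator (box a b) x"
proof (cases "x \<in> box a b")
  case False
  then show ?thesis by (simp add: box_bump_support)
next
  case True
  have e0: "(\<lambda>k. 1 / real (Suc k)) \<longlonglongrightarrow> 0" using LIMSEQ_inverse_real_of_nat by (simp add: inverse_eq_divide)
  have "\<forall>\<^sub>F k in sequentially. \<forall>j\<in>Basis. 1 / real (Suc k) < x \<bullet> j - a \<bullet> j \<and> 1 / real (Suc k) < b \<bullet> j - x \<bullet> j"
    using True by (intro eventually_ball_finite ballI eventually_conj order_tendstoD(2)[OF e0]) (auto simp: mem_box)
  then have "\<forall>\<^sub>F k in sequentially. box_bump a b (1 / real (Suc k)) x = 1"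
  proof eventually_elim
    case (elim k)
    then have "shrunk_box_dist_sq a b (1 / real (Suc k)) x = 0"
      unfolding shrunk_box_dist_sq_def by (intro sum.neutral) (auto simp: max_def dest!: bspec)
    then show ?case by (simp add: box_bump_def)
  qed
  then show ?thesis using True by (simp add: tendsto_eventually)
qed

text \<open>The sets over which \<open>f\<close> has integral zero form a Dynkin system, so they include the Borel set where
  \<open>f > 0\<close>.\<close>
lemma AE_zero_if_box_integrals_zero:
  fixes f :: "'a::euclidean_space \<Rightarrow> real"
  assumes f: "integrable lborel f" and f0: "\<And>x. x \<notin> box c d \<Longrightarrow> f x = 0"
    and int: "\<And>a b. box a b \<subseteq> box c d \<Longrightarrow> (LINT x:box a b|lborel. f x) = 0"
  shows "AE x in lborel. f x = 0"
proof -
  note [measurable] = borel_measurable_integrable[OF f]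
  have si: "set_integrable lborel A f" if "A \<in> sets borel" for A
    unfolding set_integrable_def using f that by (intro integrable_mult_indicator) auto
  have stable: "Int_stable (range (\<lambda>(a, b). box a b :: 'a set))"
    by (auto simp: Int_stable_def box_Int_box)
  have sub: "range (\<lambda>(a, b). box a b :: 'a set) \<subseteq> Pow UNIV" by simp
  have zero: "(LINT x:A|lborel. f x) = 0" if "A \<in> sigma_sets UNIV (range (\<lambda>(a, b). box a b :: 'a set))" for A
    using stable sub that
  proof (induction rule: sigma_sets_induct_disjoint)
    case (basic A)
    then obtain a b where A: "A = box a b" by auto
    obtain a' b' where ab': "box a b \<inter> box c d = box a' b'" using box_Int_box by blast
    have "(LINT x:A|lborel. f x) = (LINT x:box a b \<inter> box c d|lborel. f x)"
      unfolding A set_lebesgue_integral_def using f0 by (intro Bochner_Integration.integral_cong) (auto simp: indicator_def)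
    also have "\<dots> = 0" unfolding ab' using ab' by (intro int) auto
    finally show ?case .
  next
    case empty then show ?case by (simp add: set_lebesgue_integral_def)
  next
    case (compl A)
    then have A: "A \<in> sets borel" by (simp add: borel_eq_box)
    have "(LINT x:UNIV|lborel. f x) = (LINT x:box c d|lborel. f x)"
      unfolding set_lebesgue_integral_def using f0 by (intro Bochner_Integration.integral_cong) (auto simp: indicator_def)
    also have "\<dots> = 0" by (rule int) simp
    finally have "(LINT x:UNIV|lborel. f x) = 0" .
    moreover have "(LINT x:UNIV|lborel. f x) = (LINT x:A|lborel. f x) + (LINT x:UNIV - A|lborel. f x)"
      using set_integral_Un[of A "UNIV - A" lborel f] si A by auto
    ultimately show ?case using compl by simp
  next
    case (union A)
    then have A: "A i \<in> sets borel" for i by (auto simp: borel_eq_box)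
    have "(LINT x:(\<Union>i. A i)|lborel. f x) = (\<Sum>i. LINT x:A i|lborel. f x)"
      using A union(1) by (intro lebesgue_integral_countable_add si) (auto simp: disjoint_family_on_def)
    then show ?case using union by simp
  qed
  have zero': "(LINT x:A|lborel. f x) = 0" if "A \<in> sets borel" for A
    using zero that by (simp add: borel_eq_box)
  have pos: "AE x in lborel. g x \<le> 0"
    if g: "integrable lborel g" and gz: "\<And>A. A \<in> sets borel \<Longrightarrow> (LINT x:A|lborel. g x) = 0" for g :: "'a \<Rightarrow> real"
  proof -
    note [measurable] = borel_measurable_integrable[OF g]
    let ?A = "{x. 0 < g x}"
    have A: "?A \<in> sets borel" by measurable
    have eq: "(\<lambda>x. indicator ?A x *\<^sub>R g x) = (\<lambda>x. max 0 (g x))"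
      by (rule ext) (simp add: max_def not_less split: split_indicator)
    have "integrable lborel (\<lambda>x. indicator ?A x *\<^sub>R g x)" using g A by (intro integrable_mult_indicator) auto
    then have i: "integrable lborel (\<lambda>x. max 0 (g x))" by (simp only: eq)
    have "(LINT x|lborel. max 0 (g x)) = 0" using gz[OF A] unfolding set_lebesgue_integral_def eq .
    then have "AE x in lborel. max 0 (g x) = 0"
      using integral_nonneg_eq_0_iff_AE[OF i] by simp
    then show ?thesis by eventually_elim (auto simp: max_def split: if_splits)
  qed
  have "AE x in lborel. f x \<le> 0" by (rule pos[OF f zero'])
  moreover have "AE x in lborel. - f x \<le> 0"
    by (rule pos) (use f zero' in \<open>auto simp: set_lebesgue_integral_def\<close>)
  ultimately show ?thesis by eventually_elim auto
qed

text \<open>The bumps are admissible test functions, and by dominated convergence they show that \<open>G - H\<close> has integral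
  zero over all open subboxes.\<close>
lemma weak_gradient_unique_on_box:
  fixes G H :: "'a::euclidean_space \<Rightarrow> 'a"
  assumes \<Omega>: "open \<Omega>" and G: "has_weak_gradient \<Omega> u G" and H: "has_weak_gradient \<Omega> u H" and cd: "cbox c d \<subseteq> \<Omega>"
  shows "AE x in lebesgue. x \<in> box c d \<longrightarrow> G x = H x"
proof -
  let ?Q = "cbox c d"
  have int: "integrable lebesgue (\<lambda>x. indicator ?Q x *\<^sub>R F x)" if "has_weak_gradient \<Omega> u F" for F
  proof -
    have "locally_integrable_on F \<Omega>" using that by (simp only: has_weak_gradient_def)
    then have "integrable (lebesgue_on ?Q) F"
      unfolding locally_integrable_on_def using cd by (elim allE[of _ ?Q]) simp
    moreover have "?Q \<inter> space lebesgue \<in> sets lebesgue" by simp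
    ultimately show ?thesis using integrable_restrict_space by blast
  qed
  have conv: "(\<lambda>k. LINT x|lebesgue_on \<Omega>. box_bump a b (1 / real (Suc k)) x *\<^sub>R F x)
      \<longlonglongrightarrow> (LINT x|lebesgue. indicator (box a b) x *\<^sub>R (indicator ?Q x *\<^sub>R F x))"
    if ab: "box a b \<subseteq> box c d" and F: "has_weak_gradient \<Omega> u F" for a b F
  proof -
    have bm[measurable]: "box_bump a b \<epsilon> \<in> borel_measurable borel" for \<epsilon>
      using C1_box_bump[of a b \<epsilon>] C1_with_gradient_measurable(1) by blast
    have bm': "box_bump a b \<epsilon> \<in> borel_measurable lebesgue" for \<epsilon>
      using bm by (simp add: measurable_completion)
    have sub: "box a b \<subseteq> \<Omega>" "box a b \<subseteq> ?Q" using ab cd box_subset_cbox by blast+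
    have "(LINT x|lebesgue_on \<Omega>. box_bump a b (1 / real (Suc k)) x *\<^sub>R F x)
        = (LINT x|lebesgue. box_bump a b (1 / real (Suc k)) x *\<^sub>R (indicator ?Q x *\<^sub>R F x))" for k
    proof -
      have "(LINT x|lebesgue_on \<Omega>. box_bump a b (1 / real (Suc k)) x *\<^sub>R F x)
        = (LINT x|lebesgue. indicator \<Omega> x *\<^sub>R (box_bump a b (1 / real (Suc k)) x *\<^sub>R F x))"
        using \<Omega> by (intro integral_restrict_space) auto
      also have "\<dots> = (LINT x|lebesgue. box_bump a b (1 / real (Suc k)) x *\<^sub>R (indicator ?Q x *\<^sub>R F x))"
      proof (intro Bochner_Integration.integral_cong refl)
        fix x show "indicator \<Omega> x *\<^sub>R (box_bump a b (1 / real (Suc k)) x *\<^sub>R F x)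
          = box_bump a b (1 / real (Suc k)) x *\<^sub>R (indicator ?Q x *\<^sub>R F x)"
          using sub box_bump_support[of "1 / real (Suc k)" x a b]
          by (cases "x \<in> box a b") (auto simp: indicator_def)
      qed
      finally show ?thesis .
    qed
    moreover have "(\<lambda>k. LINT x|lebesgue. box_bump a b (1 / real (Suc k)) x *\<^sub>R (indicator ?Q x *\<^sub>R F x))
      \<longlonglongrightarrow> (LINT x|lebesgue. indicator (box a b) x *\<^sub>R (indicator ?Q x *\<^sub>R F x))"
    proof (rule integral_dominated_convergence[where w="\<lambda>x. norm (indicator ?Q x *\<^sub>R F x)"])
      show "integrable lebesgue (\<lambda>x. norm (indicator ?Q x *\<^sub>R F x))" using int[OF F] by (rule integrable_norm)
      show "AE x in lebesgue. (\<lambda>k. box_bump a b (1 / real (Suc k)) x *\<^sub>R indicator ?Q x *\<^sub>R F x)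
          \<longlonglongrightarrow> indicator (box a b) x *\<^sub>R indicator ?Q x *\<^sub>R F x"
        by (intro AE_I2 tendsto_intros box_bump_tendsto)
      show "AE x in lebesgue. norm (box_bump a b (1 / real (Suc k)) x *\<^sub>R indicator ?Q x *\<^sub>R F x)
          \<le> norm (indicator ?Q x *\<^sub>R F x)" for k
      proof (rule AE_I2)
        fix x
        have "\<bar>box_bump a b (1 / real (Suc k)) x\<bar> * norm (indicator ?Q x *\<^sub>R F x) \<le> 1 * norm (indicator ?Q x *\<^sub>R F x)"
          using box_bump_bounds[of a b "1 / real (Suc k)" x] by (intro mult_right_mono) auto
        then show "norm (box_bump a b (1 / real (Suc k)) x *\<^sub>R indicator ?Q x *\<^sub>R F x)
          \<le> norm (indicator ?Q x *\<^sub>R F x)" by (simp only: norm_scaleR[of "box_bump _ _ _ _"] mult_1)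
      qed
    next
      note m = borel_measurable_scaleR[OF _ borel_measurable_integrable[OF int[OF F]]]
      show "(\<lambda>x. indicator (box a b) x *\<^sub>R indicator ?Q x *\<^sub>R F x) \<in> borel_measurable lebesgue"
        by (rule m[OF borel_measurable_indicator]) simp
      show "(\<lambda>x. box_bump a b (1 / real (Suc k)) x *\<^sub>R indicator ?Q x *\<^sub>R F x) \<in> borel_measurable lebesgue" for k
        by (rule m[OF bm'])
    qed
    ultimately show ?thesis by simp
  qed
  have eqab: "(LINT x|lebesgue. indicator (box a b) x *\<^sub>R (indicator ?Q x *\<^sub>R G x))
      = (LINT x|lebesgue. indicator (box a b) x *\<^sub>R (indicator ?Q x *\<^sub>R H x))" if ab: "box a b \<subseteq> box c d" for a b
  proof (rule LIMSEQ_unique[OF conv[OF ab G]])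
    have "(LINT x|lebesgue_on \<Omega>. box_bump a b (1 / real (Suc k)) x *\<^sub>R G x)
      = (LINT x|lebesgue_on \<Omega>. box_bump a b (1 / real (Suc k)) x *\<^sub>R H x)" for k
    proof -
      obtain D where D: "C1_with_gradient UNIV (box_bump a b (1 / real (Suc k))) D" using C1_box_bump by blast
      have K: "\<exists>K. compact K \<and> K \<subseteq> \<Omega> \<and> (\<forall>x. x \<notin> K \<longrightarrow> box_bump a b (1 / real (Suc k)) x = 0)"
        using cd ab box_subset_cbox[of c d] by (intro exI[of _ ?Q]) (auto intro!: box_bump_support)
      have "(LINT x|lebesgue_on \<Omega>. u x *\<^sub>R D x) = - (LINT x|lebesgue_on \<Omega>. box_bump a b (1 / real (Suc k)) x *\<^sub>R F x)"
        if F: "has_weak_gradient \<Omega> u F" for F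
        using F[unfolded has_weak_gradient_def, THEN conjunct2, THEN conjunct2, rule_format, OF conjI, OF D K] .
      from this[OF G] this[OF H] show ?thesis by simp
    qed
    then show "(\<lambda>k. LINT x|lebesgue_on \<Omega>. box_bump a b (1 / real (Suc k)) x *\<^sub>R G x)
      \<longlonglongrightarrow> (LINT x|lebesgue. indicator (box a b) x *\<^sub>R (indicator ?Q x *\<^sub>R H x))"
      using conv[OF ab H] by simp
  qed
  have "AE x in lebesgue. x \<in> box c d \<longrightarrow> (G x - H x) \<bullet> e = 0" if e: "e \<in> Basis" for e
  proof -
    define f where "f x = (indicator ?Q x *\<^sub>R G x - indicator ?Q x *\<^sub>R H x) \<bullet> e" for x
    have f: "integrable lebesgue f" unfolding f_def using int[OF G] int[OF H] by auto
    obtain g where g[measurable]: "g \<in> borel_measurable lborel" and fg: "AE x in lborel. f x = g x"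
      using completion_ex_borel_measurable_real[OF borel_measurable_integrable[OF f]] by auto
    define h where "h x = indicator (box c d) x * g x" for x
    have [measurable]: "h \<in> borel_measurable lborel" unfolding h_def by measurable
    have fh: "AE x in lebesgue. indicator (box c d) x * f x = h x"
      using AE_completion[OF fg] by eventually_elim (simp add: h_def)
    have hi: "integrable lebesgue h"
    proof (rule integrable_cong_AE_imp[OF _ _ fh])
      show "integrable lebesgue (\<lambda>x. indicator (box c d) x * f x)"
        using integrable_mult_indicator[OF _ f, of "box c d"] by simp
      show "h \<in> borel_measurable lebesgue" by (rule measurable_completion) simp
    qed
    have "AE x in lborel. h x = 0"
    proof (rule AE_zero_if_box_integrals_zero[of h c d])
      show "integrable lborel h" using hi by (simp add: integrable_completion)
      fix a b assume ab: "box a b \<subseteq> box c d"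
      have "(LINT x:box a b|lborel. h x) = (LINT x|lebesgue. indicator (box a b) x *\<^sub>R h x)"
        unfolding set_lebesgue_integral_def by (rule integral_completion[symmetric]) measurable
      also have "\<dots> = (LINT x|lebesgue. (indicator (box a b) x *\<^sub>R (indicator ?Q x *\<^sub>R G x)
          - indicator (box a b) x *\<^sub>R (indicator ?Q x *\<^sub>R H x)) \<bullet> e)"
      proof (rule integral_cong_AE)
        show "(\<lambda>x. indicator (box a b) x *\<^sub>R h x) \<in> borel_measurable lebesgue"
          by (rule measurable_completion) measurable
        show "(\<lambda>x. (indicator (box a b) x *\<^sub>R indicator ?Q x *\<^sub>R G x - indicator (box a b) x *\<^sub>R indicator ?Q x *\<^sub>R H x) \<bullet> e)
           \<in> borel_measurable lebesgue"
          by (intro borel_measurable_inner borel_measurable_diff borel_measurable_const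
              borel_measurable_scaleR[OF borel_measurable_indicator borel_measurable_integrable[OF int[OF G]]]
              borel_measurable_scaleR[OF borel_measurable_indicator borel_measurable_integrable[OF int[OF H]]]) simp_all
        show "AE x in lebesgue. indicator (box a b) x *\<^sub>R h x = (indicator (box a b) x *\<^sub>R indicator ?Q x *\<^sub>R G x
            - indicator (box a b) x *\<^sub>R indicator ?Q x *\<^sub>R H x) \<bullet> e"
          using fh by eventually_elim (use ab in \<open>auto simp: f_def indicator_def split: if_splits\<close>)
      qed
      also have "\<dots> = ((LINT x|lebesgue. indicator (box a b) x *\<^sub>R (indicator ?Q x *\<^sub>R G x))
          - (LINT x|lebesgue. indicator (box a b) x *\<^sub>R (indicator ?Q x *\<^sub>R H x))) \<bullet> e"
        using integrable_mult_indicator[OF _ int[OF G], of "box a b"] integrable_mult_indicator[OF _ int[OF H], of "box a b"]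
        by simp
      also have "\<dots> = 0" using eqab[OF ab] by simp
      finally show "(LINT x:box a b|lborel. h x) = 0" .
    qed (simp add: h_def)
    then have "AE x in lebesgue. h x = 0" by (rule AE_completion)
    then show ?thesis using fh
      by eventually_elim (use box_subset_cbox[of c d] in \<open>auto simp: f_def indicator_def split: if_splits\<close>)
  qed
  then have "AE x in lebesgue. \<forall>e\<in>Basis. x \<in> box c d \<longrightarrow> (G x - H x) \<bullet> e = 0"
    by (intro AE_finite_allI) auto
  then show ?thesis
  proof eventually_elim
    case (elim x)
    show ?case
    proof
      assume "x \<in> box c d"
      then have "G x - H x = 0" using elim euclidean_all_zero_iff[of "G x - H x"] by blast
      then show "G x = H x" by simp
    qed
  qed
qed

lemma weak_gradient_unique:
  fixes G H :: "'a::euclidean_space \<Rightarrow> 'a"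
  assumes \<Omega>: "open \<Omega>" and G: "has_weak_gradient \<Omega> u G" and H: "has_weak_gradient \<Omega> u H"
  shows "AE x in lebesgue_on \<Omega>. G x = H x"
proof -
  obtain D where D: "countable D" "D \<subseteq> Pow \<Omega>" "\<And>X. X \<in> D \<Longrightarrow> \<exists>a b. X = cbox a b" "\<Union>D = \<Omega>"
    using open_countable_Union_open_cbox[OF \<Omega>] by metis
  have "AE x in lebesgue. \<forall>X\<in>D. x \<in> X \<longrightarrow> G x = H x"
    unfolding AE_ball_countable[OF D(1)]
  proof
    fix X assume X: "X \<in> D"
    then obtain a b where ab: "X = cbox a b" "cbox a b \<subseteq> \<Omega>" using D(2,3) by blast
    have "cbox a b - box a b \<in> null_sets lebesgue"
      using negligible_frontier_interval[of a b] by (simp add: negligible_iff_null_sets)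
    then have "AE x in lebesgue. x \<notin> cbox a b - box a b" by (rule AE_not_in)
    with weak_gradient_unique_on_box[OF \<Omega> G H ab(2)]
    show "AE x in lebesgue. x \<in> X \<longrightarrow> G x = H x" by eventually_elim (auto simp: ab)
  qed
  then show ?thesis
    using \<Omega> D(4) by (subst AE_restrict_space_iff) (auto elim!: eventually_mono)
qed

lemma has_weak_gradient_measurable:
  fixes G :: "'a::euclidean_space \<Rightarrow> 'a"
  assumes \<Omega>: "open \<Omega>" and G: "has_weak_gradient \<Omega> u G"
  shows "G \<in> borel_measurable (lebesgue_on \<Omega>)"
proof -
  obtain D where D: "countable D" "D \<subseteq> Pow \<Omega>" "\<And>X. X \<in> D \<Longrightarrow> \<exists>a b. X = cbox a b" "\<Union>D = \<Omega>"
    using open_countable_Union_open_cbox[OF \<Omega>] by metis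
  show ?thesis
  proof (rule measurable_piecewise_restrict[OF D(1)])
    show "space (lebesgue_on \<Omega>) \<subseteq> \<Union>D" using D(4) by simp
    fix X assume X: "X \<in> D"
    then obtain a b where ab: "X = cbox a b" "X \<subseteq> \<Omega>" using D(2,3) by blast
    then have e: "restrict_space (lebesgue_on \<Omega>) X = lebesgue_on X"
      using \<Omega> by (subst restrict_restrict_space) (auto simp: Int_absorb1)
    show "X \<inter> space (lebesgue_on \<Omega>) \<in> sets (lebesgue_on \<Omega>)"
      using ab \<Omega> by (auto simp: sets_restrict_space_iff)
    have "integrable (lebesgue_on X) G"
      using G ab unfolding has_weak_gradient_def locally_integrable_on_def by auto
    then show "G \<in> borel_measurable (restrict_space (lebesgue_on \<Omega>) X)"
      unfolding e by (rule borel_measurable_integrable)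
  qed
qed

section \<open>Trace inequalities for the surface measure\<close>

text \<open>Convexity of the power, with weights \<open>1 - t\<close> and \<open>t\<close>.  For \<open>t\<close> close to \<open>0\<close> the first coefficient is close
  to \<open>1\<close>.\<close>
lemma powr_add_le:
  fixes a b p t :: real
  assumes p: "1 < p" and ab: "0 \<le> a" "0 \<le> b" and t: "0 < t" "t < 1"
  shows "(a + b) powr p \<le> (1 - t) powr (1 - p) * a powr p + t powr (1 - p) * b powr p"
proof -
  have ge1: "1 \<le> x powr (1 - p)" if "0 < x" "x < 1" for x :: real
  proof -
    have "ln x \<le> 0" using that by simp
    then have "0 \<le> (1 - p) * ln x" using p by (intro mult_nonpos_nonpos) auto
    then show ?thesis using that by (simp add: powr_def)
  qed
  consider "a = 0" | "b = 0" | "0 < a" "0 < b" using ab by linarith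
  then show ?thesis
  proof cases
    case 1
    then show ?thesis using mult_right_mono[OF ge1[OF t], of "b powr p"] by simp
  next
    case 2
    then show ?thesis using mult_right_mono[OF ge1[of "1 - t"], of "a powr p"] t by simp
  next
    case 3
    have "((1 - t) *\<^sub>R (a / (1 - t)) + t *\<^sub>R (b / t)) powr p
        \<le> (1 - t) * (a / (1 - t)) powr p + t * (b / t) powr p"
      using t 3 p by (intro convex_onD[OF powr_convex]) auto
    moreover have "x * (y / x) powr p = x powr (1 - p) * y powr p" if "0 < x" "0 < y" for x y :: real
      using that by (simp add: powr_divide powr_diff)
    ultimately show ?thesis using t 3 by simp
  qed
qed

lemma norm_powr_le:
  fixes a b :: "'a::real_normed_vector"
  assumes p: "1 < p" and t: "0 < t" "t < 1"
  shows "norm a powr p \<le> (1 - t) powr (1 - p) * norm b powr p + t powr (1 - p) * norm (a - b) powr p"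
proof -
  have "norm a \<le> norm b + norm (a - b)" using norm_triangle_sub[of a b] by simp
  then have "norm a powr p \<le> (norm b + norm (a - b)) powr p" using p by (intro powr_mono2) auto
  also have "\<dots> \<le> (1 - t) powr (1 - p) * norm b powr p + t powr (1 - p) * norm (a - b) powr p"
    by (rule powr_add_le[OF p _ _ t]) auto
  finally show ?thesis .
qed

text \<open>First \<open>k\<close> tends to infinity and then \<open>t\<close> to \<open>0\<close> in the weighted inequality for the norms; this is used in place
  of Minkowski's inequality.\<close>
lemma Lp_norm_tendsto:
  fixes f :: "'b \<Rightarrow> 'c::{second_countable_topology, real_normed_vector}" and F :: "nat \<Rightarrow> 'b \<Rightarrow> 'c"
  assumes p: "1 < p" and [measurable]: "f \<in> borel_measurable M" "\<And>k. F k \<in> borel_measurable M"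
    and lim: "(\<lambda>k. \<integral>\<^sup>+x. ennreal (norm (F k x - f x) powr p) \<partial>M) \<longlonglongrightarrow> 0"
  shows "(\<lambda>k. \<integral>\<^sup>+x. ennreal (norm (F k x) powr p) \<partial>M) \<longlonglongrightarrow> (\<integral>\<^sup>+x. ennreal (norm (f x) powr p) \<partial>M)"
proof -
  define X where "X = (\<integral>\<^sup>+x. ennreal (norm (f x) powr p) \<partial>M)"
  define Xk where "Xk k = (\<integral>\<^sup>+x. ennreal (norm (F k x) powr p) \<partial>M)" for k
  define d where "d k = (\<integral>\<^sup>+x. ennreal (norm (F k x - f x) powr p) \<partial>M)" for k
  define A where "A t = ennreal ((1 - t) powr (1 - p))" for t :: real
  define B where "B t = ennreal (t powr (1 - p))" for t :: real
  have le: "(\<integral>\<^sup>+x. ennreal (norm (g x) powr p) \<partial>M) \<le> A t * (\<integral>\<^sup>+x. ennreal (norm (h x) powr p) \<partial>M)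
      + B t * (\<integral>\<^sup>+x. ennreal (norm (g x - h x) powr p) \<partial>M)"
    if [measurable]: "g \<in> borel_measurable M" "h \<in> borel_measurable M" and t: "0 < t" "t < 1" for g h :: "'b \<Rightarrow> 'c" and t
  proof -
    have "(\<integral>\<^sup>+x. ennreal (norm (g x) powr p) \<partial>M)
      \<le> (\<integral>\<^sup>+x. A t * ennreal (norm (h x) powr p) + B t * ennreal (norm (g x - h x) powr p) \<partial>M)"
      unfolding A_def B_def
      by (intro nn_integral_mono) (simp add: norm_powr_le[OF p t] ennreal_leI flip: ennreal_mult ennreal_plus)
    also have "\<dots> = A t * (\<integral>\<^sup>+x. ennreal (norm (h x) powr p) \<partial>M)
      + B t * (\<integral>\<^sup>+x. ennreal (norm (g x - h x) powr p) \<partial>M)"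
      by (subst nn_integral_add) (auto simp: nn_integral_cmult)
    finally show ?thesis .
  qed
  have up: "Xk k \<le> A t * X + B t * d k" if "0 < t" "t < 1" for t k
    unfolding Xk_def X_def d_def by (rule le) (use that in auto)
  have lo: "X \<le> A t * Xk k + B t * d k" if "0 < t" "t < 1" for t k
    using le[OF _ _ that, of f "F k"] unfolding Xk_def X_def d_def by (simp add: norm_minus_commute)
  have Bd: "(\<lambda>k. c + B t * d k) \<longlonglongrightarrow> c" for t c
  proof -
    have "(\<lambda>k. B t * d k) \<longlonglongrightarrow> B t * 0"
      using lim unfolding d_def by (intro ennreal_tendsto_cmult) (auto simp: B_def)
    then have "(\<lambda>k. c + B t * d k) \<longlonglongrightarrow> c + B t * 0" by (intro tendsto_add tendsto_const)
    then show ?thesis by simp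
  qed
  have At: "((\<lambda>t. A t * c) \<longlongrightarrow> c) (at_right 0)" if "c < top" for c
  proof -
    have "((\<lambda>t::real. (1 - t) powr (1 - p)) \<longlongrightarrow> (1 - 0) powr (1 - p)) (at_right 0)"
      by (intro tendsto_intros) auto
    then have "((\<lambda>t. c * A t) \<longlongrightarrow> c * ennreal ((1 - 0) powr (1 - p))) (at_right 0)"
      unfolding A_def using that by (intro ennreal_tendsto_cmult tendsto_ennrealI)
    then show ?thesis by (simp add: mult.commute)
  qed
  have small: "\<forall>\<^sub>F t in at_right (0::real). 0 < t \<and> t < 1"
    by (rule eventually_at_rightI[of 0 1]) auto
  have "Xk \<longlonglongrightarrow> X"
  proof (rule order_tendstoI)
    fix c assume c: "X < c"
    have "\<forall>\<^sub>F t in at_right 0. A t * X < c"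
      by (rule order_tendstoD(2)[OF At c]) (use c in \<open>auto simp: less_top intro: order_less_le_trans\<close>)
    with small obtain t where t: "0 < t" "t < 1" "A t * X < c"
      using eventually_happens'[OF _ eventually_conj] by (metis (no_types, lifting) trivial_limit_at_right_real)
    have "\<forall>\<^sub>F k in sequentially. A t * X + B t * d k < c" by (rule order_tendstoD(2)[OF Bd t(3)])
    then show "\<forall>\<^sub>F k in sequentially. Xk k < c"
      by eventually_elim (use up[OF t(1,2)] in \<open>auto intro: order_le_less_trans\<close>)
  next
    fix c assume c: "c < X"
    have "\<forall>\<^sub>F t in at_right 0. A t * c < X"
      by (rule order_tendstoD(2)[OF At c]) (use c in \<open>auto intro: order_less_le_trans\<close>)
    with small obtain t where t: "0 < t" "t < 1" "A t * c < X"
      using eventually_happens'[OF _ eventually_conj] by (metis (no_types, lifting) trivial_limit_at_right_real)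
    have "\<forall>\<^sub>F k in sequentially. A t * c + B t * d k < X" by (rule order_tendstoD(2)[OF Bd t(3)])
    then show "\<forall>\<^sub>F k in sequentially. c < Xk k"
    proof eventually_elim
      case (elim k)
      show ?case
      proof (rule ccontr)
        assume "\<not> c < Xk k"
        then have "A t * Xk k + B t * d k \<le> A t * c + B t * d k" by (intro add_right_mono mult_left_mono) auto
        from order_trans[OF lo[OF t(1,2)] this] elim show False by (meson leD)
      qed
    qed
  qed
  then show ?thesis by (simp add: Xk_def[abs_def] X_def)
qed

lemma nn_integral_lebesgue_on:
  assumes "\<Omega> \<in> sets borel"
  shows "(\<integral>\<^sup>+x. f x \<partial>lebesgue_on \<Omega>) = (\<integral>\<^sup>+x. f x * indicator \<Omega> x \<partial>(lborel :: 'a::euclidean_space measure))"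
  using assms by (subst nn_integral_restrict_space) (auto simp: nn_integral_completion)

lemma nn_integral_surface_measure:
  "(\<integral>\<^sup>+x. f x \<partial>surface_measure \<Omega>) = (\<integral>\<^sup>+x. f x * indicator (frontier \<Omega>) x \<partial>(area_measure :: 'a::euclidean_space measure))"
  unfolding surface_measure_area
  by (subst nn_integral_restrict_space) (auto simp: frontier_closed borel_closed)

lemma measurable_surface_measure [measurable (raw)]:
  "f \<in> borel_measurable borel \<Longrightarrow> f \<in> borel_measurable (surface_measure \<Omega>)"
  unfolding surface_measure_area by (rule measurable_restrict_space1) simp

lemma measurable_lebesgue_on_borel:
  "f \<in> borel_measurable borel \<Longrightarrow> f \<in> borel_measurable (lebesgue_on \<Omega>)"
  by (rule measurable_restrict_space1) (simp add: measurable_completion)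

lemma surface_integral_ball:
  fixes f :: "'a::euclidean_space \<Rightarrow> ennreal"
  assumes "2 \<le> DIM('a)" "0 < \<rho>" "f \<in> borel_measurable borel"
  shows "(\<integral>\<^sup>+x. f x \<partial>surface_measure (ball z \<rho>))
    = ennreal (\<rho> ^ (DIM('a) - 1)) * (\<integral>\<^sup>+\<omega>. f (z + \<rho> *\<^sub>R \<omega>) \<partial>sphere_measure)"
  using assms nn_integral_area_measure_sphere[OF assms] by (simp add: nn_integral_surface_measure)

lemma frontier_shell:
  fixes U :: "'a::euclidean_space set"
  assumes U: "U = {x. r < norm x \<and> norm x < R}" and rR: "0 < r" "r < R"
  shows "frontier U \<subseteq> sphere 0 r \<union> sphere 0 R"
proof
  fix x assume x: "x \<in> frontier U"
  have "open U" unfolding U by (intro open_Collect_conj open_Collect_less continuous_intros)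
  then have "x \<notin> U" using x by (simp add: frontier_def interior_open)
  moreover have "U \<subseteq> {x. r \<le> norm x \<and> norm x \<le> R}" unfolding U by auto
  then have "closure U \<subseteq> {x. r \<le> norm x \<and> norm x \<le> R}"
    by (rule closure_minimal) (intro closed_Collect_conj closed_Collect_le continuous_intros)
  then have "r \<le> norm x" "norm x \<le> R" using x by (auto simp: frontier_def)
  ultimately show "x \<in> sphere 0 r \<union> sphere 0 R" unfolding U by auto
qed

lemma surface_integral_shell_le:
  fixes f :: "'a::euclidean_space \<Rightarrow> ennreal"
  assumes dim: "2 \<le> DIM('a)" and U: "U = {x. r < norm x \<and> norm x < R}" and rR: "0 < r" "r < R"
    and [measurable]: "f \<in> borel_measurable borel"
  shows "(\<integral>\<^sup>+x. f x \<partial>surface_measure U)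
    \<le> ennreal (R ^ (DIM('a) - 1)) * (\<integral>\<^sup>+\<omega>. f (0 + R *\<^sub>R \<omega>) \<partial>sphere_measure)
      + ennreal (r ^ (DIM('a) - 1)) * (\<integral>\<^sup>+\<omega>. f (0 + r *\<^sub>R \<omega>) \<partial>sphere_measure)"
proof -
  have i[measurable]: "(\<lambda>x::'a. indicator (sphere 0 t) x :: ennreal) \<in> borel_measurable area_measure" for t
    by (intro borel_measurable_indicator) auto
  have "(\<integral>\<^sup>+x. f x \<partial>surface_measure U) \<le> (\<integral>\<^sup>+x. f x * indicator (sphere 0 R) x + f x * indicator (sphere 0 r) x \<partial>area_measure)"
    unfolding nn_integral_surface_measure using frontier_shell[OF U rR]
    by (intro nn_integral_mono) (auto simp: indicator_def)
  also have "\<dots> = (\<integral>\<^sup>+x. f x * indicator (sphere 0 R) x \<partial>area_measure) + (\<integral>\<^sup>+x. f x * indicator (sphere 0 r) x \<partial>area_measure)"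
    by (intro nn_integral_add) measurable
  finally show ?thesis
    using nn_integral_area_measure_sphere[OF dim, of R f 0] nn_integral_area_measure_sphere[OF dim, of r f 0] rR by simp
qed

lemma energy_lebesgue_on:
  fixes w :: "'a::euclidean_space \<Rightarrow> real"
  assumes w: "C1_with_gradient UNIV w Dw" and \<Omega>: "\<Omega> \<in> sets borel" and C: "0 \<le> C"
  shows "(\<integral>\<^sup>+x. ennreal (norm (Dw x) powr p + C * \<bar>w x\<bar> powr p) * indicator \<Omega> x \<partial>lborel)
    = (\<integral>\<^sup>+x. ennreal (norm (Dw x) powr p) \<partial>lebesgue_on \<Omega>) + ennreal C * (\<integral>\<^sup>+x. ennreal (\<bar>w x\<bar> powr p) \<partial>lebesgue_on \<Omega>)"
proof -
  note [measurable] = C1_with_gradient_measurable(1,2)[OF w] \<Omega>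
  have "(\<integral>\<^sup>+x. ennreal (norm (Dw x) powr p + C * \<bar>w x\<bar> powr p) * indicator \<Omega> x \<partial>lborel)
    = (\<integral>\<^sup>+x. ennreal (norm (Dw x) powr p) * indicator \<Omega> x + ennreal C * (ennreal (\<bar>w x\<bar> powr p) * indicator \<Omega> x) \<partial>lborel)"
    using C by (intro nn_integral_cong) (simp add: ennreal_mult distrib_right mult.assoc)
  also have "\<dots> = (\<integral>\<^sup>+x. ennreal (norm (Dw x) powr p) * indicator \<Omega> x \<partial>lborel)
      + ennreal C * (\<integral>\<^sup>+x. ennreal (\<bar>w x\<bar> powr p) * indicator \<Omega> x \<partial>lborel)"
    by (subst nn_integral_add) (auto simp: nn_integral_cmult)
  finally show ?thesis by (simp add: nn_integral_lebesgue_on[OF \<Omega>])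
qed

text \<open>The weight \<open>\<phi>(s) = s/\<rho>\<close> gives a constant that is far from optimal but independent of \<open>w\<close>; it controls
  limits of traces.\<close>
lemma ball_trace_inequality:
  fixes w :: "'a::euclidean_space \<Rightarrow> real"
  assumes dim: "2 \<le> DIM('a)" and w: "C1_with_gradient UNIV w Dw" and p: "1 < p" and \<rho>: "0 < \<rho>"
  shows "(\<integral>\<^sup>+x. ennreal (\<bar>w x\<bar> powr p) \<partial>surface_measure (ball z \<rho>))
    \<le> (\<integral>\<^sup>+x. ennreal (norm (Dw x) powr p) \<partial>lebesgue_on (ball z \<rho>))
      + ennreal (real DIM('a) / \<rho> + p - 1) * (\<integral>\<^sup>+x. ennreal (\<bar>w x\<bar> powr p) \<partial>lebesgue_on (ball z \<rho>))"
proof -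
  let ?C = "real DIM('a) / \<rho> + p - 1"
  note [measurable] = C1_with_gradient_measurable(1,2)[OF w]
  have C0: "0 \<le> ?C" using p \<rho> by (auto intro: add_nonneg_nonneg simp: add_diff_eq[symmetric])
  have "ennreal (1 powr (p - 1)) *
      (ennreal (\<rho> ^ (DIM('a) - 1)) * (\<integral>\<^sup>+\<omega>. ennreal (\<bar>w (z + \<rho> *\<^sub>R \<omega>)\<bar> powr p) \<partial>sphere_measure) +
       ennreal (0 ^ (DIM('a) - 1)) * (\<integral>\<^sup>+\<omega>. ennreal (\<bar>w (z + 0 *\<^sub>R \<omega>)\<bar> powr p) \<partial>sphere_measure))
    \<le> (\<integral>\<^sup>+x. ennreal (norm (Dw x) powr p + ?C * \<bar>w x\<bar> powr p) * indicator {x. 0 < norm (x - z) \<and> norm (x - z) < \<rho>} x \<partial>lborel)"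
  proof (rule annulus_trace_inequality[OF dim w p _ \<rho> zero_less_one C0, where \<phi>="\<lambda>s. s / \<rho>" and \<phi>'="\<lambda>_. 1 / \<rho>"])
    fix s assume s: "s \<in> {0..\<rho>}"
    show "((\<lambda>s. s / \<rho>) has_real_derivative 1 / \<rho>) (at s)"
      using DERIV_cdivide[OF DERIV_ident, of \<rho>] by simp
    show le1: "\<bar>s / \<rho>\<bar> \<le> 1" using s \<rho> by simp
    have "(p - 1) * (\<bar>s / \<rho>\<bar> * s) \<le> (p - 1) * (1 * s)" using p s le1 by (intro mult_left_mono mult_right_mono) auto
    moreover have "s * (1 / \<rho>) + real (DIM('a) - 1) * (s / \<rho>) = real DIM('a) / \<rho> * s"
      using dim by (simp add: of_nat_diff add_divide_distrib[symmetric] algebra_simps)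
    ultimately show "1 powr (p - 1) * (s * (1 / \<rho>) + real (DIM('a) - 1) * (s / \<rho>)) + (p - 1) * 1 powr p * \<bar>s / \<rho>\<bar> * s \<le> ?C * s"
      by (simp add: algebra_simps)
  qed (use \<rho> in auto)
  also have "\<dots> \<le> (\<integral>\<^sup>+x. ennreal (norm (Dw x) powr p + ?C * \<bar>w x\<bar> powr p) * indicator (ball z \<rho>) x \<partial>lborel)"
    by (intro nn_integral_mono) (auto simp: indicator_def dist_norm norm_minus_commute)
  also have "\<dots> = (\<integral>\<^sup>+x. ennreal (norm (Dw x) powr p) \<partial>lebesgue_on (ball z \<rho>))
      + ennreal ?C * (\<integral>\<^sup>+x. ennreal (\<bar>w x\<bar> powr p) \<partial>lebesgue_on (ball z \<rho>))"
    by (rule energy_lebesgue_on[OF w _ C0]) simp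
  finally show ?thesis
    using dim surface_integral_ball[OF dim \<rho>, of "\<lambda>x. ennreal (\<bar>w x\<bar> powr p)" z] by (simp add: power_0_left)
qed

text \<open>On the shell, the radial weight \<open>\<phi>\<close> increases from \<open>-1\<close> to \<open>1\<close> with vanishing derivative at both ends.
  Where \<open>\<phi>\<close> varies, the term of order \<open>\<beta>\<^sup>p\<close> gains the factor \<open>1 - \<bar>\<phi>\<bar>\<close>, of the order of \<open>y\<^sup>2\<close>, and
  the loss beyond the curvature term is at most of order \<open>\<beta>\<^sup>p\<^sup>-\<^sup>1 y\<close>.  Completing the square costs only \<open>\<beta>\<^sup>p\<^sup>-\<^sup>2\<close>.\<close>
lemma shell_trace_inequality:
  fixes r R p :: real
  assumes dim: "2 \<le> DIM('a::euclidean_space)" and U: "U = {x::'a. r < norm x \<and> norm x < R}"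
    and rR: "0 < r" "r < R" and p: "1 < p"
  obtains K where "0 \<le> K" "\<And>\<beta> w Dw. 0 < \<beta> \<Longrightarrow> C1_with_gradient UNIV w Dw \<Longrightarrow>
    ennreal (\<beta> powr (p - 1)) * (\<integral>\<^sup>+x. ennreal (\<bar>w x\<bar> powr p) \<partial>surface_measure U)
    \<le> (\<integral>\<^sup>+x. ennreal (norm (Dw x) powr p) \<partial>lebesgue_on U)
      + ennreal ((p - 1) * \<beta> powr p + real (DIM('a) - 1) / R * \<beta> powr (p - 1) + K * \<beta> powr (p - 2))
        * (\<integral>\<^sup>+x. ennreal (\<bar>w x\<bar> powr p) \<partial>lebesgue_on U)"
proof -
  define m where "m = real (DIM('a) - 1)"
  have m0: "0 \<le> m" by (simp add: m_def)
  define L where "L = R - r"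
  have L: "0 < L" using rR by (simp add: L_def)
  define A where "A = 12 / L + 2 * m * L / (r * R)"
  define K where "K = A\<^sup>2 / (8 * (p - 1))"
  have K: "0 \<le> K" using p by (simp add: K_def)
  have main: "ennreal (\<beta> powr (p - 1)) * (\<integral>\<^sup>+x. ennreal (\<bar>w x\<bar> powr p) \<partial>surface_measure U)
    \<le> (\<integral>\<^sup>+x. ennreal (norm (Dw x) powr p) \<partial>lebesgue_on U)
      + ennreal ((p - 1) * \<beta> powr p + real (DIM('a) - 1) / R * \<beta> powr (p - 1) + K * \<beta> powr (p - 2))
        * (\<integral>\<^sup>+x. ennreal (\<bar>w x\<bar> powr p) \<partial>lebesgue_on U)"
    if \<beta>: "0 < \<beta>" and w: "C1_with_gradient UNIV w Dw" for \<beta> and w :: "'a \<Rightarrow> real" and Dw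
  proof -
    note [measurable] = C1_with_gradient_measurable(1,2)[OF w]
    define C where "C = (p - 1) * \<beta> powr p + m / R * \<beta> powr (p - 1) + K * \<beta> powr (p - 2)"
    have C0: "0 \<le> C" using p m0 K rR by (simp add: C_def)
    define \<tau> where "\<tau> s = (R - s) / L" for s
    define \<phi> where "\<phi> s = 1 - 2 * (3 * (\<tau> s)\<^sup>2 - 2 * (\<tau> s) ^ 3)" for s
    define \<phi>' where "\<phi>' s = 12 * (\<tau> s * (1 - \<tau> s)) / L" for s
    have Um: "U \<in> sets borel" unfolding U by measurable
    have "ennreal (\<beta> powr (p - 1)) * (\<integral>\<^sup>+x. ennreal (\<bar>w x\<bar> powr p) \<partial>surface_measure U)
      \<le> ennreal (\<beta> powr (p - 1)) *
      (ennreal (R ^ (DIM('a) - 1)) * (\<integral>\<^sup>+\<omega>. ennreal (\<bar>w (0 + R *\<^sub>R \<omega>)\<bar> powr p) \<partial>sphere_measure) +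
       ennreal (r ^ (DIM('a) - 1)) * (\<integral>\<^sup>+\<omega>. ennreal (\<bar>w (0 + r *\<^sub>R \<omega>)\<bar> powr p) \<partial>sphere_measure))"
      by (intro mult_left_mono surface_integral_shell_le[OF dim U rR]) auto
    also have "\<dots> \<le> (\<integral>\<^sup>+x. ennreal (norm (Dw x) powr p + C * \<bar>w x\<bar> powr p) * indicator {x. r < norm (x - 0) \<and> norm (x - 0) < R} x \<partial>lborel)"
    proof (rule annulus_trace_inequality[OF dim w p _ rR(2) \<beta> C0, where \<phi>=\<phi> and \<phi>'=\<phi>'])
      fix s assume s: "s \<in> {r..R}"
      have s0: "0 < s" using s rR by auto
      have t: "0 \<le> \<tau> s" "\<tau> s \<le> 1" using s L by (auto simp: \<tau>_def L_def)
      have d\<tau>: "(\<tau> has_real_derivative - 1 / L) (at s)"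
        unfolding \<tau>_def[abs_def] using DERIV_cdivide[OF DERIV_diff[OF DERIV_const DERIV_ident], of R L] by simp
      show "(\<phi> has_real_derivative \<phi>' s) (at s)"
        unfolding \<phi>_def[abs_def] \<phi>'_def
        by (auto intro!: derivative_eq_intros d\<tau> simp: algebra_simps power2_eq_square power3_eq_cube diff_divide_distrib)
      define y where "y = \<tau> s * (1 - \<tau> s)"
      have y0: "0 \<le> y" using t by (simp add: y_def)
      have one_minus: "1 - \<phi> s = 2 * (\<tau> s)\<^sup>2 * (3 - 2 * \<tau> s)"
        by (simp add: \<phi>_def algebra_simps power2_eq_square power3_eq_cube)
      have one_plus: "1 + \<phi> s = 2 * (1 - \<tau> s)\<^sup>2 * (1 + 2 * \<tau> s)"
        by (simp add: \<phi>_def algebra_simps power2_eq_square power3_eq_cube)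
      have "2 * (y\<^sup>2 * 1) \<le> 2 * ((\<tau> s)\<^sup>2 * (3 - 2 * \<tau> s))"
      proof (intro mult_left_mono mult_mono)
        show "y\<^sup>2 \<le> (\<tau> s)\<^sup>2" unfolding y_def using t by (intro power_mono) (auto simp: mult_left_le)
      qed (use t in auto)
      then have g1: "2 * y\<^sup>2 \<le> 1 - \<phi> s" using one_minus by simp
      have "2 * (y\<^sup>2 * 1) \<le> 2 * ((1 - \<tau> s)\<^sup>2 * (1 + 2 * \<tau> s))"
      proof (intro mult_left_mono mult_mono)
        show "y\<^sup>2 \<le> (1 - \<tau> s)\<^sup>2" unfolding y_def using t by (intro power_mono) (auto simp: mult_left_le_one_le)
      qed (use t in auto)
      then have g2: "2 * y\<^sup>2 \<le> 1 + \<phi> s" using one_plus by simp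
      have gain: "\<bar>\<phi> s\<bar> \<le> 1 - 2 * y\<^sup>2" using g1 g2 by (simp add: abs_if)
      then show "\<bar>\<phi> s\<bar> \<le> 1" using zero_le_power2[of y] by linarith
      have loss: "\<phi> s \<le> s / R + 2 * L * y / (r * R) * s"
      proof (cases "\<tau> s \<le> 1 / 2")
        case True
        have "\<phi> s \<le> 1" using g1 zero_le_power2[of y] by linarith
        moreover have "1 \<le> s / R + 2 * L * y / (r * R) * s"
        proof -
          have "\<tau> s * (1 / 2) \<le> y" unfolding y_def using True t by (intro mult_left_mono) auto
          then have "R - s \<le> 2 * L * y" using L by (simp add: \<tau>_def field_simps)
          moreover have "2 * L * y * 1 \<le> 2 * L * y * (s / r)" using s rR L y0 by (intro mult_left_mono) auto
          ultimately have "R - s \<le> 2 * L * y * (s / r)" by simp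
          then have "1 * R \<le> s + 2 * L * y * (s / r)" by linarith
          then have "1 \<le> (s + 2 * L * y * (s / r)) / R" using rR by (subst pos_le_divide_eq) auto
          also have "\<dots> = s / R + 2 * L * y / (r * R) * s" using rR by (simp add: field_simps)
          finally show ?thesis .
        qed
        ultimately show ?thesis by linarith
      next
        case False
        have "0 \<le> (2 * \<tau> s - 1) * (1 + 2 * \<tau> s - 2 * (\<tau> s)\<^sup>2)"
        proof (intro mult_nonneg_nonneg)
          have "\<tau> s * \<tau> s \<le> \<tau> s" using t by (simp add: mult_left_le)
          then show "0 \<le> 1 + 2 * \<tau> s - 2 * (\<tau> s)\<^sup>2" unfolding power2_eq_square by linarith
        qed (use False in simp)
        then have "\<phi> s \<le> 0" by (simp add: \<phi>_def algebra_simps power2_eq_square power3_eq_cube)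
        moreover have "0 \<le> s / R + 2 * L * y / (r * R) * s" using s0 rR L y0 by simp
        ultimately show ?thesis by linarith
      qed
      define \<gamma> where "\<gamma> = \<beta> powr (p - 2)"
      have \<gamma>: "0 \<le> \<gamma>" "\<beta> powr (p - 1) = \<gamma> * \<beta>" "\<beta> powr p = \<gamma> * \<beta>\<^sup>2"
        using \<beta> by (auto simp: \<gamma>_def powr_diff power2_eq_square powr_numeral field_simps)
      have sq: "A * (\<beta> * y) - 2 * (p - 1) * (\<beta> * y)\<^sup>2 \<le> K"
      proof -
        have "0 \<le> (A - 4 * (p - 1) * (\<beta> * y))\<^sup>2" by simp
        then have "8 * (p - 1) * (A * (\<beta> * y) - 2 * (p - 1) * (\<beta> * y)\<^sup>2) \<le> A\<^sup>2"
          by (simp add: power2_eq_square algebra_simps)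
        then show ?thesis using p unfolding K_def by (simp add: pos_le_divide_eq mult.commute)
      qed
      have "\<beta> powr (p - 1) * (s * \<phi>' s + m * \<phi> s) + (p - 1) * \<beta> powr p * \<bar>\<phi> s\<bar> * s
        \<le> \<gamma> * \<beta> * (s * (12 * y / L) + m * (s / R + 2 * L * y / (r * R) * s)) + (p - 1) * (\<gamma> * \<beta>\<^sup>2) * (1 - 2 * y\<^sup>2) * s"
        unfolding \<gamma>(2,3) using \<gamma>(1) \<beta> m0 p s0 loss gain
        by (intro add_mono mult_left_mono mult_right_mono) (auto simp: \<phi>'_def y_def)
      also have "\<dots> = s * ((p - 1) * (\<gamma> * \<beta>\<^sup>2) + m / R * (\<gamma> * \<beta>) + \<gamma> * (A * (\<beta> * y) - 2 * (p - 1) * (\<beta> * y)\<^sup>2))"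
        by (simp add: A_def algebra_simps power2_eq_square add_divide_distrib)
      also have "\<dots> \<le> s * ((p - 1) * (\<gamma> * \<beta>\<^sup>2) + m / R * (\<gamma> * \<beta>) + \<gamma> * K)"
        using s0 \<gamma>(1) sq by (intro mult_left_mono add_left_mono) auto
      also have "\<dots> = C * s" unfolding C_def \<gamma>(2,3) by (simp add: \<gamma>_def algebra_simps)
      finally show "\<beta> powr (p - 1) * (s * \<phi>' s + real (DIM('a) - 1) * \<phi> s) + (p - 1) * \<beta> powr p * \<bar>\<phi> s\<bar> * s \<le> C * s"
        by (simp add: m_def)
    next
      show "\<phi> R = 1" by (simp add: \<phi>_def \<tau>_def)
      show "r = 0 \<or> \<phi> r = -1" using L by (simp add: \<phi>_def \<tau>_def L_def[symmetric])
    qed (use rR in auto)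
    also have "\<dots> = (\<integral>\<^sup>+x. ennreal (norm (Dw x) powr p + C * \<bar>w x\<bar> powr p) * indicator U x \<partial>lborel)"
      by (simp add: U)
    also have "\<dots> = (\<integral>\<^sup>+x. ennreal (norm (Dw x) powr p) \<partial>lebesgue_on U)
        + ennreal C * (\<integral>\<^sup>+x. ennreal (\<bar>w x\<bar> powr p) \<partial>lebesgue_on U)"
      by (rule energy_lebesgue_on[OF w Um C0])
    finally show ?thesis by (simp add: C_def m_def)
  qed
  show ?thesis by (rule that[OF K main])
qed

section \<open>Bounds for the Robin eigenvalue\<close>

lemma weak_gradient_has_weak_gradient:
  assumes "u \<in> sobolev_space \<Omega> p" shows "has_weak_gradient \<Omega> u (weak_gradient \<Omega> u)"
proof -
  have "\<exists>G. has_weak_gradient \<Omega> u G" using assms by (auto simp: sobolev_space_def)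
  then show ?thesis unfolding weak_gradient_def by (rule someI_ex)
qed

lemma weak_gradient_integrable:
  fixes u :: "'a::euclidean_space \<Rightarrow> real"
  assumes \<Omega>: "open \<Omega>" and u: "u \<in> sobolev_space \<Omega> p"
  shows "integrable (lebesgue_on \<Omega>) (\<lambda>x. norm (weak_gradient \<Omega> u x) powr p)"
proof -
  obtain G where G: "G \<in> Lp_space (lebesgue_on \<Omega>) p" "has_weak_gradient \<Omega> u G"
    using u by (auto simp: sobolev_space_def)
  note W = weak_gradient_has_weak_gradient[OF u]
  have [measurable]: "weak_gradient \<Omega> u \<in> borel_measurable (lebesgue_on \<Omega>)"
    by (rule has_weak_gradient_measurable[OF \<Omega> W])
  have eq: "AE x in lebesgue_on \<Omega>. norm (G x) powr p = norm (weak_gradient \<Omega> u x) powr p"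
    using weak_gradient_unique[OF \<Omega> G(2) W] by eventually_elim simp
  show ?thesis
  proof (rule integrable_cong_AE_imp[OF _ _ eq])
    show "integrable (lebesgue_on \<Omega>) (\<lambda>x. norm (G x) powr p)" using G(1) by (simp add: Lp_space_def)
  qed measurable
qed

text \<open>All three integrals are limits of the integrals of the \<open>C\<^sup>1\<close> functions that approximate \<open>u\<close>, its weak gradient
  and its trace.\<close>
lemma is_trace_inequality:
  fixes u g :: "'a::euclidean_space \<Rightarrow> real"
  assumes \<Omega>: "open \<Omega>" and p: "1 < p" and u: "u \<in> sobolev_space \<Omega> p" and g: "is_trace \<Omega> p u g"
    and ineq: "\<And>w Dw. C1_with_gradient UNIV w Dw \<Longrightarrow>
      ennreal \<alpha> * (\<integral>\<^sup>+x. ennreal (\<bar>w x\<bar> powr p) \<partial>surface_measure \<Omega>)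
      \<le> (\<integral>\<^sup>+x. ennreal (norm (Dw x) powr p) \<partial>lebesgue_on \<Omega>) + ennreal C * (\<integral>\<^sup>+x. ennreal (\<bar>w x\<bar> powr p) \<partial>lebesgue_on \<Omega>)"
  shows "ennreal \<alpha> * (\<integral>\<^sup>+x. ennreal (\<bar>g x\<bar> powr p) \<partial>surface_measure \<Omega>)
      \<le> (\<integral>\<^sup>+x. ennreal (norm (weak_gradient \<Omega> u x) powr p) \<partial>lebesgue_on \<Omega>)
        + ennreal C * (\<integral>\<^sup>+x. ennreal (\<bar>u x\<bar> powr p) \<partial>lebesgue_on \<Omega>)"
proof -
  obtain v Dv where v: "\<And>k. C1_with_gradient UNIV (v k) (Dv k)"
    "(\<lambda>k. \<integral>\<^sup>+x. ennreal (\<bar>v k x - u x\<bar> powr p) \<partial>lebesgue_on \<Omega>) \<longlonglongrightarrow> 0"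
    "(\<lambda>k. \<integral>\<^sup>+x. ennreal (norm (Dv k x - weak_gradient \<Omega> u x) powr p) \<partial>lebesgue_on \<Omega>) \<longlonglongrightarrow> 0"
    "(\<lambda>k. \<integral>\<^sup>+x. ennreal (\<bar>v k x - g x\<bar> powr p) \<partial>surface_measure \<Omega>) \<longlonglongrightarrow> 0"
    using g unfolding is_trace_def by blast
  note vm = C1_with_gradient_measurable(1,2)[OF v(1)]
  have um: "u \<in> borel_measurable (lebesgue_on \<Omega>)" using u by (simp add: sobolev_space_def Lp_space_def)
  have gm: "g \<in> borel_measurable (surface_measure \<Omega>)" using g by (simp add: is_trace_def Lp_space_def)
  have l1: "(\<lambda>k. \<integral>\<^sup>+x. ennreal (norm (v k x) powr p) \<partial>lebesgue_on \<Omega>) \<longlonglongrightarrow> (\<integral>\<^sup>+x. ennreal (norm (u x) powr p) \<partial>lebesgue_on \<Omega>)"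
    by (rule Lp_norm_tendsto[OF p um measurable_lebesgue_on_borel[OF vm(1)]]) (use v(2) in simp)
  have l2: "(\<lambda>k. \<integral>\<^sup>+x. ennreal (norm (Dv k x) powr p) \<partial>lebesgue_on \<Omega>) \<longlonglongrightarrow> (\<integral>\<^sup>+x. ennreal (norm (weak_gradient \<Omega> u x) powr p) \<partial>lebesgue_on \<Omega>)"
    by (rule Lp_norm_tendsto[OF p has_weak_gradient_measurable[OF \<Omega> weak_gradient_has_weak_gradient[OF u]]
          measurable_lebesgue_on_borel[OF vm(2)] v(3)])
  have l3: "(\<lambda>k. \<integral>\<^sup>+x. ennreal (norm (v k x) powr p) \<partial>surface_measure \<Omega>) \<longlonglongrightarrow> (\<integral>\<^sup>+x. ennreal (norm (g x) powr p) \<partial>surface_measure \<Omega>)"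
    by (rule Lp_norm_tendsto[OF p gm measurable_surface_measure[OF vm(1)]]) (use v(4) in simp)
  show ?thesis
  proof (rule tendsto_le[OF sequentially_bot])
    show "(\<lambda>k. ennreal \<alpha> * (\<integral>\<^sup>+x. ennreal (\<bar>v k x\<bar> powr p) \<partial>surface_measure \<Omega>))
      \<longlonglongrightarrow> ennreal \<alpha> * (\<integral>\<^sup>+x. ennreal (\<bar>g x\<bar> powr p) \<partial>surface_measure \<Omega>)"
      using l3 by (intro ennreal_tendsto_cmult) auto
    show "(\<lambda>k. (\<integral>\<^sup>+x. ennreal (norm (Dv k x) powr p) \<partial>lebesgue_on \<Omega>) + ennreal C * (\<integral>\<^sup>+x. ennreal (\<bar>v k x\<bar> powr p) \<partial>lebesgue_on \<Omega>))
      \<longlonglongrightarrow> (\<integral>\<^sup>+x. ennreal (norm (weak_gradient \<Omega> u x) powr p) \<partial>lebesgue_on \<Omega>) + ennreal C * (\<integral>\<^sup>+x. ennreal (\<bar>u x\<bar> powr p) \<partial>lebesgue_on \<Omega>)"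
      using l1 l2 by (intro tendsto_add ennreal_tendsto_cmult) auto
    show "\<forall>\<^sub>F k in sequentially. ennreal \<alpha> * (\<integral>\<^sup>+x. ennreal (\<bar>v k x\<bar> powr p) \<partial>surface_measure \<Omega>) \<le>
      (\<integral>\<^sup>+x. ennreal (norm (Dv k x) powr p) \<partial>lebesgue_on \<Omega>) + ennreal C * (\<integral>\<^sup>+x. ennreal (\<bar>v k x\<bar> powr p) \<partial>lebesgue_on \<Omega>)"
      by (intro always_eventually allI ineq v)
  qed
qed

text \<open>Functions without a trace have the default trace \<open>0\<close>, hence a nonnegative quotient.\<close>
lemma robin_Lambda_ge:
  fixes \<Omega> :: "'a::euclidean_space set"
  assumes \<Omega>: "open \<Omega>" and p: "1 < p" and \<alpha>: "0 \<le> \<alpha>" and C: "0 \<le> C"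
    and ineq: "\<And>w Dw. C1_with_gradient UNIV w Dw \<Longrightarrow>
      ennreal \<alpha> * (\<integral>\<^sup>+x. ennreal (\<bar>w x\<bar> powr p) \<partial>surface_measure \<Omega>)
      \<le> (\<integral>\<^sup>+x. ennreal (norm (Dw x) powr p) \<partial>lebesgue_on \<Omega>) + ennreal C * (\<integral>\<^sup>+x. ennreal (\<bar>w x\<bar> powr p) \<partial>lebesgue_on \<Omega>)"
  shows "ereal (- C) \<le> robin_Lambda \<Omega> p \<alpha>"
  unfolding robin_Lambda_def
proof (rule INF_greatest)
  fix u assume "u \<in> {u \<in> sobolev_space \<Omega> p. \<not> (AE x in lebesgue_on \<Omega>. u x = 0)}"
  then have u: "u \<in> sobolev_space \<Omega> p" by simp
  define X where "X = (LINT x|lebesgue_on \<Omega>. \<bar>u x\<bar> powr p)"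
  define D where "D = (LINT x|lebesgue_on \<Omega>. norm (weak_gradient \<Omega> u x) powr p)"
  define T where "T = (LINT x|surface_measure \<Omega>. \<bar>boundary_trace \<Omega> p u x\<bar> powr p)"
  have X0: "0 \<le> X" and D0: "0 \<le> D" and T0: "0 \<le> T" by (auto simp: X_def D_def T_def)
  have X: "(\<integral>\<^sup>+x. ennreal (\<bar>u x\<bar> powr p) \<partial>lebesgue_on \<Omega>) = ennreal X"
    unfolding X_def using u by (intro nn_integral_eq_integral) (auto simp: sobolev_space_def Lp_space_def)
  have D: "(\<integral>\<^sup>+x. ennreal (norm (weak_gradient \<Omega> u x) powr p) \<partial>lebesgue_on \<Omega>) = ennreal D"
    unfolding D_def using weak_gradient_integrable[OF \<Omega> u] by (intro nn_integral_eq_integral) auto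
  have "\<alpha> * T \<le> D + C * X"
  proof (cases "\<exists>g. is_trace \<Omega> p u g")
    case True
    then have tr: "is_trace \<Omega> p u (boundary_trace \<Omega> p u)"
      unfolding boundary_trace_def by (simp add: someI_ex)
    have "(\<integral>\<^sup>+x. ennreal (\<bar>boundary_trace \<Omega> p u x\<bar> powr p) \<partial>surface_measure \<Omega>) = ennreal T"
      unfolding T_def using tr by (intro nn_integral_eq_integral) (auto simp: is_trace_def Lp_space_def)
    then have "ennreal \<alpha> * ennreal T \<le> ennreal D + ennreal C * ennreal X"
      using is_trace_inequality[OF \<Omega> p u tr ineq] by (simp add: X D)
    then show ?thesis
      using \<alpha> C X0 D0 T0 by (simp flip: ennreal_mult ennreal_plus)
  next
    case False
    then have "T = 0" by (simp add: T_def boundary_trace_def)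
    then show ?thesis using D0 C X0 by simp
  qed
  then have "- C * X \<le> D - \<alpha> * T" by simp
  then have "- C \<le> (D - \<alpha> * T) / X"
    using X0 C by (cases "X = 0") (auto simp: pos_le_divide_eq)
  then show "ereal (- C) \<le> ereal (robin_quotient \<Omega> p \<alpha> u)"
    by (simp add: robin_quotient_def X_def D_def T_def)
qed

lemma integrable_lebesgue_on_bounded:
  fixes f :: "'a::euclidean_space \<Rightarrow> 'b::euclidean_space"
  assumes f: "continuous_on UNIV f" and \<Omega>: "bounded \<Omega>" "\<Omega> \<in> sets borel"
  shows "integrable (lebesgue_on \<Omega>) f"
proof -
  obtain K where K: "compact K" "\<Omega> \<subseteq> K"
    using compact_closure[of \<Omega>] \<Omega>(1) closure_subset by blast
  have [measurable]: "f \<in> borel_measurable borel" "\<Omega> \<in> sets borel"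
    using f \<Omega> by (auto simp: borel_measurable_continuous_onI)
  have "integrable lborel (\<lambda>x. indicator K x *\<^sub>R f x)"
    by (rule borel_integrable_compact) (use f K in \<open>auto intro: continuous_on_subset\<close>)
  then have "integrable lborel (\<lambda>x. indicator \<Omega> x *\<^sub>R (indicator K x *\<^sub>R f x))"
    by (rule integrable_mult_indicator[rotated]) simp
  also have "(\<lambda>x. indicator \<Omega> x *\<^sub>R (indicator K x *\<^sub>R f x)) = (\<lambda>x. indicator \<Omega> x *\<^sub>R f x)"
    using K(2) by (auto simp: fun_eq_iff indicator_def)
  finally show ?thesis
    by (subst integrable_restrict_space) (auto simp: integrable_completion)
qed

lemma C1_in_sobolev_space:
  fixes u :: "'a::euclidean_space \<Rightarrow> real"
  assumes \<Omega>: "open \<Omega>" "bounded \<Omega>" and p: "1 < p" and u: "C1_with_gradient UNIV u Du"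
  shows "u \<in> sobolev_space \<Omega> p"
    and "integrable (lebesgue_on \<Omega>) (\<lambda>x. \<bar>u x\<bar> powr p)" "integrable (lebesgue_on \<Omega>) (\<lambda>x. norm (Du x) powr p)"
    and "AE x in lebesgue_on \<Omega>. weak_gradient \<Omega> u x = Du x"
proof -
  note m = C1_with_gradient_measurable[OF u]
  have c: "continuous_on UNIV (\<lambda>x. norm (f x) powr p)" if "continuous_on UNIV f" for f :: "'a \<Rightarrow> 'b::euclidean_space"
    by (rule continuous_on_powr') (use that p in \<open>auto intro!: continuous_intros\<close>)
  show i: "integrable (lebesgue_on \<Omega>) (\<lambda>x. \<bar>u x\<bar> powr p)" "integrable (lebesgue_on \<Omega>) (\<lambda>x. norm (Du x) powr p)"
    using c[OF m(3)] c[OF m(4)] \<Omega> by (auto intro!: integrable_lebesgue_on_bounded)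
  have w: "has_weak_gradient \<Omega> u Du" by (rule has_weak_gradient_C1[OF \<Omega>(1) u])
  then show s: "u \<in> sobolev_space \<Omega> p"
    unfolding sobolev_space_def Lp_space_def using i m(1,2) by (auto intro!: measurable_lebesgue_on_borel)
  show "AE x in lebesgue_on \<Omega>. weak_gradient \<Omega> u x = Du x"
    by (rule weak_gradient_unique[OF \<Omega>(1) weak_gradient_has_weak_gradient[OF s] w])
qed

text \<open>By the trace inequality, every admissible trace of a \<open>C\<^sup>1\<close> function on a ball has the same
  \<open>L\<^sup>p\<close> norm as its restriction to the sphere.\<close>
lemma boundary_trace_C1_ball:
  fixes u :: "'a::euclidean_space \<Rightarrow> real"
  assumes dim: "2 \<le> DIM('a)" and p: "1 < p" and \<rho>: "0 < \<rho>" and u: "C1_with_gradient UNIV u Du"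
    and fin: "(\<integral>\<^sup>+x. ennreal (\<bar>u x\<bar> powr p) \<partial>surface_measure (ball z \<rho>)) < top"
  shows "ennreal (LINT x|surface_measure (ball z \<rho>). \<bar>boundary_trace (ball z \<rho>) p u x\<bar> powr p)
    = (\<integral>\<^sup>+x. ennreal (\<bar>u x\<bar> powr p) \<partial>surface_measure (ball z \<rho>))"
proof -
  let ?B = "ball z \<rho>"
  note C1 = C1_in_sobolev_space[OF open_ball bounded_ball p u, of z \<rho>]
  note m = C1_with_gradient_measurable[OF u]
  have AE0: "AE x in lebesgue_on ?B. norm (Du x - weak_gradient ?B u x) powr p = 0"
    using C1(4) by eventually_elim simp
  have "is_trace ?B p u u"
    unfolding is_trace_def
  proof (intro conjI exI[of _ "\<lambda>_. u"] exI[of _ "\<lambda>_. Du"] allI u)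
    have "integrable (surface_measure ?B) (\<lambda>x. \<bar>u x\<bar> powr p)"
      using m(1) fin by (intro integrableI_nonneg measurable_surface_measure) auto
    then show "u \<in> Lp_space (surface_measure ?B) p"
      using m(1) by (auto simp: Lp_space_def intro!: measurable_surface_measure)
    have "(\<integral>\<^sup>+x. ennreal (norm (Du x - weak_gradient ?B u x) powr p) \<partial>lebesgue_on ?B) = (\<integral>\<^sup>+x. 0 \<partial>lebesgue_on ?B)"
      using AE0 by (intro nn_integral_cong_AE) (auto elim!: eventually_mono)
    then show "(\<lambda>k. \<integral>\<^sup>+x. ennreal (norm (Du x - weak_gradient ?B u x) powr p) \<partial>lebesgue_on ?B) \<longlonglongrightarrow> 0"
      by simp
  qed auto
  then have "\<exists>g. is_trace ?B p u g" by blast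
  then have tr: "is_trace ?B p u (boundary_trace ?B p u)"
    unfolding boundary_trace_def by (simp add: someI_ex)
  define g where "g = boundary_trace ?B p u"
  have g: "g \<in> Lp_space (surface_measure ?B) p" using tr by (simp add: is_trace_def g_def)
  then have gm: "g \<in> borel_measurable (surface_measure ?B)" by (simp add: Lp_space_def)
  obtain v Dv where v: "\<And>k. C1_with_gradient UNIV (v k) (Dv k)"
    "(\<lambda>k. \<integral>\<^sup>+x. ennreal (\<bar>v k x - u x\<bar> powr p) \<partial>lebesgue_on ?B) \<longlonglongrightarrow> 0"
    "(\<lambda>k. \<integral>\<^sup>+x. ennreal (norm (Dv k x - weak_gradient ?B u x) powr p) \<partial>lebesgue_on ?B) \<longlonglongrightarrow> 0"
    "(\<lambda>k. \<integral>\<^sup>+x. ennreal (\<bar>v k x - g x\<bar> powr p) \<partial>surface_measure ?B) \<longlonglongrightarrow> 0"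
    using tr unfolding is_trace_def g_def by blast
  note vm = C1_with_gradient_measurable(1,2)[OF v(1)]
  let ?C = "ennreal (real DIM('a) / \<rho> + p - 1)"
  have l3: "(\<lambda>k. \<integral>\<^sup>+x. ennreal (norm (v k x) powr p) \<partial>surface_measure ?B) \<longlonglongrightarrow> (\<integral>\<^sup>+x. ennreal (norm (g x) powr p) \<partial>surface_measure ?B)"
    by (rule Lp_norm_tendsto[OF p gm measurable_surface_measure[OF vm(1)]]) (use v(4) in simp)
  have e: "(\<integral>\<^sup>+x. ennreal (norm (Dv k x - Du x) powr p) \<partial>lebesgue_on ?B)
      = (\<integral>\<^sup>+x. ennreal (norm (Dv k x - weak_gradient ?B u x) powr p) \<partial>lebesgue_on ?B)" for k
    using C1(4) by (intro nn_integral_cong_AE) (auto elim!: eventually_mono)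
  have "(\<lambda>k. \<integral>\<^sup>+x. ennreal (norm (v k x - u x) powr p) \<partial>surface_measure ?B) \<longlonglongrightarrow> 0"
  proof (rule tendsto_sandwich[OF _ _ tendsto_const])
    show "\<forall>\<^sub>F k in sequentially. (\<integral>\<^sup>+x. ennreal (norm (v k x - u x) powr p) \<partial>surface_measure ?B)
      \<le> (\<integral>\<^sup>+x. ennreal (norm (Dv k x - Du x) powr p) \<partial>lebesgue_on ?B) + ?C * (\<integral>\<^sup>+x. ennreal (\<bar>v k x - u x\<bar> powr p) \<partial>lebesgue_on ?B)"
      using ball_trace_inequality[OF dim C1_with_gradient_diff[OF v(1) u] p \<rho>, where z=z] by simp
    have "(\<lambda>k. (\<integral>\<^sup>+x. ennreal (norm (Dv k x - Du x) powr p) \<partial>lebesgue_on ?B) + ?C * (\<integral>\<^sup>+x. ennreal (\<bar>v k x - u x\<bar> powr p) \<partial>lebesgue_on ?B))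
      \<longlonglongrightarrow> 0 + ?C * 0"
      unfolding e by (intro tendsto_add v ennreal_tendsto_cmult) auto
    then show "(\<lambda>k. (\<integral>\<^sup>+x. ennreal (norm (Dv k x - Du x) powr p) \<partial>lebesgue_on ?B) + ?C * (\<integral>\<^sup>+x. ennreal (\<bar>v k x - u x\<bar> powr p) \<partial>lebesgue_on ?B))
      \<longlonglongrightarrow> 0" by simp
  qed simp
  then have l4: "(\<lambda>k. \<integral>\<^sup>+x. ennreal (norm (v k x) powr p) \<partial>surface_measure ?B) \<longlonglongrightarrow> (\<integral>\<^sup>+x. ennreal (norm (u x) powr p) \<partial>surface_measure ?B)"
    by (rule Lp_norm_tendsto[OF p measurable_surface_measure[OF m(1)] measurable_surface_measure[OF vm(1)]])
  have "(\<integral>\<^sup>+x. ennreal (norm (g x) powr p) \<partial>surface_measure ?B) = (\<integral>\<^sup>+x. ennreal (norm (u x) powr p) \<partial>surface_measure ?B)"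
    by (rule LIMSEQ_unique[OF l3 l4])
  moreover have "(\<integral>\<^sup>+x. ennreal (norm (g x) powr p) \<partial>surface_measure ?B) = ennreal (LINT x|surface_measure ?B. norm (g x) powr p)"
    using g by (intro nn_integral_eq_integral) (auto simp: Lp_space_def)
  ultimately show ?thesis by (simp add: g_def)
qed

lemma nn_integral_radial_ball:
  fixes z :: "'a::euclidean_space" and f :: "real \<Rightarrow> ennreal"
  assumes [measurable]: "f \<in> borel_measurable borel"
  shows "(\<integral>\<^sup>+x. f (norm (x - z)) \<partial>lebesgue_on (ball z \<rho>))
    = emeasure sphere_measure (UNIV :: 'a set) *
      (\<integral>\<^sup>+s. ennreal (\<bar>s\<bar> ^ (DIM('a) - 1)) * f s * indicator {0<..<\<rho>} s \<partial>lborel)"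
proof -
  define I where "I = (\<integral>\<^sup>+s. ennreal (\<bar>s\<bar> ^ (DIM('a) - 1)) * f s * indicator {0<..<\<rho>} s \<partial>lborel)"
  have meas: "(\<lambda>x. f (norm (x - z)) * indicator (ball z \<rho>) x) \<in> borel_measurable borel"
  proof -
    have [measurable]: "ball z \<rho> \<in> sets borel" by simp
    show ?thesis by measurable
  qed
  have "(\<integral>\<^sup>+x. f (norm (x - z)) \<partial>lebesgue_on (ball z \<rho>)) = (\<integral>\<^sup>+x. f (norm (x - z)) * indicator (ball z \<rho>) x \<partial>lborel)"
    by (rule nn_integral_lebesgue_on) simp
  also have "\<dots> = (\<integral>\<^sup>+x. f (norm (x - z)) * indicator (ball z \<rho>) x \<partial>distr lborel borel ((+) z))"
    by (simp add: lborel_distr_plus)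
  also have "\<dots> = (\<integral>\<^sup>+x. f (norm (z + x - z)) * indicator (ball z \<rho>) (z + x) \<partial>lborel)"
    by (subst nn_integral_distr) (auto intro: meas)
  also have "\<dots> = (\<integral>\<^sup>+x. f (norm x) * indicator {x. norm x < \<rho>} x \<partial>(lborel :: 'a measure))"
    by (intro nn_integral_cong) (auto simp: indicator_def dist_norm)
  also have "\<dots> = (\<integral>\<^sup>+\<omega>. \<integral>\<^sup>+s. ennreal (\<bar>s\<bar> ^ (DIM('a) - 1)) * indicator {0<..} s *
      (f (norm (s *\<^sub>R \<omega>)) * indicator {x. norm x < \<rho>} (s *\<^sub>R \<omega>)) \<partial>lborel \<partial>(sphere_measure :: 'a measure))"
    by (rule nn_integral_polar) measurable
  also have "\<dots> = (\<integral>\<^sup>+\<omega>. I \<partial>(sphere_measure :: 'a measure))"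
  proof (rule nn_integral_cong_AE)
    have "AE \<omega> in sphere_measure. \<omega> \<in> sphere (0::'a) 1"
      using sphere_measure_null[where 'a='a] by (intro AE_I[of _ _ "- sphere 0 1"]) auto
    then show "AE \<omega> in sphere_measure. (\<integral>\<^sup>+s. ennreal (\<bar>s\<bar> ^ (DIM('a) - 1)) * indicator {0<..} s *
      (f (norm (s *\<^sub>R \<omega>)) * indicator {x. norm x < \<rho>} (s *\<^sub>R (\<omega>::'a))) \<partial>lborel) = I"
      unfolding I_def by eventually_elim (intro nn_integral_cong, auto simp: indicator_def)
  qed
  finally show ?thesis by (simp add: I_def mult.commute)
qed

text \<open>The boundary term dominates the volume term, as
  \<open>(s\<^sup>n\<^sup>-\<^sup>1 e\<^sup>c\<^sup>s)' = (c + (n-1)/s) s\<^sup>n\<^sup>-\<^sup>1 e\<^sup>c\<^sup>s\<close> and \<open>1/s \<ge> 1/\<rho>\<close>.\<close>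
lemma radial_exp_integral_le:
  fixes c \<rho> :: real
  assumes n: "2 \<le> n" and c: "0 < c" and \<rho>: "0 < \<rho>"
  shows "ennreal (c + real (n - 1) / \<rho>) * (\<integral>\<^sup>+s. ennreal (\<bar>s\<bar> ^ (n - 1)) * ennreal (exp (c * s)) * indicator {0<..<\<rho>} s \<partial>lborel)
    \<le> ennreal (\<rho> ^ (n - 1) * exp (c * \<rho>))"
proof -
  have k0: "0 \<le> c + real (n - 1) / \<rho>" using c \<rho> by simp
  have "ennreal (c + real (n - 1) / \<rho>) * (\<integral>\<^sup>+s. ennreal (\<bar>s\<bar> ^ (n - 1)) * ennreal (exp (c * s)) * indicator {0<..<\<rho>} s \<partial>lborel)
    = (\<integral>\<^sup>+s. ennreal ((c + real (n - 1) / \<rho>) * (\<bar>s\<bar> ^ (n - 1) * exp (c * s))) * indicator {0<..<\<rho>} s \<partial>lborel)"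
    using k0 by (subst nn_integral_cmult[symmetric]) (auto simp: ennreal_mult mult.assoc intro!: nn_integral_cong)
  also have "\<dots> \<le> (\<integral>\<^sup>+s. ennreal (real (n - 1) * s ^ (n - 2) * exp (c * s) + s ^ (n - 1) * (c * exp (c * s))) * indicator {0..\<rho>} s \<partial>lborel)"
  proof (rule nn_integral_mono)
    fix s
    show "ennreal ((c + real (n - 1) / \<rho>) * (\<bar>s\<bar> ^ (n - 1) * exp (c * s))) * indicator {0<..<\<rho>} s
      \<le> ennreal (real (n - 1) * s ^ (n - 2) * exp (c * s) + s ^ (n - 1) * (c * exp (c * s))) * indicator {0..\<rho>} s"
    proof (cases "s \<in> {0<..<\<rho>}")
      case True
      have "n - 1 = Suc (n - 2)" using n by simp
      then have pw: "s ^ (n - 1) = s * s ^ (n - 2)" by (metis power_Suc)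
      have spos: "0 < s" using True by simp
      have "s / \<rho> \<le> 1" using True by simp
      then have "real (n - 1) * (s ^ (n - 2) * exp (c * s)) * (s / \<rho>) \<le> real (n - 1) * (s ^ (n - 2) * exp (c * s)) * 1"
        using True by (intro mult_left_mono) auto
      then have "(c + real (n - 1) / \<rho>) * (\<bar>s\<bar> ^ (n - 1) * exp (c * s))
          \<le> real (n - 1) * s ^ (n - 2) * exp (c * s) + s ^ (n - 1) * (c * exp (c * s))"
        unfolding abs_of_pos[OF spos] pw by (simp add: algebra_simps)
      then show ?thesis using True by (simp add: ennreal_leI)
    qed simp
  qed
  also have "\<dots> = ennreal (\<rho> ^ (n - 1) * exp (c * \<rho>) - 0 ^ (n - 1) * exp (c * 0))"
  proof (rule nn_integral_FTC_Icc)
    fix s assume s: "s \<in> {0..\<rho>}"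
    have "n - 1 - Suc 0 = n - 2" by simp
    then show "((\<lambda>s. s ^ (n - 1) * exp (c * s)) has_real_derivative
        real (n - 1) * s ^ (n - 2) * exp (c * s) + s ^ (n - 1) * (c * exp (c * s))) (at s)"
      by (auto intro!: derivative_eq_intros simp: algebra_simps numeral_2_eq_2)
    show "0 \<le> real (n - 1) * s ^ (n - 2) * exp (c * s) + s ^ (n - 1) * (c * exp (c * s))"
      using s c by simp
  qed (use \<rho> in auto)
  finally show ?thesis using n by (simp add: power_0_left)
qed

definition exp_bump :: "'a::euclidean_space \<Rightarrow> real \<Rightarrow> real \<Rightarrow> 'a \<Rightarrow> real" where
  "exp_bump z \<beta> \<epsilon> x = exp (\<beta> * sqrt ((norm (x - z))\<^sup>2 + \<epsilon>\<^sup>2))"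

lemma C1_exp_bump:
  fixes z :: "'a::euclidean_space"
  assumes \<beta>: "0 < \<beta>" and \<epsilon>: "0 < \<epsilon>"
  obtains D where "C1_with_gradient UNIV (exp_bump z \<beta> \<epsilon>) D" "\<And>x. norm (D x) \<le> \<beta> * exp_bump z \<beta> \<epsilon> x"
proof -
  define q where "q x = (norm (x - z))\<^sup>2 + \<epsilon>\<^sup>2" for x :: 'a
  have q: "0 < q x" for x using \<epsilon> by (simp add: q_def add_nonneg_pos)
  define D where "D x = (exp_bump z \<beta> \<epsilon> x * (\<beta> / sqrt (q x))) *\<^sub>R (x - z)" for x
  have dq: "GDERIV q x :> 2 *\<^sub>R (x - z)" for x
    unfolding q_def[abs_def] gderiv_def power2_norm_eq_inner
    by (auto intro!: derivative_eq_intros simp: inner_commute algebra_simps)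
  have "GDERIV (exp_bump z \<beta> \<epsilon>) x :> D x" for x
  proof -
    have "((\<lambda>t. exp (\<beta> * sqrt t)) has_real_derivative exp (\<beta> * sqrt (q x)) * (\<beta> * (inverse (sqrt (q x)) / 2))) (at (q x))"
      using q[of x] by (auto intro!: derivative_eq_intros)
    then have "GDERIV (\<lambda>x. exp (\<beta> * sqrt (q x))) x :> (exp (\<beta> * sqrt (q x)) * (\<beta> * (inverse (sqrt (q x)) / 2))) *\<^sub>R (2 *\<^sub>R (x - z))"
      by (rule GDERIV_DERIV_compose[OF dq])
    moreover have "(exp (\<beta> * sqrt (q x)) * (\<beta> * (inverse (sqrt (q x)) / 2))) *\<^sub>R (2 *\<^sub>R (x - z)) = D x"
    proof -
      have gen: "(e * (\<beta> * (i / 2))) *\<^sub>R (2 *\<^sub>R v) = (e * (\<beta> * i)) *\<^sub>R v" for e i :: real and v :: 'a by simp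
      show ?thesis by (subst gen) (simp only: D_def exp_bump_def q_def divide_inverse)
    qed
    moreover have "(\<lambda>x. exp (\<beta> * sqrt (q x))) = exp_bump z \<beta> \<epsilon>"
      by (simp add: exp_bump_def[abs_def] q_def)
    ultimately show ?thesis by simp
  qed
  moreover have "continuous_on UNIV D"
    unfolding D_def exp_bump_def q_def using \<epsilon>
    by (intro continuous_intros) (auto simp: add_nonneg_eq_0_iff)
  moreover have "norm (D x) \<le> \<beta> * exp_bump z \<beta> \<epsilon> x" for x
  proof -
    have "norm (x - z) \<le> sqrt (q x)" unfolding q_def by (rule real_le_rsqrt) simp
    then have "norm (x - z) / sqrt (q x) \<le> 1" using q[of x] by simp
    then have "exp_bump z \<beta> \<epsilon> x * \<beta> * (norm (x - z) / sqrt (q x)) \<le> exp_bump z \<beta> \<epsilon> x * \<beta> * 1"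
      using \<beta> by (intro mult_left_mono) (auto simp: exp_bump_def)
    then show ?thesis using \<beta> q[of x] by (simp add: D_def exp_bump_def mult_ac)
  qed
  ultimately show ?thesis by (intro that[of D]) (auto simp: C1_with_gradient_def)
qed

text \<open>The exponential profile \<open>e\<^sup>\<beta>\<^sup>s\<close> is optimal up to lower order on the ball; replacing the distance by
  \<open>sqrt (s\<^sup>2 + \<epsilon>\<^sup>2)\<close> makes it differentiable at the centre at the expense of a factor tending to \<open>1\<close>.\<close>
lemma robin_Lambda_ball_le:
  fixes z :: "'a::euclidean_space"
  assumes dim: "2 \<le> DIM('a)" and p: "1 < p" and \<rho>: "0 < \<rho>" and \<beta>: "0 < \<beta>" and \<epsilon>: "0 < \<epsilon>" and \<alpha>: "0 \<le> \<alpha>"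
  shows "robin_Lambda (ball z \<rho>) p \<alpha>
    \<le> ereal (\<beta> powr p - \<alpha> * exp (- (p * \<beta> * \<epsilon>)) * (p * \<beta> + real (DIM('a) - 1) / \<rho>))"
proof -
  let ?B = "ball z \<rho>" and ?n = "DIM('a)"
  define u where "u = exp_bump z \<beta> \<epsilon>"
  obtain Du where Du: "C1_with_gradient UNIV u Du" "\<And>x. norm (Du x) \<le> \<beta> * u x"
    using C1_exp_bump[OF \<beta> \<epsilon>, of z] unfolding u_def by metis
  note C1 = C1_in_sobolev_space[OF open_ball bounded_ball p Du(1), of z \<rho>]
  have upos: "0 < u x" for x by (simp add: u_def exp_bump_def)
  define S where "S = measure sphere_measure (UNIV :: 'a set)"
  have S: "emeasure sphere_measure (UNIV :: 'a set) = ennreal S" "0 \<le> S"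
    unfolding S_def using sphere_measure_finite[of "UNIV :: 'a set"] by (auto simp: emeasure_eq_ennreal_measure less_top)
  define E where "E = \<rho> ^ (?n - 1) * exp (\<beta> * sqrt (\<rho>\<^sup>2 + \<epsilon>\<^sup>2)) powr p * S"
  have surf: "(\<integral>\<^sup>+x. ennreal (\<bar>u x\<bar> powr p) \<partial>surface_measure ?B) = ennreal E"
  proof -
    have "(\<integral>\<^sup>+x. ennreal (\<bar>u x\<bar> powr p) \<partial>surface_measure ?B)
        = ennreal (\<rho> ^ (?n - 1)) * (\<integral>\<^sup>+\<omega>. ennreal (\<bar>u (z + \<rho> *\<^sub>R \<omega>)\<bar> powr p) \<partial>sphere_measure)"
      using C1_with_gradient_measurable(1)[OF Du(1)] by (intro surface_integral_ball dim \<rho>) measurable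
    also have "(\<integral>\<^sup>+\<omega>. ennreal (\<bar>u (z + \<rho> *\<^sub>R \<omega>)\<bar> powr p) \<partial>sphere_measure)
        = (\<integral>\<^sup>+\<omega>. ennreal (exp (\<beta> * sqrt (\<rho>\<^sup>2 + \<epsilon>\<^sup>2)) powr p) \<partial>(sphere_measure :: 'a measure))"
    proof (rule nn_integral_cong_AE)
      have "AE \<omega> in sphere_measure. \<omega> \<in> sphere (0::'a) 1"
        using sphere_measure_null[where 'a='a] by (intro AE_I[of _ _ "- sphere 0 1"]) auto
      then show "AE \<omega> in sphere_measure. ennreal (\<bar>u (z + \<rho> *\<^sub>R \<omega>)\<bar> powr p) = ennreal (exp (\<beta> * sqrt (\<rho>\<^sup>2 + \<epsilon>\<^sup>2)) powr p)"
        by eventually_elim (use \<rho> in \<open>auto simp: u_def exp_bump_def power_mult_distrib\<close>)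
    qed
    finally show ?thesis
      using S \<rho> by (simp add: E_def ennreal_mult mult.assoc)
  qed
  have T: "(LINT x|surface_measure ?B. \<bar>boundary_trace ?B p u x\<bar> powr p) = E"
    using boundary_trace_C1_ball[OF dim p \<rho> Du(1), of z] S \<rho> by (simp add: surf) (simp add: E_def)
  define X where "X = (LINT x|lebesgue_on ?B. \<bar>u x\<bar> powr p)"
  have X: "(\<integral>\<^sup>+x. ennreal (\<bar>u x\<bar> powr p) \<partial>lebesgue_on ?B) = ennreal X"
    unfolding X_def using C1(2) by (intro nn_integral_eq_integral) auto
  have not0: "\<not> (AE x in lebesgue_on ?B. u x = 0)"
  proof
    assume "AE x in lebesgue_on ?B. u x = 0"
    then have "AE x in lebesgue_on ?B. False" by eventually_elim (use upos in \<open>metis less_irrefl\<close>)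
    then have "emeasure (lebesgue_on ?B) (space (lebesgue_on ?B)) = 0"
      by (simp only: ae_filter_eq_bot_iff[symmetric] trivial_limit_def)
    moreover have "emeasure (lebesgue_on ?B) (space (lebesgue_on ?B)) = ennreal (unit_ball_vol (real ?n) * \<rho> ^ ?n)"
      using \<rho> by (simp add: emeasure_restrict_space emeasure_ball)
    moreover have "0 < unit_ball_vol (real ?n) * \<rho> ^ ?n" using \<rho> unit_ball_vol_pos[of "real ?n"] by simp
    ultimately show False by (metis ennreal_eq_0_iff not_le)
  qed
  have Xpos: "0 < X"
  proof -
    have "X \<noteq> 0"
    proof
      assume "X = 0"
      then have "AE x in lebesgue_on ?B. \<bar>u x\<bar> powr p = 0"
        unfolding X_def using integral_nonneg_eq_0_iff_AE[OF C1(2)] by simp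
      then have "AE x in lebesgue_on ?B. u x = 0" by eventually_elim simp
      with not0 show False by simp
    qed
    moreover have "0 \<le> X" by (simp add: X_def)
    ultimately show ?thesis by simp
  qed
  define \<kappa> where "\<kappa> = p * \<beta> + real (?n - 1) / \<rho>"
  have \<kappa>: "0 < \<kappa>" using p \<beta> \<rho> by (simp add: \<kappa>_def add_pos_nonneg)
  define I where "I = (\<integral>\<^sup>+s. ennreal (\<bar>s\<bar> ^ (?n - 1)) * ennreal (exp (p * \<beta> * s)) * indicator {0<..<\<rho>} s \<partial>lborel)"
  have EX: "exp (- (p * \<beta> * \<epsilon>)) * \<kappa> * X \<le> E"
  proof -
    have "ennreal X \<le> (\<integral>\<^sup>+x. ennreal (exp (p * \<beta> * \<epsilon>)) * ennreal (exp (p * \<beta> * norm (x - z))) \<partial>lebesgue_on ?B)"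
      unfolding X[symmetric]
    proof (rule nn_integral_mono)
      fix x
      have "sqrt ((norm (x - z))\<^sup>2 + \<epsilon>\<^sup>2) \<le> norm (x - z) + \<epsilon>"
        using sqrt_add_le_add_sqrt[of "(norm (x - z))\<^sup>2" "\<epsilon>\<^sup>2"] \<epsilon> by simp
      then have "p * (\<beta> * sqrt ((norm (x - z))\<^sup>2 + \<epsilon>\<^sup>2)) \<le> p * (\<beta> * (norm (x - z) + \<epsilon>))"
        using p \<beta> by (intro mult_left_mono) auto
      then have "\<bar>u x\<bar> powr p \<le> exp (p * \<beta> * \<epsilon>) * exp (p * \<beta> * norm (x - z))"
        by (simp add: u_def exp_bump_def powr_def exp_add[symmetric] algebra_simps)
      then show "ennreal (\<bar>u x\<bar> powr p) \<le> ennreal (exp (p * \<beta> * \<epsilon>)) * ennreal (exp (p * \<beta> * norm (x - z)))"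
        by (simp add: ennreal_leI flip: ennreal_mult)
    qed
    also have "\<dots> = ennreal (exp (p * \<beta> * \<epsilon>)) * (\<integral>\<^sup>+x. ennreal (exp (p * \<beta> * norm (x - z))) \<partial>lebesgue_on ?B)"
      by (intro nn_integral_cmult measurable_lebesgue_on_borel) measurable
    also have "(\<integral>\<^sup>+x. ennreal (exp (p * \<beta> * norm (x - z))) \<partial>lebesgue_on ?B) = ennreal S * I"
      using nn_integral_radial_ball[of "\<lambda>s. ennreal (exp (p * \<beta> * s))" z \<rho>] by (simp add: S I_def)
    finally have "ennreal \<kappa> * ennreal X \<le> ennreal \<kappa> * (ennreal (exp (p * \<beta> * \<epsilon>)) * (ennreal S * I))"
      by (rule mult_left_mono) simp
    also have "\<dots> = ennreal (exp (p * \<beta> * \<epsilon>)) * ennreal S * (ennreal \<kappa> * I)"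
      by (simp only: ac_simps)
    also have "\<dots> \<le> ennreal (exp (p * \<beta> * \<epsilon>)) * ennreal S * ennreal (\<rho> ^ (?n - 1) * exp (p * \<beta> * \<rho>))"
      unfolding I_def \<kappa>_def using p \<beta> by (intro mult_left_mono radial_exp_integral_le dim \<rho>) auto
    finally have "\<kappa> * X \<le> exp (p * \<beta> * \<epsilon>) * S * (\<rho> ^ (?n - 1) * exp (p * \<beta> * \<rho>))"
      using \<kappa> Xpos S \<rho> by (simp flip: ennreal_mult)
    also have "\<dots> \<le> exp (p * \<beta> * \<epsilon>) * E"
    proof -
      have "\<rho> \<le> sqrt (\<rho>\<^sup>2 + \<epsilon>\<^sup>2)" using \<rho> by (simp add: real_le_rsqrt)
      then have "p * (\<beta> * \<rho>) \<le> p * (\<beta> * sqrt (\<rho>\<^sup>2 + \<epsilon>\<^sup>2))" using p \<beta> by (intro mult_left_mono) auto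
      then have "exp (p * \<beta> * \<rho>) \<le> exp (\<beta> * sqrt (\<rho>\<^sup>2 + \<epsilon>\<^sup>2)) powr p" by (simp add: powr_def mult.assoc)
      then have "S * \<rho> ^ (?n - 1) * exp (p * \<beta> * \<rho>) \<le> S * \<rho> ^ (?n - 1) * exp (\<beta> * sqrt (\<rho>\<^sup>2 + \<epsilon>\<^sup>2)) powr p"
        using S \<rho> by (intro mult_left_mono) auto
      then have "exp (p * \<beta> * \<epsilon>) * (S * \<rho> ^ (?n - 1) * exp (p * \<beta> * \<rho>))
          \<le> exp (p * \<beta> * \<epsilon>) * (S * \<rho> ^ (?n - 1) * exp (\<beta> * sqrt (\<rho>\<^sup>2 + \<epsilon>\<^sup>2)) powr p)"
        by (rule mult_left_mono) simp
      then show ?thesis by (simp only: E_def mult_ac)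
    qed
    finally have "exp (- (p * \<beta> * \<epsilon>)) * (\<kappa> * X) \<le> exp (- (p * \<beta> * \<epsilon>)) * (exp (p * \<beta> * \<epsilon>) * E)"
      by (rule mult_left_mono) simp
    then show ?thesis by (simp add: mult.assoc[symmetric] exp_add[symmetric])
  qed
  have grad: "(LINT x|lebesgue_on ?B. norm (weak_gradient ?B u x) powr p) \<le> \<beta> powr p * X"
  proof -
    have "(LINT x|lebesgue_on ?B. norm (weak_gradient ?B u x) powr p) \<le> (LINT x|lebesgue_on ?B. \<beta> powr p * \<bar>u x\<bar> powr p)"
    proof (rule integral_mono_AE)
      show "integrable (lebesgue_on ?B) (\<lambda>x. norm (weak_gradient ?B u x) powr p)"
        by (rule weak_gradient_integrable[OF open_ball C1(1)])
      show "integrable (lebesgue_on ?B) (\<lambda>x. \<beta> powr p * \<bar>u x\<bar> powr p)" using C1(2) by simp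
      show "AE x in lebesgue_on ?B. norm (weak_gradient ?B u x) powr p \<le> \<beta> powr p * \<bar>u x\<bar> powr p"
        using C1(4)
      proof eventually_elim
        case (elim x)
        have "norm (Du x) powr p \<le> (\<beta> * u x) powr p" using Du(2) p by (intro powr_mono2) auto
        then show ?case using elim \<beta> upos[of x] by (simp add: powr_mult)
      qed
    qed
    then show ?thesis by (simp add: X_def)
  qed
  have "robin_quotient ?B p \<alpha> u \<le> (\<beta> powr p * X - \<alpha> * E) / X"
    unfolding robin_quotient_def T X_def[symmetric] using grad Xpos by (intro divide_right_mono) auto
  also have "\<dots> \<le> (\<beta> powr p * X - \<alpha> * (exp (- (p * \<beta> * \<epsilon>)) * \<kappa> * X)) / X"
    using EX \<alpha> Xpos by (intro divide_right_mono diff_left_mono mult_left_mono) auto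
  also have "\<dots> = \<beta> powr p - \<alpha> * exp (- (p * \<beta> * \<epsilon>)) * \<kappa>"
    using Xpos by (simp add: diff_divide_distrib)
  finally have "ereal (robin_quotient ?B p \<alpha> u) \<le> ereal (\<beta> powr p - \<alpha> * exp (- (p * \<beta> * \<epsilon>)) * \<kappa>)" by simp
  moreover have "robin_Lambda ?B p \<alpha> \<le> ereal (robin_quotient ?B p \<alpha> u)"
    unfolding robin_Lambda_def using C1(1) not0 by (intro INF_lower) auto
  ultimately show ?thesis unfolding \<kappa>_def by (rule order_trans[rotated])
qed

section \<open>Comparison of the ball and the shell\<close>

lemma shell_bounded_C1_domain:
  fixes U :: "'a::euclidean_space set"
  assumes dim: "2 \<le> DIM('a)" and U: "U = {x. r < norm x \<and> norm x < R}" and rR: "0 < r" "r < R"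
  shows "bounded_C1_domain U"
  unfolding bounded_C1_domain_def
proof (intro conjI ballI)
  show "open U" unfolding U by (intro open_Collect_conj open_Collect_less continuous_intros)
  show "connected U" unfolding U using connected_annulus(1)[OF dim, of r 0 R] by simp
  show "bounded U" unfolding U by (rule bounded_subset[OF bounded_ball[of 0 R]]) auto
  have "((r + R) / 2) *\<^sub>R (normal_axis::'a) \<in> U" using rR by (simp add: U)
  then show "U \<noteq> {}" by blast
  have grad: "GDERIV (\<lambda>y. c * (norm y)\<^sup>2 + d) x :> (2 * c) *\<^sub>R x" for c d :: real and x :: 'a
    unfolding gderiv_def power2_norm_eq_inner
    by (auto intro!: derivative_eq_intros simp: inner_commute algebra_simps)
  have C1: "C1_with_gradient N (\<lambda>y. c * (norm y)\<^sup>2 + d) (\<lambda>x. (2 * c) *\<^sub>R x)" for N :: "'a set" and c d :: real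
    unfolding C1_with_gradient_def using grad by (auto intro!: continuous_intros)
  have sq: "s\<^sup>2 < t\<^sup>2 \<longleftrightarrow> s < t" if "0 \<le> s" "0 \<le> t" for s t :: real
    using that power2_less_imp_less[of s t] power_strict_mono[of s t 2] by auto
  fix x assume "x \<in> frontier U"
  then have "norm x = r \<or> norm x = R" using frontier_shell[OF U rR] by auto
  then show "\<exists>N \<phi> D\<phi>. open N \<and> x \<in> N \<and> C1_with_gradient N \<phi> D\<phi> \<and>
      (\<forall>y\<in>N. D\<phi> y \<noteq> 0) \<and> U \<inter> N = {y \<in> N. \<phi> y < 0}"
  proof
    assume x: "norm x = r"
    define N where "N = {y::'a. 0 < norm y \<and> norm y < R}"
    have "open N" unfolding N_def by (intro open_Collect_conj open_Collect_less continuous_intros)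
    moreover have "U \<inter> N = {y \<in> N. (-1) * (norm y)\<^sup>2 + r\<^sup>2 < 0}"
      using rR by (auto simp: U N_def sq)
    ultimately show ?thesis
    proof (intro exI conjI ballI)
      show "C1_with_gradient N (\<lambda>y. (-1) * (norm y)\<^sup>2 + r\<^sup>2) (\<lambda>x. (2 * (-1)) *\<^sub>R x)" by (rule C1)
      show "x \<in> N" using x rR by (auto simp: N_def)
      show "(2 * (-1)) *\<^sub>R y \<noteq> 0" if "y \<in> N" for y using that by (auto simp: N_def)
    qed
  next
    assume x: "norm x = R"
    define N where "N = {y::'a. r < norm y}"
    have "open N" unfolding N_def by (intro open_Collect_less continuous_intros)
    moreover have "U \<inter> N = {y \<in> N. 1 * (norm y)\<^sup>2 + (- R\<^sup>2) < 0}"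
      using rR by (auto simp: U N_def sq)
    ultimately show ?thesis
    proof (intro exI conjI ballI)
      show "C1_with_gradient N (\<lambda>y. 1 * (norm y)\<^sup>2 + (- R\<^sup>2)) (\<lambda>x. (2 * 1) *\<^sub>R x)" by (rule C1)
      show "x \<in> N" using x rR by (simp add: N_def)
      show "(2 * 1) *\<^sub>R y \<noteq> 0" if "y \<in> N" for y using that rR by (auto simp: N_def)
    qed
  qed
qed

lemma measure_shell:
  fixes U :: "'a::euclidean_space set"
  assumes U: "U = {x. r < norm x \<and> norm x < R}" and rR: "0 < r" "r < R"
  shows "measure lebesgue U = unit_ball_vol (real DIM('a)) * (R ^ DIM('a) - r ^ DIM('a))"
proof -
  have "U = ball 0 R - cball 0 r" by (auto simp: U)
  then have "measure lebesgue U = measure lebesgue (ball (0::'a) R) - measure lebesgue (cball (0::'a) r)"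
    using rR by (simp only:) (rule measurable_measure_Diff, auto)
  then show ?thesis
    using rR content_ball[of R "0::'a"] content_cball[of r "0::'a"] by (simp add: algebra_simps)
qed

text \<open>For \<open>\<alpha> = \<beta>\<^sup>p\<^sup>-\<^sup>1\<close> both eigenvalues are \<open>-(p-1)\<beta>\<^sup>p\<close> to leading order.  The terms of order \<open>\<beta>\<^sup>p\<^sup>-\<^sup>1\<close>
  carry the largest mean curvature \<open>(n-1)/\<rho>\<close> and \<open>(n-1)/R\<close> of the boundary, and the error is of order
  \<open>\<beta>\<^sup>p\<^sup>-\<^sup>2\<close>.\<close>
lemma eventually_robin_Lambda_ball_less_shell:
  fixes U :: "'a::euclidean_space set"
  assumes dim: "2 \<le> DIM('a)" and p: "1 < p" and U: "U = {x. r < norm x \<and> norm x < R}"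
    and r: "0 < r" "r < R" and \<rho>: "0 < \<rho>" "\<rho> < R"
  shows "\<forall>\<^sub>F \<alpha> in at_top. \<forall>c::'a. robin_Lambda (ball c \<rho>) p \<alpha> < robin_Lambda U p \<alpha>"
proof -
  define m where "m = real (DIM('a) - 1)"
  have m: "0 < m" using dim by (simp add: m_def)
  obtain K where K: "0 \<le> K" "\<And>\<beta> w Dw. 0 < \<beta> \<Longrightarrow> C1_with_gradient UNIV w Dw \<Longrightarrow>
    ennreal (\<beta> powr (p - 1)) * (\<integral>\<^sup>+x. ennreal (\<bar>w x\<bar> powr p) \<partial>surface_measure U)
    \<le> (\<integral>\<^sup>+x. ennreal (norm (Dw x) powr p) \<partial>lebesgue_on U)
      + ennreal ((p - 1) * \<beta> powr p + m / R * \<beta> powr (p - 1) + K * \<beta> powr (p - 2))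
        * (\<integral>\<^sup>+x. ennreal (\<bar>w x\<bar> powr p) \<partial>lebesgue_on U)"
    unfolding m_def using shell_trace_inequality[OF dim U r p] by metis
  have opU: "open U" unfolding U by (intro open_Collect_conj open_Collect_less continuous_intros)
  define \<delta> where "\<delta> = m * (1 / \<rho> - 1 / R)"
  have \<delta>: "0 < \<delta>" using m \<rho> by (simp add: \<delta>_def field_simps)
  \<comment> \<open>for \<open>\<beta> > K / \<delta>\<close> the gap \<open>\<delta> \<beta>\<^sup>p\<^sup>-\<^sup>1\<close> between the curvature terms exceeds the error \<open>K \<beta>\<^sup>p\<^sup>-\<^sup>2\<close>\<close>
  define b where "b = K / \<delta> + 1"
  have b: "0 < b" using K \<delta> by (simp add: b_def add_nonneg_pos)
  have "\<forall>\<^sub>F \<alpha> in at_top. b powr (p - 1) < \<alpha>" by (rule eventually_gt_at_top)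
  then show ?thesis
  proof eventually_elim
    case (elim \<alpha>)
    have \<alpha>: "0 < \<alpha>" using elim b by (smt (verit) powr_gt_zero)
    define \<beta> where "\<beta> = \<alpha> powr (1 / (p - 1))"
    have \<beta>: "0 < \<beta>" using \<alpha> by (simp add: \<beta>_def)
    have \<alpha>\<beta>: "\<beta> powr (p - 1) = \<alpha>" using \<alpha> p by (simp add: \<beta>_def powr_powr)
    have "(b powr (p - 1)) powr (1 / (p - 1)) < \<beta>"
      unfolding \<beta>_def using elim p by (intro powr_less_mono2) auto
    then have "b < \<beta>" using b p by (simp add: powr_powr)
    then have "K / \<delta> < \<beta>" by (simp add: b_def)
    then have K\<beta>: "K < \<delta> * \<beta>" using \<delta> by (simp add: field_simps)
    define \<gamma> where "\<gamma> = \<beta> powr (p - 2)"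
    have \<gamma>: "0 < \<gamma>" "\<alpha> = \<gamma> * \<beta>" "\<beta> powr p = \<gamma> * \<beta> * \<beta>"
      unfolding \<alpha>\<beta>[symmetric] using \<beta> by (auto simp: \<gamma>_def powr_diff power2_eq_square powr_numeral)
    define C where "C = (p - 1) * \<beta> powr p + m / R * \<beta> powr (p - 1) + K * \<beta> powr (p - 2)"
    have C0: "0 \<le> C" using p m K r by (simp add: C_def)
    have lower: "ereal (- C) \<le> robin_Lambda U p \<alpha>"
      using K(2)[OF \<beta>] \<alpha> C0 by (intro robin_Lambda_ge[OF opU p]) (auto simp: \<alpha>\<beta> C_def)
    define h where "h \<epsilon> = \<beta> powr p - \<alpha> * exp (- (p * \<beta> * \<epsilon>)) * (p * \<beta> + m / \<rho>)" for \<epsilon>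
    have "\<gamma> * K < \<gamma> * (\<delta> * \<beta>)" using \<gamma>(1) K\<beta> by (rule mult_strict_left_mono[rotated])
    then have "h 0 < - C"
      unfolding h_def C_def \<alpha>\<beta> \<gamma>(2,3) \<gamma>_def[symmetric] by (simp add: \<delta>_def algebra_simps)
    moreover have "(h \<longlongrightarrow> h 0) (at_right 0)"
      unfolding h_def by (intro tendsto_intros)
    ultimately have "\<forall>\<^sub>F \<epsilon> in at_right 0. h \<epsilon> < - C" by (intro order_tendstoD(2))
    moreover have "\<forall>\<^sub>F \<epsilon> in at_right (0::real). 0 < \<epsilon>" by (rule eventually_at_right_less)
    ultimately obtain \<epsilon> where \<epsilon>: "0 < \<epsilon>" "h \<epsilon> < - C"
      using eventually_happens'[OF trivial_limit_at_right_real eventually_conj] by blast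
    show ?case
    proof
      fix c :: 'a
      have "robin_Lambda (ball c \<rho>) p \<alpha> \<le> ereal (h \<epsilon>)"
        unfolding h_def m_def using \<alpha> by (intro robin_Lambda_ball_le dim p \<rho> \<beta> \<epsilon>) simp
      also have "\<dots> < ereal (- C)" using \<epsilon> by simp
      finally show "robin_Lambda (ball c \<rho>) p \<alpha> < robin_Lambda U p \<alpha>" using lower by (rule order_less_le_trans)
    qed
  qed
qed

theorem mainTheorem6:
  fixes p r \<rho> R :: real and B U :: "'a::euclidean_space set"
  assumes "DIM('a) \<ge> 2"
    and "1 < p"
    and "0 < r" and "r < \<rho>" and "\<rho> < R"
    and "R ^ DIM('a) - r ^ DIM('a) = \<rho> ^ DIM('a)"
    and "B = {x. norm x < \<rho>}"
    and "U = {x. r < norm x \<and> norm x < R}"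
  shows "measure lebesgue B = measure lebesgue U \<and>
    (\<forall>\<^sub>F \<alpha> in at_top.
       robin_Lambda B p \<alpha> < robin_Lambda U p \<alpha> \<and>
       (\<forall>c::'a. \<not> (\<forall>\<Omega> :: 'a set. bounded_C1_domain \<Omega> \<and> measure lebesgue \<Omega> = measure lebesgue (ball c \<rho>) \<longrightarrow>
                   robin_Lambda \<Omega> p \<alpha> \<le> robin_Lambda (ball c \<rho>) p \<alpha>)))"
proof -
  have rR: "r < R" and \<rho>: "0 < \<rho>" using assms by auto
  have B: "B = ball 0 \<rho>" by (auto simp: assms(7))
  have vol: "measure lebesgue U = measure lebesgue (ball c \<rho>)" for c :: 'a
    unfolding measure_shell[OF assms(8,3) rR] assms(6) using \<rho> content_ball[of \<rho> c] by simp
  have dom: "bounded_C1_domain U" by (rule shell_bounded_C1_domain[OF assms(1,8,3) rR])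
  have "\<forall>\<^sub>F \<alpha> in at_top. \<forall>c::'a. robin_Lambda (ball c \<rho>) p \<alpha> < robin_Lambda U p \<alpha>"
    by (rule eventually_robin_Lambda_ball_less_shell[OF assms(1,2,8,3) rR \<rho> assms(5)])
  then have "\<forall>\<^sub>F \<alpha> in at_top.
       robin_Lambda B p \<alpha> < robin_Lambda U p \<alpha> \<and>
       (\<forall>c::'a. \<not> (\<forall>\<Omega> :: 'a set. bounded_C1_domain \<Omega> \<and> measure lebesgue \<Omega> = measure lebesgue (ball c \<rho>) \<longrightarrow>
                   robin_Lambda \<Omega> p \<alpha> \<le> robin_Lambda (ball c \<rho>) p \<alpha>))"
  proof eventually_elim
    case (elim \<alpha>)
    then show ?case using dom vol B by (meson not_le)
  qed
  then show ?thesis using vol[of 0] B by simp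
qed

end
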